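(* Let $s\in(0,1)$, $N\geq 1$ and $p\in[1,2]$. Let $\Omega\subset\mathbb{R}^N$ be a bounded, open, convex set of class $C^{1,1}$, and let $C_0$ be a constant. Suppose the overdetermined problem \[ \begin{cases} (-\Delta)^s u=\lambda_{s,p}(\Omega)\,u^{p-1} & \text{in } \Omega,\\ u=0 & \text{in } \mathbb{R}^N\setminus\Omega,\\ u/\delta^s=C_0 & \text{on } \partial\Omega \end{cases} \] admits a nontrivial nonnegative pointwise solution $u$. Then $\Omega$ is a ball.
   Context: For $\varphi\in C^{1,1}_c(\mathbb{R}^N)$ the fractional Laplacian is $(-\Delta)^s\varphi(x)=c_{N,s}\,\mathrm{p.v.}\int_{\mathbb{R}^N}\frac{\varphi(x)-\varphi(y)}{|x-y|^{N+2s}}\,dy$ with $c_{N,s}=\pi^{-N/2}s4^s\frac{\Gamma(N/2+s)}{\Gamma(1-s)}$. The Gagliardo seminorm is $[u]^2_{H^s(\mathbb{R}^N)}=\frac{c_{N,s}}{2}\iint_{\mathbb{R}^N\times\mathbb{R}^N}\frac{(u(x)-u(y))^2}{|x-y|^{N+2s}}\,dx\,dy$, and $\mathcal{H}^s_0(\Omega)$ is the completion of $C^{0,1}_c(\Omega)$ with respect to this seminorm. The constant $\lambda_{s,p}(\Omega)=\inf\{[u]^2_{H^s(\mathbb{R}^N)}: u\in\mathcal{H}^s_0(\Omega),\ \|u\|^2_{L^p(\Omega)}=1\}$. Here $\delta(x)=\mathrm{dist}(x,\partial\Omega)$, and for $x_0\in\partial\Omega$, $(u/\delta^s)(x_0):=\lim_{x\to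 x_0,\,x\in\Omega}u(x)/\delta(x)^s$. *)

theory Defs
  imports "HOL-Analysis.Analysis"
begin

definition frac_const :: "nat \<Rightarrow> real \<Rightarrow> real" where
  "frac_const N s = pi powr (- real N / 2) * s * 4 powr s * Gamma (real N / 2 + s) / Gamma (1 - s)"

definition frac_kernel :: "real \<Rightarrow> 'a::euclidean_space \<Rightarrow> 'a \<Rightarrow> real" where
  "frac_kernel s x y = 1 / norm (x - y) powr (real DIM('a) + 2 * s)"

definition frac_lap_pv :: "real \<Rightarrow> ('a::euclidean_space \<Rightarrow> real) \<Rightarrow> 'a \<Rightarrow> real \<Rightarrow> bool" where
  "frac_lap_pv s u x L \<longleftrightarrow>
     (\<forall>\<epsilon>>0. set_integrable lborel (- ball x \<epsilon>) (\<lambda>y. (u x - u y) * frac_kernel s x y)) \<and>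
     ((\<lambda>\<epsilon>. frac_const DIM('a) s * (LINT y:(- ball x \<epsilon>)|lborel. (u x - u y) * frac_kernel s x y))
        \<longlongrightarrow> L) (at_right 0)"

definition gagliardo_sq :: "real \<Rightarrow> ('a::euclidean_space \<Rightarrow> real) \<Rightarrow> ennreal" where
  "gagliardo_sq s u = ennreal (frac_const DIM('a) s / 2) *
     (\<integral>\<^sup>+ z. ennreal ((u (fst z) - u (snd z))\<^sup>2 * frac_kernel s (fst z) (snd z)) \<partial>(lborel \<Otimes>\<^sub>M lborel))"

definition lip_c :: "'a::euclidean_space set \<Rightarrow> ('a \<Rightarrow> real) set" where
  "lip_c \<Omega> = {\<phi>. (\<exists>C. C-lipschitz_on UNIV \<phi>) \<and> compact (closure {x. \<phi> x \<noteq> 0})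
                  \<and> closure {x. \<phi> x \<noteq> 0} \<subseteq> \<Omega>}"

text \<open>H^s_0(Omega): completion of C^{0,1}_c(Omega) w.r.t. the Gagliardo seminorm,
  realised as functions (vanishing outside Omega) approximated in the seminorm.\<close>
definition Hs0 :: "real \<Rightarrow> 'a::euclidean_space set \<Rightarrow> ('a \<Rightarrow> real) set" where
  "Hs0 s \<Omega> = {u. u \<in> borel_measurable lborel \<and> (\<forall>x. x \<notin> \<Omega> \<longrightarrow> u x = 0) \<and>
      gagliardo_sq s u < \<infinity> \<and>
      (\<exists>\<phi>. (\<forall>n. \<phi> n \<in> lip_c \<Omega>) \<and> ((\<lambda>n. gagliardo_sq s (\<lambda>x. \<phi> n x - u x)) \<longlonglongrightarrow> 0))}"

definition lambda_sp :: "real \<Rightarrow> real \<Rightarrow> 'a::euclidean_space set \<Rightarrow> real" where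
  "lambda_sp s p \<Omega> = Inf {enn2real (gagliardo_sq s u) | u. u \<in> Hs0 s \<Omega> \<and>
      (\<integral>\<^sup>+ x\<in>\<Omega>. ennreal (\<bar>u x\<bar> powr p) \<partial>lborel) = 1}"

text \<open>u^q with the convention a^0 = 1 (Isabelle has 0 powr 0 = 0).\<close>
definition rpow :: "real \<Rightarrow> real \<Rightarrow> real" where
  "rpow a q = (if q = 0 then 1 else a powr q)"

text \<open>Boundary of class C^{1,1}: near each boundary point, Omega is the strict
  epigraph (in direction of a unit vector e) of a C^{1,1} function on the hyperplane e^\<bottom>.\<close>
definition C11_boundary :: "'a::euclidean_space set \<Rightarrow> bool" where
  "C11_boundary \<Omega> \<longleftrightarrow> (\<forall>x0\<in>frontier \<Omega>. \<exists>r>0. \<exists>e::'a. \<exists>\<gamma>::'a\<Rightarrow>real. \<exists>g::'a\<Rightarrow>'a. \<exists>L.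
      norm e = 1 \<and>
      (\<forall>y\<in>{y. y \<bullet> e = 0}. (\<gamma> has_derivative (\<lambda>h. g y \<bullet> h)) (at y within {y. y \<bullet> e = 0})) \<and>
      (\<forall>y\<in>{y. y \<bullet> e = 0}. \<forall>z\<in>{y. y \<bullet> e = 0}. norm (g y - g z) \<le> L * norm (y - z)) \<and>
      \<Omega> \<inter> ball x0 r = {x \<in> ball x0 r. x \<bullet> e > \<gamma> (x - (x \<bullet> e) *\<^sub>R e)})"

definition bdist :: "'a::euclidean_space set \<Rightarrow> 'a \<Rightarrow> real" where
  "bdist \<Omega> x = infdist x (frontier \<Omega>)"

end

theory Submission
  imports Defs "HOL-Real_Asymp.Real_Asymp"
begin

text \<open>
  The proof is a moving plane argument in which the following three observations replace the usual
  machinery (narrow domains, boundary regularity of $u/\delta^s$, Serrin's corner lemma).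

  \<^item> For $p \le 2$ the right-hand side is sublinear, so comparison is immediate: if $t = \max v/u > 1$, then
    $tu - v$ touches zero from above at a point where its fractional Laplacian is nonnegative. By
    antisymmetry the same works on a half space when $v$ is a reflected copy of $u$, and up to an error
    of order $1-k$ when the reflected copy is in addition contracted by a factor $k < 1$.

  \<^item> The largest cap of $\Omega$ that can be reflected into $\Omega$ defines a critical plane. Reflect at a plane slightly
    beyond it and contract the image by the factor $k$ for which it just fits into $\Omega$. It then touches
    $\partial\Omega$ at a point $y$ at positive distance $d$ from the plane. Since $\Omega$ has interior tangent balls of a fixed
    radius, its normal is Lipschitz, and this forces $1 - k = O(d^2)$ when $d$ is small.

  \<^item> If $u$ were not symmetric about the critical plane, the difference $W$ of $u$ and the contracted reflected
    copy would be bounded below on a fixed ball. Comparison with the barrier $(\rho^2 - |x-q|^2)_+^s$ in a ball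
    of radius proportional to $d$ tangent at $y$ gives $W \ge c\, d^{1+s} \delta^s$ along the normal at $y$. The boundary
    condition shows that $W/\delta^s$ has a limit of order $1-k$ there, which is a contradiction. Interior
    tangency and the corner case are thus treated alike.

  Hence $\Omega$ is symmetric about some hyperplane orthogonal to any given direction, so it is a ball.
\<close>

section \<open>Reflections and polar coordinates\<close>

text \<open>The contradiction is a race of exponents. The Hopf estimate at the contact point has one
  factor d from the difference between the kernel and its mirror image, and a factor of order d^s
  from the radius of the barrier ball; the boundary condition leaves only O(1-k). Since s < 1, a gap
  O(d^2) loses against d^(1+s). If d stays away from 0, then 1-k is small because the plane is close
  to the critical one, so nothing need be known about d. At the critical plane itself contact may
  occur on the plane, where d = 0 and the barrier ball shrinks to nothing; shift and contraction
  replace it by contact off the plane. The price is a factor k^(-2s) in the equation of the copy and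
  the loss of antisymmetry. Pure contraction is therefore compared first, and its error O(1-k)
  bounds the defect of antisymmetry. The barrier is the classical function whose fractional
  Laplacian is constant in the ball. Only an upper bound for its truncated integrals is needed,
  independent of the ball and of the point; it comes from integration along lines through the
  point.\<close>

lemma nn_integral_lborel_affine:
  fixes f :: "'a::euclidean_space \<Rightarrow> ennreal" and t :: 'a and c :: real
  assumes [measurable]: "f \<in> borel_measurable borel" and "c \<noteq> 0"
  shows "(\<integral>\<^sup>+x. f x \<partial>lborel) = ennreal (\<bar>c\<bar> ^ DIM('a)) * (\<integral>\<^sup>+x. f (t + c *\<^sub>R x) \<partial>lborel)"
  by (subst lborel_affine[OF assms(2), of t])
     (simp add: nn_integral_density nn_integral_distr nn_integral_cmult)

lemma nn_integral_lborel_translate: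
  fixes f :: "'a::euclidean_space \<Rightarrow> ennreal"
  assumes "f \<in> borel_measurable borel"
  shows "(\<integral>\<^sup>+x. f (t + x) \<partial>lborel) = (\<integral>\<^sup>+x. f x \<partial>lborel)"
  using nn_integral_lborel_affine[OF assms, of 1 t] by simp

lemma nn_integral_lborel_reflect_point:
  fixes f :: "'a::euclidean_space \<Rightarrow> ennreal"
  assumes "f \<in> borel_measurable borel"
  shows "(\<integral>\<^sup>+x. f (t - x) \<partial>lborel) = (\<integral>\<^sup>+x. f x \<partial>lborel)"
  using nn_integral_lborel_affine[OF assms, of "-1" t] by simp

text \<open>Uniqueness of the translation-invariant measure: for nonnegative $f$, $h$ the double integral of
  $f(gx)\,h(y)$ is unchanged when $f$ and $h$ are exchanged; then take for $h$ the indicator of a ball.\<close>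

lemma nn_integral_lborel_linear_isometry:
  fixes g :: "'a::euclidean_space \<Rightarrow> 'a" and f :: "'a \<Rightarrow> ennreal"
  assumes "linear g" and iso: "\<And>x. norm (g x) = norm x" and [measurable]: "f \<in> borel_measurable borel"
  shows "(\<integral>\<^sup>+x. f (g x) \<partial>lborel) = (\<integral>\<^sup>+x. f x \<partial>lborel)"
proof -
  interpret linear g by fact
  have "continuous_on UNIV g" using \<open>linear g\<close> by (simp add: linear_continuous_on linear_conv_bounded_linear)
  then have g[measurable]: "g \<in> borel_measurable borel" by (rule borel_measurable_continuous_onI)
  have "inj g"
    by (metis \<open>linear g\<close> injI iso linear_injective_0 norm_eq_zero)
  then have "surj g" using \<open>linear g\<close> linear_injective_imp_surjective by blast
  define h :: "'a \<Rightarrow> ennreal" where "h = indicator (ball 0 1)"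
  have [measurable]: "h \<in> borel_measurable borel" unfolding h_def
    by (rule borel_measurable_indicator) (rule borel_open[OF open_ball])
  have hg: "h (g x) = h x" for x by (simp add: h_def indicator_def iso)
  have "(\<integral>\<^sup>+x. f (g x) \<partial>lborel) * (\<integral>\<^sup>+y. h y \<partial>lborel)
      = (\<integral>\<^sup>+x. \<integral>\<^sup>+y. f (g x) * h y \<partial>lborel \<partial>lborel)"
    by (simp add: nn_integral_cmult nn_integral_multc)
  also have "\<dots> = (\<integral>\<^sup>+x. \<integral>\<^sup>+y. f (g x) * h (g x + y) \<partial>lborel \<partial>lborel)"
  proof (rule nn_integral_cong)
    fix x
    have "(\<integral>\<^sup>+y. f (g x) * h (g x + y) \<partial>lborel) = (\<integral>\<^sup>+y. f (g x) * h y \<partial>lborel)"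
      by (rule nn_integral_lborel_translate[where f="\<lambda>y. f (g x) * h y"]) measurable
    then show "(\<integral>\<^sup>+y. f (g x) * h y \<partial>lborel) = (\<integral>\<^sup>+y. f (g x) * h (g x + y) \<partial>lborel)" by simp
  qed
  also have "\<dots> = (\<integral>\<^sup>+y. \<integral>\<^sup>+x. f (g x) * h (g x + y) \<partial>lborel \<partial>lborel)"
    by (intro lborel_pair.Fubini') measurable
  also have "\<dots> = (\<integral>\<^sup>+y. \<integral>\<^sup>+x. f (g x - y) * h (g x) \<partial>lborel \<partial>lborel)"
  proof (rule nn_integral_cong)
    fix y :: 'a
    obtain y' where y: "y = g y'" using \<open>surj g\<close> by (metis surjD)
    have "(\<integral>\<^sup>+x. f (g x) * h (g x + y) \<partial>lborel)
        = (\<integral>\<^sup>+x. f (g (- y' + x)) * h (g (- y' + x) + y) \<partial>lborel)"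
      by (rule nn_integral_lborel_translate[symmetric]) measurable
    also have "\<dots> = (\<integral>\<^sup>+x. f (g x - y) * h (g x) \<partial>lborel)"
      by (intro nn_integral_cong) (simp add: y add diff neg)
    finally show "(\<integral>\<^sup>+x. f (g x) * h (g x + y) \<partial>lborel) = (\<integral>\<^sup>+x. f (g x - y) * h (g x) \<partial>lborel)" .
  qed
  also have "\<dots> = (\<integral>\<^sup>+x. \<integral>\<^sup>+y. f (g x - y) * h (g x) \<partial>lborel \<partial>lborel)"
    by (intro lborel_pair.Fubini') measurable
  also have "\<dots> = (\<integral>\<^sup>+x. (\<integral>\<^sup>+y. f y \<partial>lborel) * h x \<partial>lborel)"
    by (intro nn_integral_cong, subst nn_integral_multc, simp)
       (simp add: nn_integral_lborel_reflect_point hg)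
  also have "\<dots> = (\<integral>\<^sup>+y. f y \<partial>lborel) * (\<integral>\<^sup>+y. h y \<partial>lborel)"
    by (simp add: nn_integral_cmult)
  finally have *: "(\<integral>\<^sup>+x. f (g x) \<partial>lborel) * (\<integral>\<^sup>+y. h y \<partial>lborel)
      = (\<integral>\<^sup>+y. f y \<partial>lborel) * (\<integral>\<^sup>+y. h y \<partial>lborel)" .
  have "emeasure lborel (ball (0::'a) 1) = ennreal (measure lborel (ball (0::'a) 1))"
    by (rule emeasure_eq_ennreal_measure) (use emeasure_lborel_ball_finite[of "0::'a" 1] in auto)
  moreover have "measure lborel (ball (0::'a) 1) > 0" by (rule content_ball_pos) simp
  ultimately obtain c where c: "c > 0" "(\<integral>\<^sup>+y. h y \<partial>lborel) = ennreal c"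
    unfolding h_def by auto
  \<comment> \<open>Multiplication in \<open>ennreal\<close> cancels only for factors that are
    neither 0 nor infinite; the indicator of a ball provides such a factor.\<close>
  have cancel: "(z * ennreal c) * ennreal (1 / c) = z" for z :: ennreal
    using c by (simp add: mult.assoc ennreal_mult[symmetric])
  show ?thesis using arg_cong[OF *, of "\<lambda>z. z * ennreal (1 / c)"] by (simp only: c(2) cancel)
qed

section \<open>Reflections in hyperplanes and their invariance properties\<close>

definition hrefl :: "'a::real_inner \<Rightarrow> real \<Rightarrow> 'a \<Rightarrow> 'a" where
  "hrefl e \<mu> x = x - (2 * (x \<bullet> e - \<mu>)) *\<^sub>R e"

lemma hrefl_inner:
  assumes "norm e = 1" shows "hrefl e \<mu> x \<bullet> e = 2 * \<mu> - x \<bullet> e"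
  using assms by (simp add: hrefl_def inner_diff_left dot_square_norm)

lemma hrefl_hrefl [simp]:
  assumes "norm e = 1" shows "hrefl e \<mu> (hrefl e \<mu> x) = x"
  unfolding hrefl_def[of e \<mu> "hrefl e \<mu> x"] hrefl_inner[OF assms]
  by (simp add: hrefl_def algebra_simps)

lemma norm_add_scaleR_sq:
  fixes a e :: "'a::real_inner"
  assumes "norm e = 1" shows "(norm (a + c *\<^sub>R e))\<^sup>2 = (norm a)\<^sup>2 + 2 * c * (a \<bullet> e) + c\<^sup>2"
proof -
  have "e \<bullet> e = 1" using assms by (simp add: dot_square_norm)
  then show ?thesis unfolding power2_norm_eq_inner
    by (simp add: inner_add_left inner_add_right inner_commute[of e a] power2_eq_square algebra_simps)
qed

lemma norm_hrefl_diff: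
  assumes "norm e = 1" shows "norm (hrefl e \<mu> x - hrefl e \<mu> y) = norm (x - y)"
proof -
  have "hrefl e \<mu> x - hrefl e \<mu> y = (x - y) + (- 2 * ((x - y) \<bullet> e)) *\<^sub>R e"
    by (simp add: hrefl_def algebra_simps)
  then have "(norm (hrefl e \<mu> x - hrefl e \<mu> y))\<^sup>2 = (norm (x - y))\<^sup>2"
    by (simp only: norm_add_scaleR_sq[OF assms]) (simp add: power2_eq_square)
  then show ?thesis by simp
qed

text \<open>The source of the signs in the moving plane argument: the excess of the squared distance
  is a product of the two signed distances to the plane, so a mirror image is farther away when both
  points lie on the same side.\<close>

lemma norm_diff_hrefl:
  assumes "norm e = 1"
  shows "(norm (x - hrefl e \<mu> y))\<^sup>2 = (norm (x - y))\<^sup>2 + 4 * (\<mu> - x \<bullet> e) * (\<mu> - y \<bullet> e)"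
proof -
  have "x - hrefl e \<mu> y = (x - y) + (2 * (y \<bullet> e - \<mu>)) *\<^sub>R e" by (simp add: hrefl_def)
  then show ?thesis
    by (simp only: norm_add_scaleR_sq[OF assms])
       (simp add: inner_diff_left power2_eq_square algebra_simps)
qed

text \<open>\<open>hrefl e 0\<close> is the linear part: it reflects vectors, in particular normals,
  whereas \<open>hrefl e \<mu>\<close> reflects points.\<close>

lemma hrefl_eq_linear: "hrefl e \<mu> x = (2 * \<mu>) *\<^sub>R e + hrefl e 0 x"
  by (simp add: hrefl_def algebra_simps)

lemma continuous_on_hrefl [continuous_intros]: "continuous_on A (hrefl e \<mu>)"
  unfolding hrefl_def by (intro continuous_intros)

lemma measurable_hrefl [measurable]: "hrefl e \<mu> \<in> borel_measurable (borel :: 'a::euclidean_space measure)"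
  by (rule borel_measurable_continuous_onI) (rule continuous_on_hrefl)

lemma nn_integral_hrefl:
  fixes f :: "'a::euclidean_space \<Rightarrow> ennreal"
  assumes e: "norm e = 1" and [measurable]: "f \<in> borel_measurable borel"
  shows "(\<integral>\<^sup>+x. f (hrefl e \<mu> x) \<partial>lborel) = (\<integral>\<^sup>+x. f x \<partial>lborel)"
proof -
  have lin: "linear (hrefl e 0)"
    by (rule linearI) (simp_all add: hrefl_def inner_add_left algebra_simps)
  have iso: "norm (hrefl e 0 x) = norm x" for x
    using norm_hrefl_diff[OF e, of 0 x 0] by (simp add: hrefl_def)
  have "(\<integral>\<^sup>+x. f (hrefl e \<mu> x) \<partial>lborel) = (\<integral>\<^sup>+x. f ((2 * \<mu>) *\<^sub>R e + hrefl e 0 x) \<partial>lborel)"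
    by (subst hrefl_eq_linear) simp
  also have "\<dots> = (\<integral>\<^sup>+x. f ((2 * \<mu>) *\<^sub>R e + x) \<partial>lborel)"
    by (rule nn_integral_lborel_linear_isometry[OF lin iso]) measurable
  also have "\<dots> = (\<integral>\<^sup>+x. f x \<partial>lborel)" by (rule nn_integral_lborel_translate) measurable
  finally show ?thesis .
qed

lemma distr_lborel_hrefl:
  assumes "norm e = 1"
  shows "distr lborel borel (hrefl e \<mu>) = (lborel :: 'a::euclidean_space measure)"
proof (rule measure_eqI)
  fix A :: "'a set" assume "A \<in> sets (distr lborel borel (hrefl e \<mu>))"
  then have [measurable]: "A \<in> sets borel" by simp
  have "emeasure (distr lborel borel (hrefl e \<mu>)) A = (\<integral>\<^sup>+x. indicator A x \<partial>distr lborel borel (hrefl e \<mu>))"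
    by simp
  also have "\<dots> = (\<integral>\<^sup>+x. indicator A (hrefl e \<mu> x) \<partial>lborel)"
    by (subst nn_integral_distr) auto
  also have "\<dots> = emeasure lborel A" by (subst nn_integral_hrefl[OF assms]) auto
  finally show "emeasure (distr lborel borel (hrefl e \<mu>)) A = emeasure lborel A" .
qed simp

text \<open>By scale invariance of dr/r the mass of [a, 2a] is ln 2 for every a; this is the factor
  \<open>ln 2\<close> in the polar coordinates below.\<close>

lemma nn_integral_inverse_interval:
  assumes "0 < a" "a \<le> b"
  shows "(\<integral>\<^sup>+r. ennreal (1 / r) * indicator {a..b} r \<partial>lborel) = ennreal (ln b - ln a)"
  using assms
  by (intro nn_integral_FTC_Icc) (auto intro!: derivative_eq_intros simp: has_real_derivative_iff_has_vector_derivative[symmetric] divide_simps)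

text \<open>Polar coordinates, with the sphere replaced by the annulus $1 \le |\omega| < 2$ so that only
  Lebesgue measure is needed.\<close>

lemma nn_integral_polar:
  fixes f :: "'a::euclidean_space \<Rightarrow> ennreal"
  assumes [measurable]: "f \<in> borel_measurable borel"
  shows "ennreal (ln 2) * (\<integral>\<^sup>+z. f z \<partial>lborel) =
    (\<integral>\<^sup>+\<omega>. indicator {\<omega>. 1 \<le> norm \<omega> \<and> norm \<omega> \<le> 2} \<omega> * ennreal (1 / norm \<omega> ^ DIM('a)) *
      (\<integral>\<^sup>+r. indicator {0<..} r * ennreal (r ^ (DIM('a) - 1)) * f (r *\<^sub>R (\<omega> /\<^sub>R norm \<omega>)) \<partial>lborel) \<partial>lborel)"
proof -
  let ?N = "DIM('a)"
  let ?A = "{\<omega>::'a. 1 \<le> norm \<omega> \<and> norm \<omega> \<le> 2}"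
  have [measurable]: "?A \<in> sets borel" by measurable
  have N: "?N = Suc (?N - 1)" using DIM_positive[where 'a='a] by simp
  \<comment> \<open>Replacing r by |\<omega>| r removes the normalisation of \<omega>; the weight
    1/|\<omega>|^N cancels the powers of |\<omega>| that come out.\<close>
  have inner: "ennreal (1 / norm \<omega> ^ ?N) *
      (\<integral>\<^sup>+r. indicator {0<..} r * ennreal (r ^ (?N - 1)) * f (r *\<^sub>R (\<omega> /\<^sub>R norm \<omega>)) \<partial>lborel)
    = (\<integral>\<^sup>+r. indicator {0<..} r * ennreal (r ^ (?N - 1)) * f (r *\<^sub>R \<omega>) \<partial>lborel)" if "\<omega> \<in> ?A" for \<omega>
  proof -
    from that have n: "norm \<omega> > 0" by auto
    have "(\<integral>\<^sup>+r. indicator {0<..} r * ennreal (r ^ (?N - 1)) * f (r *\<^sub>R (\<omega> /\<^sub>R norm \<omega>)) \<partial>lborel)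
      = ennreal (norm \<omega>) * (\<integral>\<^sup>+r. indicator {0<..} (norm \<omega> * r) * ennreal ((norm \<omega> * r) ^ (?N - 1)) * f ((norm \<omega> * r) *\<^sub>R (\<omega> /\<^sub>R norm \<omega>)) \<partial>lborel)"
      using n by (subst nn_integral_lborel_affine[where t=0 and c="norm \<omega>"]) auto
    also have "(\<integral>\<^sup>+r. indicator {0<..} (norm \<omega> * r) * ennreal ((norm \<omega> * r) ^ (?N - 1)) * f ((norm \<omega> * r) *\<^sub>R (\<omega> /\<^sub>R norm \<omega>)) \<partial>lborel)
      = (\<integral>\<^sup>+r. ennreal (norm \<omega> ^ (?N - 1)) * (indicator {0<..} r * ennreal (r ^ (?N - 1)) * f (r *\<^sub>R \<omega>)) \<partial>lborel)"
      using n by (intro nn_integral_cong)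
        (auto simp: indicator_def zero_less_mult_iff power_mult_distrib ennreal_mult mult_ac)
    also have "\<dots> = ennreal (norm \<omega> ^ (?N - 1)) * (\<integral>\<^sup>+r. (indicator {0<..} r * ennreal (r ^ (?N - 1)) * f (r *\<^sub>R \<omega>)) \<partial>lborel)"
      by (rule nn_integral_cmult) measurable
    finally have "(\<integral>\<^sup>+r. indicator {0<..} r * ennreal (r ^ (?N - 1)) * f (r *\<^sub>R (\<omega> /\<^sub>R norm \<omega>)) \<partial>lborel)
      = ennreal (norm \<omega> ^ ?N) * (\<integral>\<^sup>+r. (indicator {0<..} r * ennreal (r ^ (?N - 1)) * f (r *\<^sub>R \<omega>)) \<partial>lborel)"
      using n by (subst N, unfold power_Suc) (simp add: ennreal_mult mult.assoc)
    moreover have "ennreal (1 / norm \<omega> ^ ?N) * (ennreal (norm \<omega> ^ ?N) * x) = x" for x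
      using n by (simp add: mult.assoc[symmetric] ennreal_mult[symmetric])
    ultimately show ?thesis by simp
  qed
  have "(\<integral>\<^sup>+\<omega>. indicator ?A \<omega> * ennreal (1 / norm \<omega> ^ ?N) *
      (\<integral>\<^sup>+r. indicator {0<..} r * ennreal (r ^ (?N - 1)) * f (r *\<^sub>R (\<omega> /\<^sub>R norm \<omega>)) \<partial>lborel) \<partial>lborel)
    = (\<integral>\<^sup>+\<omega>. \<integral>\<^sup>+r. indicator ?A \<omega> * (indicator {0<..} r * ennreal (r ^ (?N - 1)) * f (r *\<^sub>R \<omega>)) \<partial>lborel \<partial>lborel)"
  proof (rule nn_integral_cong)
    fix \<omega> :: 'a
    show "indicator ?A \<omega> * ennreal (1 / norm \<omega> ^ ?N) *
      (\<integral>\<^sup>+r. indicator {0<..} r * ennreal (r ^ (?N - 1)) * f (r *\<^sub>R (\<omega> /\<^sub>R norm \<omega>)) \<partial>lborel)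
      = (\<integral>\<^sup>+r. indicator ?A \<omega> * (indicator {0<..} r * ennreal (r ^ (?N - 1)) * f (r *\<^sub>R \<omega>)) \<partial>lborel)"
    proof (cases "\<omega> \<in> ?A")
      case True
      then have i: "indicator ?A \<omega> = (1::ennreal)" by simp
      show ?thesis unfolding i mult_1_left by (rule inner[OF True])
    next
      case False
      then show ?thesis by simp
    qed
  qed
  also have "\<dots> = (\<integral>\<^sup>+r. \<integral>\<^sup>+\<omega>. indicator ?A \<omega> * (indicator {0<..} r * ennreal (r ^ (?N - 1)) * f (r *\<^sub>R \<omega>)) \<partial>lborel \<partial>lborel)"
    by (intro lborel_pair.Fubini'[symmetric]) measurable
  \<comment> \<open>Now z = r \<omega> for fixed r. After the next exchange of integrals z is fixed,
    and the r with z/r in the annulus fill [|z|/2, |z|], of mass ln 2 for dr/r.\<close>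
  also have "\<dots> = (\<integral>\<^sup>+r. \<integral>\<^sup>+z. indicator {0<..} r * ennreal (1 / r) * indicator ?A (z /\<^sub>R r) * f z \<partial>lborel \<partial>lborel)"
  proof (rule nn_integral_cong)
    fix r :: real
    show "(\<integral>\<^sup>+\<omega>. indicator ?A \<omega> * (indicator {0<..} r * ennreal (r ^ (?N - 1)) * f (r *\<^sub>R \<omega>)) \<partial>lborel)
      = (\<integral>\<^sup>+z. indicator {0<..} r * ennreal (1 / r) * indicator ?A (z /\<^sub>R r) * f z \<partial>lborel)"
    proof (cases "r > 0")
      case True
      have "(\<integral>\<^sup>+z. indicator {0<..} r * ennreal (1 / r) * indicator ?A (z /\<^sub>R r) * f z \<partial>lborel)
        = ennreal (r ^ ?N) * (\<integral>\<^sup>+z. indicator {0<..} r * ennreal (1 / r) * indicator ?A z * f (r *\<^sub>R z) \<partial>lborel)"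
        using True by (subst nn_integral_lborel_affine[where t=0 and c=r]) auto
      also have "\<dots> = (\<integral>\<^sup>+z. ennreal (r ^ ?N) * (indicator {0<..} r * ennreal (1 / r) * indicator ?A z * f (r *\<^sub>R z)) \<partial>lborel)"
        by (rule nn_integral_cmult[symmetric]) measurable
      also have "\<dots> = (\<integral>\<^sup>+\<omega>. indicator ?A \<omega> * (indicator {0<..} r * ennreal (r ^ (?N - 1)) * f (r *\<^sub>R \<omega>)) \<partial>lborel)"
      proof (rule nn_integral_cong)
        fix z :: 'a
        have "ennreal (r ^ ?N) * ennreal (1 / r) = ennreal (r ^ (?N - 1))"
          using True by (subst N) (simp add: ennreal_mult[symmetric] del: Suc_pred)
        then have "ennreal (r ^ ?N) * (1 * ennreal (1 / r) * y) = 1 * ennreal (r ^ (?N - 1)) * y" for y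
          by (simp add: mult.assoc[symmetric])
        from this[of "indicator ?A z * f (r *\<^sub>R z)"]
        show "ennreal (r ^ ?N) * (indicator {0<..} r * ennreal (1 / r) * indicator ?A z * f (r *\<^sub>R z))
          = indicator ?A z * (indicator {0<..} r * ennreal (r ^ (?N - 1)) * f (r *\<^sub>R z))"
          using True by (cases "z \<in> ?A") (simp_all add: mult_ac)
      qed
      finally show ?thesis by simp
    qed simp
  qed
  also have "\<dots> = (\<integral>\<^sup>+z. \<integral>\<^sup>+r. indicator {0<..} r * ennreal (1 / r) * indicator ?A (z /\<^sub>R r) * f z \<partial>lborel \<partial>lborel)"
    by (intro lborel_pair.Fubini') measurable
  also have "\<dots> = (\<integral>\<^sup>+z. ennreal (ln 2) * f z \<partial>lborel)"
  proof (rule nn_integral_cong_AE)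
    have "AE z in lborel. z \<noteq> (0::'a)" by (rule AE_lborel_singleton)
    then show "AE z in lborel. (\<integral>\<^sup>+r. indicator {0<..} r * ennreal (1 / r) * indicator ?A (z /\<^sub>R r) * f z \<partial>lborel) = ennreal (ln 2) * f z"
    proof eventually_elim
      fix z :: 'a assume "z \<noteq> 0"
      have "(\<integral>\<^sup>+r. indicator {0<..} r * ennreal (1 / r) * indicator ?A (z /\<^sub>R r) * f z \<partial>lborel)
        = (\<integral>\<^sup>+r. ennreal (1 / r) * indicator {norm z / 2..norm z} r * f z \<partial>lborel)"
        using \<open>z \<noteq> 0\<close> by (intro nn_integral_cong) (auto simp: indicator_def field_simps)
      also have "\<dots> = (\<integral>\<^sup>+r. ennreal (1 / r) * indicator {norm z / 2..norm z} r \<partial>lborel) * f z"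
        by (rule nn_integral_multc) measurable
      also have "\<dots> = ennreal (ln 2) * f z"
        using \<open>z \<noteq> 0\<close> by (subst nn_integral_inverse_interval) (auto simp: ln_div)
      finally show "(\<integral>\<^sup>+r. indicator {0<..} r * ennreal (1 / r) * indicator ?A (z /\<^sub>R r) * f z \<partial>lborel) = ennreal (ln 2) * f z" .
    qed
  qed
  also have "\<dots> = ennreal (ln 2) * (\<integral>\<^sup>+z. f z \<partial>lborel)"
    by (rule nn_integral_cmult) measurable
  finally show ?thesis by simp
qed

section \<open>A one-dimensional integral\<close>

text \<open>After division by (x + y)^s the claim reduces to t <= t^s on [0,1].\<close>

lemma powr_add_le_add_powr:
  fixes x y s :: real
  assumes "0 \<le> x" "0 \<le> y" "0 < s" "s \<le> 1"
  shows "(x + y) powr s \<le> x powr s + y powr s"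
proof (cases "x + y = 0")
  case False
  then have p: "x + y > 0" using assms by simp
  have le: "t \<le> t powr s" if "0 \<le> t" "t \<le> 1" for t
    using that assms powr_mono'[of s 1 t] by (cases "t = 0") auto
  have "1 = x / (x + y) + y / (x + y)" using p by (simp flip: add_divide_distrib)
  also have "\<dots> \<le> (x / (x + y)) powr s + (y / (x + y)) powr s"
    using assms p by (intro add_mono le) (auto simp: field_simps)
  also have "\<dots> = (x powr s + y powr s) / (x + y) powr s"
    using assms p by (simp add: powr_divide add_divide_distrib)
  finally show ?thesis using p by (simp add: field_simps)
qed (use assms in auto)

text \<open>Concavity of t^s, used through the tangent at the mean c; that the tangent lies above
  the graph is Young's inequality with weights s and 1 - s.\<close>

lemma powr_mean_le:
  fixes x y s :: real
  assumes "0 \<le> x" "0 \<le> y" "0 < s" "s \<le> 1"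
  shows "x powr s + y powr s \<le> 2 * ((x + y) / 2) powr s"
proof (cases "x + y = 0")
  case True
  then have "x = 0" "y = 0" using assms by auto
  then show ?thesis by simp
next
  case False
  define c where "c = (x + y) / 2"
  have c: "c > 0" using False assms by (simp add: c_def)
  have tangent: "t powr s \<le> c powr s * (1 + s * (t / c - 1))" if "t \<ge> 0" for t
  proof -
    have "(t / c) powr s \<le> 1 + s * (t / c - 1)"
    proof (cases "t = 0")
      case False
      then have "t / c > 0" using that c by simp
      then have "(t / c) powr s * 1 powr (1 - s) \<le> s * (t / c) + (1 - s) * 1"
        using assms by (intro Youngs_inequality_0) auto
      then show ?thesis by (simp add: algebra_simps)
    qed (use assms in auto)
    then have "c powr s * (t / c) powr s \<le> c powr s * (1 + s * (t / c - 1))"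
      by (rule mult_left_mono) simp
    then show ?thesis using c that by (simp add: powr_divide)
  qed
  have "x powr s + y powr s \<le> c powr s * (2 + s * ((x + y) / c - 2))"
    using tangent[OF assms(1)] tangent[OF assms(2)] by (simp add: algebra_simps add_divide_distrib)
  also have "(x + y) / c = 2"
  proof -
    have "x + y = 2 * c" by (simp add: c_def)
    then show ?thesis using c by simp
  qed
  finally show ?thesis by (simp add: c_def mult.commute)
qed

lemma DERIV_powr_tail:
  fixes s r :: real
  assumes "0 < s" "0 < r"
  shows "((\<lambda>r. - (r powr (- 2 * s) / (2 * s))) has_real_derivative r powr (-1 - 2 * s)) (at r)"
proof -
  have "((\<lambda>x. (- 1 / (2 * s)) * x powr (- 2 * s)) has_real_derivative
      (- 1 / (2 * s)) * (- 2 * s * r powr (- 2 * s - 1))) (at r)"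
    by (intro DERIV_cmult has_real_derivative_powr assms)
  moreover have "r powr (- 2 * s - 1) = r powr (-1 - 2 * s)" by (rule arg_cong) simp
  then have "(- 1 / (2 * s)) * (- 2 * s * r powr (- 2 * s - 1)) = r powr (-1 - 2 * s)"
    using assms by simp
  ultimately show ?thesis by simp
qed

lemma has_integral_powr_tail:
  fixes s a b :: real
  assumes "0 < s" "0 < a" "a \<le> b"
  shows "((\<lambda>r. r powr (-1 - 2 * s)) has_integral (a powr (- 2 * s) - b powr (- 2 * s)) / (2 * s)) {a..b}"
proof -
  have "((\<lambda>r. r powr (-1 - 2 * s)) has_integral
      (- (b powr (- 2 * s) / (2 * s))) - (- (a powr (- 2 * s) / (2 * s)))) {a..b}"
  proof (rule fundamental_theorem_of_calculus)
    fix x assume "x \<in> {a..b}"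
    then have "((\<lambda>r. - (r powr (- 2 * s) / (2 * s))) has_real_derivative x powr (-1 - 2 * s)) (at x)"
      using assms by (intro DERIV_powr_tail) auto
    then show "((\<lambda>r. - (r powr (- 2 * s) / (2 * s))) has_vector_derivative x powr (-1 - 2 * s)) (at x within {a..b})"
      unfolding has_real_derivative_iff_has_vector_derivative[symmetric] by (rule has_field_derivative_at_within)
  qed (use assms in auto)
  then show ?thesis by (simp add: diff_divide_distrib)
qed

text \<open>The barrier (\<rho>^2 - |y - q|^2)_+^s on a line through an interior point x, with its
  value at x scaled to 1 and r measured in units of the square root of \<rho>^2 - |x - q|^2; m
  records position and direction.\<close>

definition quad_profile :: "real \<Rightarrow> real \<Rightarrow> real \<Rightarrow> real" where
  "quad_profile s m r = (max 0 (1 + 2 * m * r - r\<^sup>2)) powr s"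

lemma continuous_on_quad_profile [continuous_intros]:
  assumes "0 < s" "continuous_on A f"
  shows "continuous_on A (\<lambda>r. quad_profile s m (f r))"
  unfolding quad_profile_def
  by (rule continuous_on_powr') (use assms in \<open>auto intro!: continuous_intros\<close>)

lemma quad_profile_nonneg: "0 \<le> quad_profile s m r"
  by (simp add: quad_profile_def)

text \<open>With $x = 1/t^2 \pm 2m/t - 1$ the two halves of the integral add up to the integral of
  $x^s/(x+1)$, in which $m$ no longer occurs.\<close>

lemma quad_profile_integral_lower:
  fixes s m X :: real
  assumes s: "0 < s" "s < 1" and m: "0 \<le> m" and X: "1 \<le> X"
  defines "f \<equiv> \<lambda>r. quad_profile s m r * r powr (-1 - 2 * s)"
  defines "g \<equiv> \<lambda>r. quad_profile s m (- r) * r powr (-1 - 2 * s)"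
  defines "b \<equiv> sqrt (1 + m\<^sup>2) + m"
  shows "X powr s / s - (1 / s + 1 / (1 - s))
    \<le> integral {1 / (sqrt (X + (1 + m\<^sup>2)) - m)..b} f + integral {1 / (sqrt (X + (1 + m\<^sup>2)) + m)..b} g"
proof -
  define c where "c = 1 + m\<^sup>2"
  define \<sigma> where "\<sigma> x = sqrt (x + c)" for x
  \<comment> \<open>b is the positive zero of 1 + 2mr - r^2, the value of r that corresponds to x =
    0. The other profile vanishes already beyond sqrt (1 + m^2) - m, so b can serve as the upper
    limit of both integrals.\<close>
  define A where "A x = integral {1 / (\<sigma> x - m)..b} f" for x
  define B where "B x = integral {1 / (\<sigma> x + m)..b} g" for x
  have f_nonneg: "f r \<ge> 0" and g_nonneg: "g r \<ge> 0" for r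
    by (auto simp: f_def g_def quad_profile_nonneg)
  have cont: "continuous_on {l..b} f" "continuous_on {l..b} g" if "l > 0" for l
    unfolding f_def g_def using that s by (auto intro!: continuous_intros)
  have \<sigma>: "\<sigma> x > m" "\<sigma> x \<ge> 1" "(\<sigma> x)\<^sup>2 = x + c" "\<sigma> x > sqrt c" if "x > 0" for x
  proof -
    show "\<sigma> x > sqrt c" using that by (simp add: \<sigma>_def)
    show "\<sigma> x > m" unfolding \<sigma>_def using that m by (intro real_less_rsqrt) (simp add: c_def)
    show "\<sigma> x \<ge> 1" unfolding \<sigma>_def using that by (intro real_le_rsqrt) (simp add: c_def)
    show "(\<sigma> x)\<^sup>2 = x + c" using that by (simp add: \<sigma>_def c_def add_nonneg_nonneg)
  qed
  have sqc: "sqrt c > m" unfolding c_def by (rule real_less_rsqrt) simp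
  have bc: "b * (sqrt c - m) = 1"
  proof -
    have "(sqrt c)\<^sup>2 = c" by (simp add: c_def add_nonneg_nonneg)
    then show ?thesis by (simp add: b_def c_def[symmetric] algebra_simps power2_eq_square) (simp add: c_def power2_eq_square)
  qed
  have b: "b > 0" using sqc m by (simp add: b_def c_def)
  have tlt: "1 / (\<sigma> x - m) < b" "1 / (\<sigma> x + m) < b" "0 < 1 / (\<sigma> x - m)" "0 < 1 / (\<sigma> x + m)" if "x > 0" for x
  proof -
    have "1 = b * (sqrt c - m)" by (simp add: bc)
    also have "\<dots> < b * (\<sigma> x - m)" using \<sigma>(4)[OF that] b by simp
    finally show 1: "1 / (\<sigma> x - m) < b" using \<sigma>[OF that] by (simp add: field_simps)
    have "1 / (\<sigma> x + m) \<le> 1 / (\<sigma> x - m)" using \<sigma>[OF that] m by (simp add: frac_le)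
    with 1 show "1 / (\<sigma> x + m) < b" by simp
    show "0 < 1 / (\<sigma> x - m)" "0 < 1 / (\<sigma> x + m)" using \<sigma>[OF that] m by auto
  qed
  have D\<sigma>: "(\<sigma> has_real_derivative 1 / (2 * \<sigma> x)) (at x)" if "x > 0" for x
  proof -
    have "x + c > 0" using that by (simp add: c_def add_pos_nonneg)
    then show ?thesis unfolding \<sigma>_def by (auto intro!: derivative_eq_intros simp: field_simps)
  qed
  \<comment> \<open>\<tau> = 1 and \<tau> = -1 treat the two halves together. The chain rule applies
    to the lower limit t, where the profile equals (t^2 x)^s.\<close>
  have D: "((\<lambda>x. integral {1 / (\<sigma> x - \<tau> * m)..b} (\<lambda>r. quad_profile s m (\<tau> * r) * r powr (-1 - 2 * s)))
      has_real_derivative x powr s / (2 * \<sigma> x * (\<sigma> x - \<tau> * m))) (at x)"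
    if "x > 0" and \<tau>: "\<tau> = 1 \<or> \<tau> = - 1" for x \<tau>
  proof -
    define F where "F r = quad_profile s m (\<tau> * r) * r powr (-1 - 2 * s)" for r
    define t where "t = 1 / (\<sigma> x - \<tau> * m)"
    have t: "0 < t" "t < b" using tlt[OF that(1)] \<tau> by (auto simp: t_def)
    have pos: "0 < \<sigma> x - \<tau> * m" using \<sigma>[OF that(1)] m \<tau> by auto
    have "continuous_on {t/2..b} F" unfolding F_def using t s by (auto intro!: continuous_intros)
    then have "((\<lambda>y. integral {y..b} F) has_real_derivative - F t) (at t within {t/2..b})"
      using t by (intro integral_has_real_derivative') auto
    then have 1: "((\<lambda>y. integral {y..b} F) has_real_derivative - F t) (at t)"
      using t by (subst (asm) at_within_interior) (auto simp: interior_atLeastAtMost_real)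
    have 2: "((\<lambda>x. 1 / (\<sigma> x - \<tau> * m)) has_real_derivative - (1 / (2 * \<sigma> x)) * t\<^sup>2) (at x)"
      using pos D\<sigma>[OF that(1)]
      by (auto intro!: derivative_eq_intros simp: t_def power2_eq_square field_simps)
    have "1 + 2 * m * (\<tau> * t) - (\<tau> * t)\<^sup>2 = t\<^sup>2 * x"
    proof -
      have h: "t * (\<sigma> x - \<tau> * m) = 1" using pos by (simp add: t_def)
      have "t\<^sup>2 * ((\<sigma> x - \<tau> * m)\<^sup>2 + 2 * m * \<tau> * (\<sigma> x - \<tau> * m) - 1)
        = (t * (\<sigma> x - \<tau> * m))\<^sup>2 + 2 * m * \<tau> * t * (t * (\<sigma> x - \<tau> * m)) - t\<^sup>2"
        by (simp add: algebra_simps power2_eq_square)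
      moreover have "(\<sigma> x - \<tau> * m)\<^sup>2 + 2 * m * \<tau> * (\<sigma> x - \<tau> * m) - 1 = x"
        using \<sigma>(3)[OF that(1)] \<tau> by (auto simp: c_def power2_eq_square algebra_simps)
      ultimately have "1 + 2 * m * \<tau> * t - t\<^sup>2 = t\<^sup>2 * x" by (simp only: h) simp
      moreover have "(\<tau> * t)\<^sup>2 = t\<^sup>2" using \<tau> by auto
      ultimately show ?thesis by simp
    qed
    then have "quad_profile s m (\<tau> * t) = (t\<^sup>2 * x) powr s"
      using that(1) by (simp add: quad_profile_def)
    also have "\<dots> = t powr (2 * s) * x powr s"
      using that(1) t by (simp add: powr_mult powr_powr flip: powr_numeral)
    finally have "F t = x powr s * (t powr (2 * s) * t powr (-1 - 2 * s))" by (simp add: F_def)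
    also have "t powr (2 * s) * t powr (-1 - 2 * s) = 1 / t"
      using t by (simp add: powr_add[symmetric] powr_minus_divide)
    finally have "F t * t\<^sup>2 = x powr s * t" using t by (simp add: power2_eq_square)
    then have "- F t * (- (1 / (2 * \<sigma> x)) * t\<^sup>2) = x powr s * t / (2 * \<sigma> x)" by simp
    also have "\<dots> = x powr s / (2 * \<sigma> x * (\<sigma> x - \<tau> * m))" by (simp add: t_def)
    finally show ?thesis
      using DERIV_chain2[OF 1[unfolded t_def] 2] by (simp only: F_def[abs_def] t_def)
  qed
  have DA: "(A has_real_derivative x powr s / (2 * \<sigma> x * (\<sigma> x - m))) (at x)" if "x > 0" for x
    using D[OF that, of 1] by (simp add: A_def[abs_def] f_def)
  have DB: "(B has_real_derivative x powr s / (2 * \<sigma> x * (\<sigma> x + m))) (at x)" if "x > 0" for x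
    using D[OF that, of "- 1"] by (simp add: B_def[abs_def] g_def)
  \<comment> \<open>The derivative of A + B is x^s/(x+1) = x^(s-1) - x^(s-2) + x^(s-2)/(x+1). The
    subtracted powers are primitives of the first two terms, which leaves V with a nonnegative
    derivative.\<close>
  define V where "V x = A x + B x - x powr s / s - x powr (s - 1) / (1 - s)" for x
  have DV: "(V has_real_derivative x powr (s - 2) / (x + 1)) (at x)" if "x > 0" for x
  proof -
    have "(V has_real_derivative x powr s / (2 * \<sigma> x * (\<sigma> x - m)) + x powr s / (2 * \<sigma> x * (\<sigma> x + m))
        - x powr (s - 1) + x powr (s - 2)) (at x)"
    proof -
      have 1: "((\<lambda>x. x powr s / s) has_real_derivative x powr (s - 1)) (at x)"
        using DERIV_cdivide[OF has_real_derivative_powr[OF that, of s], of s] s by simp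
      have "x powr (s - 1 - 1) = x powr (s - 2)" by (rule arg_cong) simp
      then have 2: "((\<lambda>x. x powr (s - 1) / (1 - s)) has_real_derivative - (x powr (s - 2))) (at x)"
      proof -
        assume e: "x powr (s - 1 - 1) = x powr (s - 2)"
        have "(s - 1) * x powr (s - 1 - 1) / (1 - s) = - (x powr (s - 2))"
          unfolding e using s by (simp add: divide_simps) (simp add: algebra_simps)
        then show ?thesis
          using DERIV_cdivide[OF has_real_derivative_powr[OF that, of "s - 1"], of "1 - s"] by (simp only:)
      qed
      show ?thesis unfolding V_def
        using DERIV_diff[OF DERIV_diff[OF DERIV_add[OF DA[OF that] DB[OF that]] 1] 2] by simp
    qed
    moreover have "x powr s / (2 * \<sigma> x * (\<sigma> x - m)) + x powr s / (2 * \<sigma> x * (\<sigma> x + m)) = x powr s / (x + 1)"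
    proof -
      have "1 / (2 * \<sigma> x * (\<sigma> x - m)) + 1 / (2 * \<sigma> x * (\<sigma> x + m)) = 1 / ((\<sigma> x)\<^sup>2 - m\<^sup>2)"
      proof -
        have "\<sigma> x > 0" "\<sigma> x - m > 0" "\<sigma> x + m > 0" using \<sigma>[OF that] m by auto
        moreover have "(\<sigma> x)\<^sup>2 - m\<^sup>2 = (\<sigma> x - m) * (\<sigma> x + m)" by (simp add: power2_eq_square algebra_simps)
        moreover have "1 / (2 * a * b) + 1 / (2 * a * d) = 1 / (b * d)"
          if "a > 0" "b > 0" "d > 0" "b + d = 2 * a" for a b d :: real
        proof -
          have "1 / (2 * a * b) + 1 / (2 * a * d) = (b + d) / (2 * a * b * d)" using that(1-3) by (simp add: field_simps)
          then show ?thesis using that by simp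
        qed
        ultimately show ?thesis by simp
      qed
      also have "(\<sigma> x)\<^sup>2 - m\<^sup>2 = x + 1" using \<sigma>[OF that] by (simp add: c_def)
      finally have h: "1 / (2 * \<sigma> x * (\<sigma> x - m)) + 1 / (2 * \<sigma> x * (\<sigma> x + m)) = 1 / (x + 1)" .
      show ?thesis using arg_cong[OF h, of "\<lambda>z. x powr s * z"] by (simp only: distrib_left times_divide_eq_right mult_1_right)
    qed
    moreover have "x powr s = x powr (s - 2) * x\<^sup>2" "x powr (s - 1) = x powr (s - 2) * x"
      using that by (simp_all add: powr_diff power2_eq_square)
    then have "x powr s / (x + 1) - x powr (s - 1) + x powr (s - 2) = x powr (s - 2) / (x + 1)"
      using that by (simp add: field_simps power2_eq_square)
    ultimately show ?thesis by simp
  qed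
  have "V 1 \<le> V X"
  proof (rule DERIV_nonneg_imp_nondecreasing[OF X])
    fix x :: real assume "1 \<le> x" "x \<le> X"
    then show "\<exists>y. (V has_real_derivative y) (at x) \<and> 0 \<le> y"
      by (intro exI[of _ "x powr (s - 2) / (x + 1)"] conjI DV) auto
  qed
  moreover have "A 1 \<ge> 0" "B 1 \<ge> 0"
    unfolding A_def B_def using f_nonneg g_nonneg tlt[of 1]
    by (auto intro!: integral_nonneg integrable_continuous_interval cont)
  moreover have "X powr (s - 1) / (1 - s) \<ge> 0" using s by simp
  ultimately show ?thesis by (simp add: V_def A_def B_def \<sigma>_def c_def)
qed


text \<open>The substitution produces different cut-offs for the two halves. With M = 1/\<epsilon>
  and X + 1 = M(M - 2m) they are 1/(M - 2m) and \<epsilon>; on the strip between them r <= 2m, so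
  the first profile is at least 1 there and the strip can be added back.\<close>

lemma quad_profile_tail_near_zero:
  fixes s m :: real
  assumes s: "0 < s" "s < 1" and m: "0 \<le> m"
  defines "f \<equiv> \<lambda>r. quad_profile s m r * r powr (-1 - 2 * s)"
  defines "g \<equiv> \<lambda>r. quad_profile s m (- r) * r powr (-1 - 2 * s)"
  defines "b \<equiv> sqrt (1 + m\<^sup>2) + m"
  shows "eventually (\<lambda>\<epsilon>. \<epsilon> powr (- 2 * s) / s - (3 / s + 1 / (1 - s))
    \<le> integral {\<epsilon>..b} f + integral {\<epsilon>..b} g) (at_right 0)"
proof -
  have "eventually (\<lambda>M. M powr s - (M - 2 * m) powr s \<le> 1) at_top"
  proof -
    have "((\<lambda>M. M powr s - (M - 2 * m) powr s) \<longlongrightarrow> 0) at_top"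
      using s by real_asymp
    then show ?thesis by (rule eventually_mono[OF order_tendstoD(2)[where a=1]]) auto
  qed
  moreover have "eventually (\<lambda>M::real. M \<ge> 2 * m + 2 \<and> M \<ge> 2 \<and> (m > 0 \<longrightarrow> 1 / (M - 2 * m) \<le> 2 * m)) at_top"
  proof (intro eventually_conj eventually_ge_at_top)
    show "eventually (\<lambda>M::real. m > 0 \<longrightarrow> 1 / (M - 2 * m) \<le> 2 * m) at_top"
    proof (cases "m > 0")
      case True
      show ?thesis using eventually_ge_at_top[of "2 * m + 1 / (2 * m)"]
      proof eventually_elim
        case (elim M)
        then have "M - 2 * m > 0" using True by (smt (verit) divide_pos_pos)
        then show ?case using elim True by (simp add: field_simps)
      qed
    qed simp
  qed
  ultimately have "eventually (\<lambda>M. (M powr s - (M - 2 * m) powr s \<le> 1) \<and>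
     M \<ge> 2 * m + 2 \<and> M \<ge> 2 \<and> (m > 0 \<longrightarrow> 1 / (M - 2 * m) \<le> 2 * m)) at_top"
    by (rule eventually_conj)
  then have "eventually (\<lambda>\<epsilon>. ((inverse \<epsilon>) powr s - (inverse \<epsilon> - 2 * m) powr s \<le> 1) \<and>
     inverse \<epsilon> \<ge> 2 * m + 2 \<and> inverse \<epsilon> \<ge> 2 \<and> (m > 0 \<longrightarrow> 1 / (inverse \<epsilon> - 2 * m) \<le> 2 * m)) (at_right 0)"
    by (rule eventually_compose_filterlim[OF _ filterlim_inverse_at_top_right])
  moreover have "eventually (\<lambda>\<epsilon>::real. \<epsilon> > 0) (at_right 0)" by (simp add: eventually_at_right_less)
  ultimately show ?thesis
  proof eventually_elim
    case (elim \<epsilon>)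
    define M where "M = inverse \<epsilon>"
    have M: "M powr s - (M - 2 * m) powr s \<le> 1" "M \<ge> 2 * m + 2" "M \<ge> 2" "m > 0 \<Longrightarrow> 1 / (M - 2 * m) \<le> 2 * m"
      and \<epsilon>: "\<epsilon> > 0" "\<epsilon> = 1 / M" using elim by (auto simp: M_def field_simps)
    define Y where "Y = M * (M - 2 * m)"
    define X where "X = Y - 1"
    have "2 * 2 \<le> M * (M - 2 * m)" using M by (intro mult_mono) auto
    then have X: "X \<ge> 1" by (simp add: X_def Y_def)
    have "X + (1 + m\<^sup>2) = (M - m)\<^sup>2" by (simp add: X_def Y_def power2_eq_square algebra_simps)
    then have sq: "sqrt (X + (1 + m\<^sup>2)) = M - m" using M m by simp
    define t where "t = 1 / (M - 2 * m)"
    have t: "\<epsilon> \<le> t" "t > 0" using M m by (auto simp: t_def \<epsilon> field_simps)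
    have main: "X powr s / s - (1 / s + 1 / (1 - s)) \<le> integral {t..b} f + integral {\<epsilon>..b} g"
      using quad_profile_integral_lower[OF s m X] unfolding sq
      by (simp add: f_def g_def b_def t_def \<epsilon>)
    have contf: "continuous_on {l..h} f" if "l > 0" for l h
      unfolding f_def using that s by (auto intro!: continuous_intros)
    have sqm: "sqrt (1 + m\<^sup>2) \<ge> m" by (rule real_le_rsqrt) simp
    have sq1: "sqrt (1 + m\<^sup>2) \<ge> 1" by (rule real_le_rsqrt) simp
    have tb: "t \<le> b"
    proof -
      have "t \<le> 1" using M m by (simp add: t_def field_simps)
      also have "1 \<le> b" using sq1 m unfolding b_def by linarith
      finally show ?thesis .
    qed
    have split: "integral {\<epsilon>..b} f = integral {\<epsilon>..t} f + integral {t..b} f"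
      using t tb \<epsilon> by (intro Henstock_Kurzweil_Integration.integral_combine[symmetric] integrable_continuous_interval contf) auto
    have strip: "(M powr (2 * s) - (M - 2 * m) powr (2 * s)) / (2 * s) \<le> integral {\<epsilon>..t} f"
    proof (cases "m = 0")
      case True
      then show ?thesis using \<epsilon> by (simp add: t_def)
    next
      case False
      then have "m > 0" using m by simp
      have hi: "((\<lambda>r. r powr (-1 - 2 * s)) has_integral (\<epsilon> powr (- 2 * s) - t powr (- 2 * s)) / (2 * s)) {\<epsilon>..t}"
        by (rule has_integral_powr_tail) (use t \<epsilon> s in auto)
      have "(\<epsilon> powr (- 2 * s) - t powr (- 2 * s)) / (2 * s) \<le> integral {\<epsilon>..t} f"
      proof (rule has_integral_le[OF hi])
        show "(f has_integral integral {\<epsilon>..t} f) {\<epsilon>..t}"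
          using \<epsilon> by (intro integrable_integral integrable_continuous_interval contf) auto
        fix r assume r: "r \<in> {\<epsilon>..t}"
        then have "r > 0" using \<epsilon>(1) by simp
        have "r \<le> 2 * m" using r M(4)[OF \<open>m > 0\<close>] by (simp add: t_def)
        with \<open>r > 0\<close> have "r * r \<le> (2 * m) * r" by (intro mult_right_mono) auto
        then have "1 \<le> 1 + 2 * m * r - r\<^sup>2" by (simp add: power2_eq_square)
        then have "1 \<le> quad_profile s m r" using s by (simp add: quad_profile_def ge_one_powr_ge_zero)
        then show "r powr (-1 - 2 * s) \<le> f r" by (simp add: f_def mult_le_cancel_right1)
      qed
      moreover have "t powr (- 2 * s) = (M - 2 * m) powr (2 * s)"
        using M m by (simp add: t_def powr_divide powr_minus_divide)
      moreover have "\<epsilon> powr (- 2 * s) = M powr (2 * s)"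
        using M m by (simp add: \<epsilon> powr_divide powr_minus_divide)
      ultimately show ?thesis by (simp add: diff_divide_distrib)
    qed
    \<comment> \<open>The loss stays bounded because M^(2s) + (M - 2m)^(2s) = 2 Y^s + (M^s - (M -
      2m)^s)^2: the square is at most 1 for large M, and passing from Y^s to X^s costs at most
      1.\<close>
    have "Y powr s \<le> X powr s + 1"
      using powr_add_le_add_powr[of X 1 s] X s by (simp add: X_def)
    moreover have "Y powr s = M powr s * (M - 2 * m) powr s"
      using M m by (simp add: Y_def powr_mult)
    moreover have "(M powr s - (M - 2 * m) powr s)\<^sup>2 \<le> 1\<^sup>2"
    proof (rule power_mono)
      show "0 \<le> M powr s - (M - 2 * m) powr s" using M m s by (simp add: powr_mono2)
    qed (rule M)
    moreover have "M powr (2 * s) = (M powr s)\<^sup>2" "(M - 2 * m) powr (2 * s) = ((M - 2 * m) powr s)\<^sup>2"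
      by (simp_all add: power2_eq_square flip: powr_add)
    ultimately have "M powr (2 * s) + (M - 2 * m) powr (2 * s) \<le> 2 * X powr s + 3"
      by (simp add: power2_eq_square algebra_simps)
    then have "(M powr (2 * s) + (M - 2 * m) powr (2 * s)) / (2 * s) \<le> (2 * X powr s + 3) / (2 * s)"
      using s by (intro divide_right_mono) auto
    moreover have "(2 * X powr s + 3) / (2 * s) \<le> X powr s / s + 2 / s"
      using s by (simp add: field_simps)
    moreover have "\<epsilon> powr (- 2 * s) / s = (M powr (2 * s) - (M - 2 * m) powr (2 * s)) / (2 * s) + (M powr (2 * s) + (M - 2 * m) powr (2 * s)) / (2 * s)"
    proof -
      have "\<epsilon> powr (- 2 * s) = M powr (2 * s)"
        using M m by (simp add: \<epsilon> powr_divide powr_minus_divide)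
      then show ?thesis using s by (simp add: field_simps)
    qed
    ultimately have "\<epsilon> powr (- 2 * s) / s \<le> integral {\<epsilon>..t} f + (X powr s / s + 2 / s)"
      using strip by linarith
    moreover have "3 / s = 1 / s + 2 / s" by (simp add: add_divide_distrib[symmetric])
    ultimately show ?case using main split by linarith
  qed
qed


lemma nn_integral_powr_tail:
  fixes s \<epsilon> :: real
  assumes "0 < s" "0 < \<epsilon>"
  shows "(\<integral>\<^sup>+r. ennreal (r powr (-1 - 2 * s)) * indicator {\<epsilon>..} r \<partial>lborel) = ennreal (\<epsilon> powr (- 2 * s) / (2 * s))"
proof -
  have "(\<integral>\<^sup>+r. ennreal (r powr (-1 - 2 * s)) * indicator {\<epsilon>..} r \<partial>lborel)
    = ennreal (0 - (- (\<epsilon> powr (- 2 * s) / (2 * s))))"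
  proof (rule nn_integral_FTC_atLeast[where F="\<lambda>r. - (r powr (- 2 * s) / (2 * s))"])
    show "((\<lambda>r. - (r powr (- 2 * s) / (2 * s))) \<longlongrightarrow> 0) at_top"
      using assms by real_asymp
    show "((\<lambda>r. - (r powr (- 2 * s) / (2 * s))) has_real_derivative r powr (-1 - 2 * s)) (at r)"
      if "\<epsilon> \<le> r" for r
      by (rule DERIV_powr_tail) (use that assms in auto)
  qed simp_all
  then show ?thesis by simp
qed

lemma nn_integral_Icc_continuous:
  fixes f :: "real \<Rightarrow> real"
  assumes "continuous_on {a..b} f" "\<And>x. x \<in> {a..b} \<Longrightarrow> 0 \<le> f x"
  shows "(\<integral>\<^sup>+r. ennreal (f r) * indicator {a..b} r \<partial>lborel) = ennreal (integral {a..b} f)"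
proof -
  have "set_integrable lborel {a..b} f" by (rule borel_integrable_atLeastAtMost') fact
  then have i: "integrable lborel (\<lambda>x. indicator {a..b} x *\<^sub>R f x)" by (simp add: set_integrable_def)
  have "(\<integral>\<^sup>+r. ennreal (f r) * indicator {a..b} r \<partial>lborel) = (\<integral>\<^sup>+r. ennreal (indicator {a..b} r *\<^sub>R f r) \<partial>lborel)"
    by (intro nn_integral_cong) (auto simp: indicator_def)
  also have "\<dots> = ennreal (\<integral>r. indicator {a..b} r *\<^sub>R f r \<partial>lborel)"
    by (rule nn_integral_eq_integral[OF i]) (use assms in \<open>auto simp: indicator_def\<close>)
  also have "(\<integral>r. indicator {a..b} r *\<^sub>R f r \<partial>lborel) = integral {a..b} f"
    using set_borel_integral_eq_integral(2)[OF \<open>set_integrable lborel {a..b} f\<close>]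
    by (simp add: set_lebesgue_integral_def)
  finally show ?thesis .
qed

text \<open>Passage from tiny cut-offs \<epsilon>' to the given one. The hypothesis keeps 1 + 2mr -
  r^2 and 1 - 2mr - r^2 nonnegative up to r = \<epsilon>, so by concavity the two profiles sum to at
  most 2 on [\<epsilon>', \<epsilon>], and the part cut away is at most the drop of the left-hand
  side.\<close>

lemma nn_integral_quad_profile_ge_aux:
  fixes s m \<epsilon> :: real
  assumes s: "0 < s" "s < 1" and m: "0 \<le> m" and \<epsilon>: "0 < \<epsilon>" "\<epsilon>\<^sup>2 + 2 * m * \<epsilon> \<le> 1"
  shows "ennreal (\<epsilon> powr (- 2 * s) / s) \<le>
    (\<integral>\<^sup>+r. ennreal ((quad_profile s m r + quad_profile s m (- r)) * r powr (-1 - 2 * s)) * indicator {\<epsilon>..} r \<partial>lborel)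
    + ennreal (3 / s + 1 / (1 - s))"
proof -
  define f where "f r = quad_profile s m r * r powr (-1 - 2 * s)" for r
  define g where "g r = quad_profile s m (- r) * r powr (-1 - 2 * s)" for r
  define b where "b = sqrt (1 + m\<^sup>2) + m"
  define B where "B = 3 / s + 1 / (1 - s)"
  have B: "B \<ge> 0" using s by (simp add: B_def)
  have nn: "f r \<ge> 0" "g r \<ge> 0" for r by (auto simp: f_def g_def quad_profile_nonneg)
  have cont: "continuous_on {l..h} f" "continuous_on {l..h} g" if "l > 0" for l h
    unfolding f_def g_def using that s by (auto intro!: continuous_intros)
  have \<epsilon>b: "\<epsilon> \<le> b"
  proof -
    have "\<epsilon>\<^sup>2 \<le> 1\<^sup>2" using \<epsilon> mult_nonneg_nonneg[OF m less_imp_le[OF \<epsilon>(1)]] unfolding power_one by linarith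
    then have "\<epsilon> \<le> 1" by (rule power2_le_imp_le) simp
    also have "1 \<le> sqrt (1 + m\<^sup>2)" by (rule real_le_rsqrt) simp
    also have "\<dots> \<le> b" using m by (simp add: b_def)
    finally show ?thesis .
  qed
  have "eventually (\<lambda>\<epsilon>'. \<epsilon>' powr (- 2 * s) / s - B \<le> integral {\<epsilon>'..b} f + integral {\<epsilon>'..b} g) (at_right 0)"
    using quad_profile_tail_near_zero[OF s m] by (simp add: f_def[abs_def] g_def[abs_def] b_def B_def)
  moreover have "eventually (\<lambda>\<epsilon>'. \<epsilon>' \<in> {0<..<\<epsilon>}) (at_right 0)"
    using \<epsilon> by (simp add: eventually_at_right_field) (auto intro!: exI[of _ \<epsilon>])
  ultimately have "eventually (\<lambda>\<epsilon>'. \<epsilon>' \<in> {0<..<\<epsilon>} \<and> \<epsilon>' powr (- 2 * s) / s - B \<le> integral {\<epsilon>'..b} f + integral {\<epsilon>'..b} g) (at_right 0)"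
    by eventually_elim auto
  then obtain \<epsilon>' where \<epsilon>': "0 < \<epsilon>'" "\<epsilon>' < \<epsilon>"
      "\<epsilon>' powr (- 2 * s) / s - B \<le> integral {\<epsilon>'..b} f + integral {\<epsilon>'..b} g"
    using eventually_happens'[OF trivial_limit_at_right_real, of "\<lambda>\<epsilon>'. \<epsilon>' \<in> {0<..<\<epsilon>} \<and> \<epsilon>' powr (- 2 * s) / s - B \<le> integral {\<epsilon>'..b} f + integral {\<epsilon>'..b} g" 0]
    by (metis greaterThanLessThan_iff)
  have hi: "((\<lambda>r. 2 * r powr (-1 - 2 * s)) has_integral 2 * ((\<epsilon>' powr (- 2 * s) - \<epsilon> powr (- 2 * s)) / (2 * s))) {\<epsilon>'..\<epsilon>}"
    by (intro has_integral_mult_right has_integral_powr_tail) (use \<epsilon>' s in auto)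
  have "integral {\<epsilon>'..\<epsilon>} f + integral {\<epsilon>'..\<epsilon>} g \<le> 2 * ((\<epsilon>' powr (- 2 * s) - \<epsilon> powr (- 2 * s)) / (2 * s))"
  proof (rule has_integral_le[OF _ hi])
    show "((\<lambda>r. f r + g r) has_integral integral {\<epsilon>'..\<epsilon>} f + integral {\<epsilon>'..\<epsilon>} g) {\<epsilon>'..\<epsilon>}"
      using \<epsilon>' by (intro has_integral_add integrable_integral integrable_continuous_interval cont) auto
    fix r assume "r \<in> {\<epsilon>'..\<epsilon>}"
    then have r: "0 < r" "r \<le> \<epsilon>" using \<epsilon>' by auto
    have "r\<^sup>2 + 2 * m * r \<le> \<epsilon>\<^sup>2 + 2 * m * \<epsilon>" using r m by (intro add_mono power_mono mult_left_mono) auto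
    then have p: "0 \<le> 1 - 2 * m * r - r\<^sup>2" using \<epsilon> by simp
    moreover have "0 \<le> 1 + 2 * m * r - r\<^sup>2" using p r m mult_nonneg_nonneg[of m r] by linarith
    ultimately have "quad_profile s m r + quad_profile s m (- r) \<le> 2 * ((2 - 2 * r\<^sup>2) / 2) powr s"
      using powr_mean_le[of "1 + 2 * m * r - r\<^sup>2" "1 - 2 * m * r - r\<^sup>2" s] s
      by (simp add: quad_profile_def)
    also have "\<dots> \<le> 2 * 1 powr s"
    proof -
      have "r\<^sup>2 \<le> 1" using p r m mult_nonneg_nonneg[of m r] by linarith
      moreover have "(2 - 2 * r\<^sup>2) / 2 = 1 - r\<^sup>2" by simp
      ultimately show ?thesis using s by (simp only:) (intro mult_left_mono powr_mono2; simp)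
    qed
    finally have "quad_profile s m r + quad_profile s m (- r) \<le> 2" by simp
    then have "(quad_profile s m r + quad_profile s m (- r)) * r powr (-1 - 2 * s) \<le> 2 * r powr (-1 - 2 * s)"
      by (rule mult_right_mono) simp
    then show "f r + g r \<le> 2 * r powr (-1 - 2 * s)" by (simp add: f_def g_def algebra_simps)
  qed
  moreover have "integral {\<epsilon>'..b} f = integral {\<epsilon>'..\<epsilon>} f + integral {\<epsilon>..b} f"
    "integral {\<epsilon>'..b} g = integral {\<epsilon>'..\<epsilon>} g + integral {\<epsilon>..b} g"
    using \<epsilon>' \<epsilon>b by (intro Henstock_Kurzweil_Integration.integral_combine[symmetric] integrable_continuous_interval cont; auto)+
  ultimately have "\<epsilon> powr (- 2 * s) / s \<le> integral {\<epsilon>..b} f + integral {\<epsilon>..b} g + B"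
    using \<epsilon>'(3) by (simp add: diff_divide_distrib)
  then have "ennreal (\<epsilon> powr (- 2 * s) / s) \<le> ennreal (integral {\<epsilon>..b} f + integral {\<epsilon>..b} g + B)"
    by (rule ennreal_leI)
  also have "\<dots> = ennreal (integral {\<epsilon>..b} f) + ennreal (integral {\<epsilon>..b} g) + ennreal B"
    using B \<epsilon> by (simp add: ennreal_plus integral_nonneg integrable_continuous_interval cont nn)
  also have "ennreal (integral {\<epsilon>..b} f) + ennreal (integral {\<epsilon>..b} g)
    = (\<integral>\<^sup>+r. ennreal (f r) * indicator {\<epsilon>..b} r + ennreal (g r) * indicator {\<epsilon>..b} r \<partial>lborel)"
  proof (subst nn_integral_add)
    have "f \<in> borel_measurable borel" "g \<in> borel_measurable borel"
      unfolding f_def g_def quad_profile_def by measurable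
    then show "(\<lambda>r. ennreal (f r) * indicator {\<epsilon>..b} r) \<in> borel_measurable lborel"
      "(\<lambda>r. ennreal (g r) * indicator {\<epsilon>..b} r) \<in> borel_measurable lborel" by measurable
  qed (use \<epsilon> in \<open>simp add: nn_integral_Icc_continuous cont nn\<close>)
  also have "\<dots> \<le> (\<integral>\<^sup>+r. ennreal ((quad_profile s m r + quad_profile s m (- r)) * r powr (-1 - 2 * s)) * indicator {\<epsilon>..} r \<partial>lborel)"
  proof (rule nn_integral_mono)
    fix r
    have "(quad_profile s m r + quad_profile s m (- r)) * r powr (-1 - 2 * s) = f r + g r"
      by (simp add: f_def g_def distrib_right)
    then show "ennreal (f r) * indicator {\<epsilon>..b} r + ennreal (g r) * indicator {\<epsilon>..b} r
      \<le> ennreal ((quad_profile s m r + quad_profile s m (- r)) * r powr (-1 - 2 * s)) * indicator {\<epsilon>..} r"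
      using nn by (simp add: ennreal_plus indicator_def)
  qed
  finally show ?thesis by (simp add: B_def add_right_mono)
qed

lemma nn_integral_quad_profile_ge:
  fixes s m \<epsilon> :: real
  assumes s: "0 < s" "s < 1" and \<epsilon>: "0 < \<epsilon>" "\<epsilon>\<^sup>2 + 2 * \<bar>m\<bar> * \<epsilon> \<le> 1"
  shows "ennreal (\<epsilon> powr (- 2 * s) / s) \<le>
    (\<integral>\<^sup>+r. ennreal ((quad_profile s m r + quad_profile s m (- r)) * r powr (-1 - 2 * s)) * indicator {\<epsilon>..} r \<partial>lborel)
    + ennreal (3 / s + 1 / (1 - s))"
proof (cases "m \<ge> 0")
  case True
  then show ?thesis using nn_integral_quad_profile_ge_aux[OF s True \<epsilon>(1)] \<epsilon> by simp
next
  case False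
  have "quad_profile s m r = quad_profile s (- m) (- r)" for r by (simp add: quad_profile_def)
  then show ?thesis using nn_integral_quad_profile_ge_aux[OF s _ \<epsilon>(1), of "- m"] \<epsilon> False
    by (simp add: add.commute)
qed

section \<open>A barrier in balls\<close>

text \<open>Up to a constant factor the torsion function of the ball for the fractional Laplacian:
  classically its fractional Laplacian is constant there. Of this, only a one-sided bound for
  truncated integrals is derived below.\<close>

definition ball_profile :: "real \<Rightarrow> 'a::euclidean_space \<Rightarrow> real \<Rightarrow> 'a \<Rightarrow> real" where
  "ball_profile s q \<rho> y = (max 0 (\<rho>\<^sup>2 - (norm (y - q))\<^sup>2)) powr s"

lemma ball_profile_nonneg: "0 \<le> ball_profile s q \<rho> y"
  by (simp add: ball_profile_def)

lemma ball_profile_le: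
  assumes "0 \<le> s" "0 \<le> \<rho>" shows "ball_profile s q \<rho> y \<le> \<rho> powr (2 * s)"
proof -
  have "ball_profile s q \<rho> y \<le> (\<rho>\<^sup>2) powr s"
    unfolding ball_profile_def using assms by (intro powr_mono2) auto
  also have "(\<rho>\<^sup>2) powr s = \<rho> powr (2 * s)"
    using assms by (cases "\<rho> = 0") (simp_all add: powr_powr flip: powr_numeral)
  finally show ?thesis .
qed

lemma ball_profile_outside:
  assumes "\<rho> \<le> norm (y - q)" "0 \<le> \<rho>" shows "ball_profile s q \<rho> y = 0"
  using assms power_mono[OF assms, of 2] by (simp add: ball_profile_def)

lemma continuous_on_ball_profile: "0 < s \<Longrightarrow> continuous_on A (ball_profile s q \<rho>)"
  unfolding ball_profile_def
  by (rule continuous_on_powr') (auto intro!: continuous_intros)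

lemma measurable_ball_profile [measurable]:
  "ball_profile s q \<rho> \<in> borel_measurable (borel :: 'a::euclidean_space measure)"
  unfolding ball_profile_def by measurable

lemma frac_kernel_nonneg: "0 \<le> frac_kernel s x y"
  by (simp add: frac_kernel_def)

lemma measurable_frac_kernel [measurable]:
  "frac_kernel s x \<in> borel_measurable (borel :: 'a::euclidean_space measure)"
  unfolding frac_kernel_def by measurable

text \<open>This is ln 2 times the surface measure of the unit sphere, expressed by Lebesgue
  measure.\<close>

definition annulus_mass :: "'a::euclidean_space itself \<Rightarrow> real" where
  "annulus_mass _ = enn2real (\<integral>\<^sup>+\<omega>. indicator {\<omega>::'a. 1 \<le> norm \<omega> \<and> norm \<omega> \<le> 2} \<omega> * ennreal (1 / norm \<omega> ^ DIM('a)) \<partial>lborel)"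

lemma annulus_mass:
  "(\<integral>\<^sup>+\<omega>. indicator {\<omega>::'a::euclidean_space. 1 \<le> norm \<omega> \<and> norm \<omega> \<le> 2} \<omega> * ennreal (1 / norm \<omega> ^ DIM('a)) \<partial>lborel)
    = ennreal (annulus_mass TYPE('a))"
proof -
  have "(\<integral>\<^sup>+\<omega>. indicator {\<omega>::'a. 1 \<le> norm \<omega> \<and> norm \<omega> \<le> 2} \<omega> * ennreal (1 / norm \<omega> ^ DIM('a)) \<partial>lborel)
    \<le> (\<integral>\<^sup>+\<omega>. indicator (cball (0::'a) 2) \<omega> \<partial>lborel)"
    by (intro nn_integral_mono) (auto simp: indicator_def one_le_power divide_le_eq)
  also have "\<dots> = emeasure lborel (cball (0::'a) 2)" by simp
  also have "\<dots> < \<infinity>" by (rule emeasure_lborel_cball_finite)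
  finally show ?thesis unfolding annulus_mass_def by simp
qed

lemma annulus_mass_nonneg: "0 \<le> annulus_mass TYPE('a::euclidean_space)"
  by (simp add: annulus_mass_def)

lemma radial_factor:
  fixes r s :: real
  assumes "0 < r"
  shows "r ^ (DIM('a::euclidean_space) - 1) * (1 / r powr (real DIM('a) + 2 * s)) = r powr (-1 - 2 * s)"
proof -
  have "r ^ (DIM('a) - 1) = r powr (real DIM('a) - 1)"
    using assms DIM_positive[where 'a='a] by (simp add: powr_realpow[symmetric] of_nat_diff)
  then have "r ^ (DIM('a) - 1) * (1 / r powr (real DIM('a) + 2 * s)) = r powr (real DIM('a) - 1 - (real DIM('a) + 2 * s))"
    by (simp only: powr_diff times_divide_eq_right mult_1_right)
  also have "real DIM('a) - 1 - (real DIM('a) + 2 * s) = -1 - 2 * s" by simp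
  finally show ?thesis .
qed

text \<open>Adding the formulas for \<omega> and -\<omega> pairs opposite directions, so that each
  pair sees a full line through x. This doubles the constant of
  \<open>nn_integral_polar\<close>.\<close>

lemma nn_integral_polar_kernel:
  fixes f :: "'a::euclidean_space \<Rightarrow> real" and x :: 'a
  assumes [measurable]: "f \<in> borel_measurable borel" and nn: "\<And>y. 0 \<le> f y" and "0 < \<epsilon>"
  shows "ennreal (2 * ln 2) * (\<integral>\<^sup>+y. ennreal (f y * frac_kernel s x y) * indicator (- ball x \<epsilon>) y \<partial>lborel) =
    (\<integral>\<^sup>+\<omega>. indicator {\<omega>. 1 \<le> norm \<omega> \<and> norm \<omega> \<le> 2} \<omega> * ennreal (1 / norm \<omega> ^ DIM('a)) *
      (\<integral>\<^sup>+r. ennreal ((f (x + r *\<^sub>R (\<omega> /\<^sub>R norm \<omega>)) + f (x - r *\<^sub>R (\<omega> /\<^sub>R norm \<omega>))) * r powr (-1 - 2 * s))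
         * indicator {\<epsilon>..} r \<partial>lborel) \<partial>lborel)"
proof -
  let ?A = "{\<omega>::'a. 1 \<le> norm \<omega> \<and> norm \<omega> \<le> 2}"
  let ?w = "\<lambda>\<omega>::'a. indicator ?A \<omega> * ennreal (1 / norm \<omega> ^ DIM('a))"
  define F where "F z = ennreal (f (x + z) * frac_kernel s x (x + z)) * indicator (- ball x \<epsilon>) (x + z)" for z
  have [measurable]: "?A \<in> sets borel" by measurable
  have [measurable]: "ball x \<epsilon> \<in> sets borel" by simp
  have F[measurable]: "F \<in> borel_measurable borel" unfolding F_def by measurable
  define I where "I \<omega> = (\<integral>\<^sup>+r. ennreal (f (x + r *\<^sub>R (\<omega> /\<^sub>R norm \<omega>)) * r powr (-1 - 2 * s)) * indicator {\<epsilon>..} r \<partial>lborel)" for \<omega> :: 'a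
  have [measurable]: "I \<in> borel_measurable borel" unfolding I_def by measurable
  have "(\<integral>\<^sup>+y. ennreal (f y * frac_kernel s x y) * indicator (- ball x \<epsilon>) y \<partial>lborel) = (\<integral>\<^sup>+z. F z \<partial>lborel)"
    unfolding F_def by (rule nn_integral_lborel_translate[symmetric]) measurable
  also have "ennreal (ln 2) * \<dots> = (\<integral>\<^sup>+\<omega>. ?w \<omega> * I \<omega> \<partial>lborel)"
    unfolding nn_integral_polar[OF F]
  proof (rule nn_integral_cong)
    fix \<omega> :: 'a
    show "?w \<omega> * (\<integral>\<^sup>+r. indicator {0<..} r * ennreal (r ^ (DIM('a) - 1)) * F (r *\<^sub>R (\<omega> /\<^sub>R norm \<omega>)) \<partial>lborel) = ?w \<omega> * I \<omega>"
    proof (cases "\<omega> \<in> ?A")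
      case True
      then have n: "norm \<omega> > 0" by auto
      have "(\<integral>\<^sup>+r. indicator {0<..} r * ennreal (r ^ (DIM('a) - 1)) * F (r *\<^sub>R (\<omega> /\<^sub>R norm \<omega>)) \<partial>lborel) = I \<omega>"
        unfolding I_def
      proof (rule nn_integral_cong)
        fix r :: real
        show "indicator {0<..} r * ennreal (r ^ (DIM('a) - 1)) * F (r *\<^sub>R (\<omega> /\<^sub>R norm \<omega>))
          = ennreal (f (x + r *\<^sub>R (\<omega> /\<^sub>R norm \<omega>)) * r powr (-1 - 2 * s)) * indicator {\<epsilon>..} r"
        proof (cases "r > 0")
          case r: True
          define v where "v = r *\<^sub>R (\<omega> /\<^sub>R norm \<omega>)"
          have nr: "norm v = r" using n r by (simp add: v_def)
          have "ennreal (r ^ (DIM('a) - 1)) * ennreal (f (x + v) * (1 / r powr (real DIM('a) + 2 * s)))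
            = ennreal (f (x + v) * (r ^ (DIM('a) - 1) * (1 / r powr (real DIM('a) + 2 * s))))"
            using r nn by (subst ennreal_mult[symmetric]) (auto simp: mult_ac)
          also have "\<dots> = ennreal (f (x + v) * r powr (-1 - 2 * s))"
            by (simp only: radial_factor[OF r])
          finally show ?thesis using r nr unfolding v_def[symmetric]
            by (simp add: F_def frac_kernel_def dist_norm indicator_def)
        qed (use \<open>0 < \<epsilon>\<close> in \<open>auto simp: indicator_def\<close>)
      qed
      then show ?thesis by simp
    qed simp
  qed
  finally have 1: "ennreal (ln 2) * (\<integral>\<^sup>+y. ennreal (f y * frac_kernel s x y) * indicator (- ball x \<epsilon>) y \<partial>lborel)
    = (\<integral>\<^sup>+\<omega>. ?w \<omega> * I \<omega> \<partial>lborel)" .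
  also have "\<dots> = (\<integral>\<^sup>+\<omega>. ?w (0 - \<omega>) * I (0 - \<omega>) \<partial>lborel)"
    by (rule nn_integral_lborel_reflect_point[symmetric]) measurable
  finally have 2: "ennreal (ln 2) * (\<integral>\<^sup>+y. ennreal (f y * frac_kernel s x y) * indicator (- ball x \<epsilon>) y \<partial>lborel)
    = (\<integral>\<^sup>+\<omega>. ?w \<omega> * I (- \<omega>) \<partial>lborel)" by (simp add: indicator_def)
  have "ennreal (2 * ln 2) = ennreal (ln 2) + ennreal (ln 2)" by (simp flip: ennreal_plus)
  then have "ennreal (2 * ln 2) * (\<integral>\<^sup>+y. ennreal (f y * frac_kernel s x y) * indicator (- ball x \<epsilon>) y \<partial>lborel)
    = (\<integral>\<^sup>+\<omega>. ?w \<omega> * I \<omega> \<partial>lborel) + (\<integral>\<^sup>+\<omega>. ?w \<omega> * I (- \<omega>) \<partial>lborel)"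
    by (simp only: distrib_right 1 2[unfolded 1])
  also have "\<dots> = (\<integral>\<^sup>+\<omega>. ?w \<omega> * I \<omega> + ?w \<omega> * I (- \<omega>) \<partial>lborel)"
    by (rule nn_integral_add[symmetric]) measurable
  also have "\<dots> = (\<integral>\<^sup>+\<omega>. ?w \<omega> *
      (\<integral>\<^sup>+r. ennreal ((f (x + r *\<^sub>R (\<omega> /\<^sub>R norm \<omega>)) + f (x - r *\<^sub>R (\<omega> /\<^sub>R norm \<omega>))) * r powr (-1 - 2 * s))
         * indicator {\<epsilon>..} r \<partial>lborel) \<partial>lborel)"
  proof (rule nn_integral_cong)
    fix \<omega> :: 'a
    have "I \<omega> + I (- \<omega>) = (\<integral>\<^sup>+r. ennreal (f (x + r *\<^sub>R (\<omega> /\<^sub>R norm \<omega>)) * r powr (-1 - 2 * s)) * indicator {\<epsilon>..} r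
        + ennreal (f (x + r *\<^sub>R (- \<omega> /\<^sub>R norm \<omega>)) * r powr (-1 - 2 * s)) * indicator {\<epsilon>..} r \<partial>lborel)"
      unfolding I_def norm_minus_cancel by (rule nn_integral_add[symmetric]) measurable
    also have "\<dots> = (\<integral>\<^sup>+r. ennreal ((f (x + r *\<^sub>R (\<omega> /\<^sub>R norm \<omega>)) + f (x - r *\<^sub>R (\<omega> /\<^sub>R norm \<omega>))) * r powr (-1 - 2 * s))
         * indicator {\<epsilon>..} r \<partial>lborel)"
      using nn by (intro nn_integral_cong) (simp add: distrib_right ennreal_plus indicator_def)
    finally show "?w \<omega> * I \<omega> + ?w \<omega> * I (- \<omega>) = ?w \<omega> *
      (\<integral>\<^sup>+r. ennreal ((f (x + r *\<^sub>R (\<omega> /\<^sub>R norm \<omega>)) + f (x - r *\<^sub>R (\<omega> /\<^sub>R norm \<omega>))) * r powr (-1 - 2 * s))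
         * indicator {\<epsilon>..} r \<partial>lborel)"
      by (simp only: distrib_left[symmetric])
  qed
  finally show ?thesis .
qed

text \<open>The case f = 1 of the same coordinates gives the tail exactly, so that in the comparison
  with the barrier the terms singular in \<epsilon> cancel.\<close>

lemma nn_integral_kernel_tail:
  fixes x :: "'a::euclidean_space"
  assumes "0 < s" "0 < \<epsilon>"
  shows "ennreal (2 * ln 2) * (\<integral>\<^sup>+y. ennreal (frac_kernel s x y) * indicator (- ball x \<epsilon>) y \<partial>lborel)
    = ennreal (annulus_mass TYPE('a) * (\<epsilon> powr (- 2 * s) / s))"
proof -
  have "(\<integral>\<^sup>+r. ennreal ((1 + 1) * r powr (-1 - 2 * s)) * indicator {\<epsilon>..} r \<partial>lborel) = ennreal (\<epsilon> powr (- 2 * s) / s)"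
  proof -
    have "(\<integral>\<^sup>+r. ennreal ((1 + 1) * r powr (-1 - 2 * s)) * indicator {\<epsilon>..} r \<partial>lborel)
      = (\<integral>\<^sup>+r. 2 * (ennreal (r powr (-1 - 2 * s)) * indicator {\<epsilon>..} r) \<partial>lborel)"
      by (intro nn_integral_cong) (simp add: ennreal_mult mult.assoc)
    also have "\<dots> = 2 * ennreal (\<epsilon> powr (- 2 * s) / (2 * s))"
      by (subst nn_integral_cmult) (simp_all add: nn_integral_powr_tail[OF assms])
    also have "\<dots> = ennreal (2 * (\<epsilon> powr (- 2 * s) / (2 * s)))"
      using assms by (subst ennreal_mult) auto
    finally show ?thesis by simp
  qed
  then show ?thesis
    using nn_integral_polar_kernel[of "\<lambda>_. 1" \<epsilon> s x] assms
    by (simp add: nn_integral_multc annulus_mass annulus_mass_nonneg flip: ennreal_mult)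
qed

lemma kernel_tail_finite:
  fixes x :: "'a::euclidean_space"
  assumes "0 < s" "0 < \<epsilon>"
  shows "(\<integral>\<^sup>+y. ennreal (frac_kernel s x y) * indicator (- ball x \<epsilon>) y \<partial>lborel) < \<infinity>"
proof (rule ccontr)
  assume "\<not> ?thesis"
  then have "(\<integral>\<^sup>+y. ennreal (frac_kernel s x y) * indicator (- ball x \<epsilon>) y \<partial>lborel) = \<infinity>"
    by (metis infinity_ennreal_def top.not_eq_extremum)
  then show False using nn_integral_kernel_tail[OF assms, of x] by (simp add: ennreal_mult_top)
qed

lemma set_integrable_kernel:
  fixes f :: "'a::euclidean_space \<Rightarrow> real"
  assumes s: "0 < s" "0 < \<epsilon>" and [measurable]: "f \<in> borel_measurable borel" and bnd: "\<And>y. \<bar>f y\<bar> \<le> M"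
  shows "set_integrable lborel (- ball x \<epsilon>) (\<lambda>y. f y * frac_kernel s x y)"
  unfolding set_integrable_def
proof (rule integrableI_bounded)
  have [measurable]: "ball x \<epsilon> \<in> sets borel" by simp
  show "(\<lambda>y. indicat_real (- ball x \<epsilon>) y *\<^sub>R (f y * frac_kernel s x y)) \<in> borel_measurable lborel" by measurable
  have M: "M \<ge> 0" using bnd[of x] by linarith
  have "(\<integral>\<^sup>+y. ennreal (norm (indicat_real (- ball x \<epsilon>) y *\<^sub>R (f y * frac_kernel s x y))) \<partial>lborel)
    \<le> (\<integral>\<^sup>+y. ennreal M * (ennreal (frac_kernel s x y) * indicator (- ball x \<epsilon>) y) \<partial>lborel)"
    using bnd M frac_kernel_nonneg[of s x]
    by (intro nn_integral_mono) (auto simp: indicator_def abs_mult mult_right_mono simp flip: ennreal_mult intro!: ennreal_leI)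
  also have "\<dots> = ennreal M * (\<integral>\<^sup>+y. (ennreal (frac_kernel s x y) * indicator (- ball x \<epsilon>) y) \<partial>lborel)"
    by (rule nn_integral_cmult) measurable
  also have "\<dots> < \<infinity>" using kernel_tail_finite[OF s, of x] by (simp add: ennreal_mult_less_top)
  finally show "(\<integral>\<^sup>+y. ennreal (norm (indicat_real (- ball x \<epsilon>) y *\<^sub>R (f y * frac_kernel s x y))) \<partial>lborel) < \<infinity>" .
qed


lemma ball_profile_line:
  fixes x q w :: "'a::euclidean_space"
  assumes s: "0 < s" and w: "norm w = 1" and P: "0 < \<rho>\<^sup>2 - (norm (x - q))\<^sup>2"
  defines "P \<equiv> \<rho>\<^sup>2 - (norm (x - q))\<^sup>2"
  shows "ball_profile s q \<rho> (x + r *\<^sub>R w) = P powr s * quad_profile s (- ((x - q) \<bullet> w) / sqrt P) (r / sqrt P)"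
proof -
  have P0: "P > 0" using P by (simp add: P_def)
  define m where "m = - ((x - q) \<bullet> w) / sqrt P"
  have "x + r *\<^sub>R w - q = (x - q) + r *\<^sub>R w" by simp
  then have "(norm (x + r *\<^sub>R w - q))\<^sup>2 = (norm (x - q))\<^sup>2 + 2 * r * ((x - q) \<bullet> w) + r\<^sup>2"
    using norm_add_scaleR_sq[OF w, of "x - q" r] by (simp only:)
  then have "\<rho>\<^sup>2 - (norm (x + r *\<^sub>R w - q))\<^sup>2 = P - 2 * r * ((x - q) \<bullet> w) - r\<^sup>2" by (simp add: P_def)
  also have "\<dots> = P * (1 + 2 * m * (r / sqrt P) - (r / sqrt P)\<^sup>2)"
  proof -
    have "P * (2 * m * (r / sqrt P)) = - 2 * r * ((x - q) \<bullet> w)" using P0 by (simp add: m_def field_simps)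
    moreover have "P * (r / sqrt P)\<^sup>2 = r\<^sup>2" using P0 by (simp add: power_divide)
    ultimately show ?thesis by (simp add: right_diff_distrib distrib_left)
  qed
  finally have "max 0 (\<rho>\<^sup>2 - (norm (x + r *\<^sub>R w - q))\<^sup>2) = P * max 0 (1 + 2 * m * (r / sqrt P) - (r / sqrt P)\<^sup>2)"
    using P0 by (auto simp: max_def zero_le_mult_iff mult_le_0_iff)
  then show ?thesis using P0 by (simp add: ball_profile_def quad_profile_def powr_mult m_def)
qed

text \<open>With r in units of c = sqrt P, the kernel and dr together contribute c^(-2s), which
  cancels the factor P^s of the profile. Hence the additive constant depends neither on the ball nor
  on x.\<close>

lemma ball_profile_line_integral:
  fixes x q w :: "'a::euclidean_space"
  assumes s: "0 < s" "s < 1" and w: "norm w = 1" and \<epsilon>: "0 < \<epsilon>" "\<epsilon> \<le> \<rho> - norm (x - q)"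
  shows "ennreal (ball_profile s q \<rho> x * (\<epsilon> powr (- 2 * s) / s)) \<le>
    (\<integral>\<^sup>+r. ennreal ((ball_profile s q \<rho> (x + r *\<^sub>R w) + ball_profile s q \<rho> (x - r *\<^sub>R w)) * r powr (-1 - 2 * s))
        * indicator {\<epsilon>..} r \<partial>lborel) + ennreal (3 / s + 1 / (1 - s))"
proof -
  define P where "P = \<rho>\<^sup>2 - (norm (x - q))\<^sup>2"
  define m where "m = - ((x - q) \<bullet> w) / sqrt P"
  define c where "c = sqrt P"
  have lt: "norm (x - q) < \<rho>" using \<epsilon> by simp
  have P: "P > 0" unfolding P_def using power_strict_mono[OF lt norm_ge_zero, of 2] by simp
  have c: "c > 0" "c\<^sup>2 = P" using P by (auto simp: c_def)
  have line: "ball_profile s q \<rho> (x + r *\<^sub>R w) = P powr s * quad_profile s m (r / c)"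
    "ball_profile s q \<rho> (x - r *\<^sub>R w) = P powr s * quad_profile s m (- (r / c))" for r
    using ball_profile_line[OF s(1) w P[unfolded P_def], of r] ball_profile_line[OF s(1) w P[unfolded P_def], of "- r"]
    by (simp_all add: P_def m_def c_def)
  have phix: "ball_profile s q \<rho> x = P powr s" using P by (simp add: ball_profile_def P_def)
  \<comment> \<open>\<open>\<epsilon> \<le> \<rho> - norm (x - q)\<close> says that segments of
    half-length \<epsilon> about x stay in the closed ball; in the rescaled variable this is the
    hypothesis of \<open>nn_integral_quad_profile_ge\<close>.\<close>
  have small: "(\<epsilon> / c)\<^sup>2 + 2 * \<bar>m\<bar> * (\<epsilon> / c) \<le> 1"
  proof -
    have "\<epsilon>\<^sup>2 + 2 * \<bar>(x - q) \<bullet> w\<bar> * \<epsilon> \<le> \<epsilon>\<^sup>2 + 2 * norm (x - q) * \<epsilon>"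
      using Cauchy_Schwarz_ineq2[of "x - q" w] w \<epsilon> by (intro add_left_mono mult_right_mono) auto
    also have "\<dots> = (\<epsilon> + norm (x - q))\<^sup>2 - (norm (x - q))\<^sup>2" by (simp add: power2_eq_square algebra_simps)
    also have "\<dots> \<le> P" unfolding P_def using \<epsilon> by (intro diff_right_mono power_mono) auto
    finally have "(\<epsilon>\<^sup>2 + 2 * \<bar>(x - q) \<bullet> w\<bar> * \<epsilon>) / P \<le> 1" using P by simp
    moreover have "(\<epsilon> / c)\<^sup>2 + 2 * \<bar>m\<bar> * (\<epsilon> / c) = (\<epsilon>\<^sup>2 + 2 * \<bar>(x - q) \<bullet> w\<bar> * \<epsilon>) / P"
    proof -
      have "(\<epsilon> / c)\<^sup>2 = \<epsilon>\<^sup>2 / P" by (simp add: power_divide c)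
      moreover have "\<bar>m\<bar> = \<bar>(x - q) \<bullet> w\<bar> / c" using c by (simp add: m_def abs_divide flip: c_def)
      then have "2 * \<bar>m\<bar> * (\<epsilon> / c) = 2 * \<bar>(x - q) \<bullet> w\<bar> * \<epsilon> / P"
        by (simp add: c(2)[symmetric] power2_eq_square)
      ultimately show ?thesis by (simp add: add_divide_distrib)
    qed
    ultimately show ?thesis by simp
  qed
  let ?Q = "\<lambda>r. quad_profile s m r + quad_profile s m (- r)"
  have meas: "(\<lambda>r. ennreal ((P powr s * quad_profile s m (r / c) + P powr s * quad_profile s m (- (r / c))) * r powr (-1 - 2 * s))
        * indicator {\<epsilon>..} r) \<in> borel_measurable borel"
    unfolding quad_profile_def by measurable
  have "(\<integral>\<^sup>+r. ennreal ((ball_profile s q \<rho> (x + r *\<^sub>R w) + ball_profile s q \<rho> (x - r *\<^sub>R w)) * r powr (-1 - 2 * s))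
        * indicator {\<epsilon>..} r \<partial>lborel)
    = ennreal c * (\<integral>\<^sup>+r. ennreal ((P powr s * quad_profile s m ((c * r) / c) + P powr s * quad_profile s m (- ((c * r) / c))) * (c * r) powr (-1 - 2 * s))
        * indicator {\<epsilon>..} (c * r) \<partial>lborel)"
    unfolding line using nn_integral_lborel_affine[OF meas, of c 0] c by simp
  also have "\<dots> = (\<integral>\<^sup>+r. ennreal c * (ennreal ((P powr s * quad_profile s m ((c * r) / c) + P powr s * quad_profile s m (- ((c * r) / c))) * (c * r) powr (-1 - 2 * s))
        * indicator {\<epsilon>..} (c * r)) \<partial>lborel)"
    by (rule nn_integral_cmult[symmetric]) (unfold quad_profile_def, measurable)
  also have "\<dots> = (\<integral>\<^sup>+r. ennreal (?Q r * r powr (-1 - 2 * s)) * indicator {\<epsilon> / c..} r \<partial>lborel)"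
  proof (rule nn_integral_cong)
    fix r
    show "ennreal c * (ennreal ((P powr s * quad_profile s m ((c * r) / c) + P powr s * quad_profile s m (- ((c * r) / c))) * (c * r) powr (-1 - 2 * s))
        * indicator {\<epsilon>..} (c * r)) = ennreal (?Q r * r powr (-1 - 2 * s)) * indicator {\<epsilon> / c..} r"
    proof (cases "\<epsilon> / c \<le> r")
      case True
      then have r: "r > 0" using \<epsilon> c by (smt (verit) divide_pos_pos)
      have ind: "\<epsilon> \<le> c * r" using True c by (simp add: field_simps)
      have cp: "c * (P powr s * c powr (-1 - 2 * s)) = 1"
      proof -
        have "P powr s = c powr (2 * s)" using c by (simp add: powr_powr c(2)[symmetric] flip: powr_numeral)
        then have "P powr s * c powr (-1 - 2 * s) = c powr (-1)" by (simp flip: powr_add)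
        then show ?thesis using c by (simp add: powr_minus_divide)
      qed
      have "c * ((P powr s * quad_profile s m ((c * r) / c) + P powr s * quad_profile s m (- ((c * r) / c))) * (c * r) powr (-1 - 2 * s))
        = (c * (P powr s * c powr (-1 - 2 * s))) * (?Q r * r powr (-1 - 2 * s))"
        using c r by (simp add: powr_mult algebra_simps)
      also have "\<dots> = ?Q r * r powr (-1 - 2 * s)" by (simp only: cp mult_1_left)
      finally show ?thesis using True ind c by (simp add: indicator_def ennreal_mult'[symmetric])
    next
      case False
      then have "\<not> \<epsilon> \<le> c * r" using c by (simp add: field_simps)
      then show ?thesis using False by (simp add: indicator_def)
    qed
  qed
  finally have eq: "(\<integral>\<^sup>+r. ennreal ((ball_profile s q \<rho> (x + r *\<^sub>R w) + ball_profile s q \<rho> (x - r *\<^sub>R w)) * r powr (-1 - 2 * s))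
        * indicator {\<epsilon>..} r \<partial>lborel) = (\<integral>\<^sup>+r. ennreal (?Q r * r powr (-1 - 2 * s)) * indicator {\<epsilon> / c..} r \<partial>lborel)" .
  have "(\<epsilon> / c) powr (- 2 * s) = P powr s * \<epsilon> powr (- 2 * s)"
  proof -
    have "P powr s = c powr (2 * s)" using c by (simp add: powr_powr c(2)[symmetric] flip: powr_numeral)
    then show ?thesis using c \<epsilon> by (simp add: powr_divide powr_minus_divide)
  qed
  then show ?thesis
    using nn_integral_quad_profile_ge[OF s _ small] \<epsilon> c unfolding eq phix by simp
qed

text \<open>In each direction the singular parts \<epsilon>^(-2s)/s of kernel and barrier cancel up
  to a constant, and integration over directions multiplies it by the annulus mass. The bound holds
  at fixed \<epsilon>, so no principal value of the barrier is ever formed.\<close>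

lemma trunc_ball_profile_le:
  fixes x q :: "'a::euclidean_space"
  assumes s: "0 < s" "s < 1" and \<epsilon>: "0 < \<epsilon>" "\<epsilon> \<le> \<rho> - norm (x - q)"
  shows "(LINT y:(- ball x \<epsilon>)|lborel. (ball_profile s q \<rho> x - ball_profile s q \<rho> y) * frac_kernel s x y)
    \<le> annulus_mass TYPE('a) * (3 / s + 1 / (1 - s)) / (2 * ln 2)"
proof -
  let ?A = "{\<omega>::'a. 1 \<le> norm \<omega> \<and> norm \<omega> \<le> 2}"
  let ?w = "\<lambda>\<omega>::'a. indicator ?A \<omega> * ennreal (1 / norm \<omega> ^ DIM('a))"
  let ?f = "ball_profile s q \<rho>"
  define B where "B = 3 / s + 1 / (1 - s)"
  define V where "V = annulus_mass TYPE('a)"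
  have B: "B \<ge> 0" using s by (simp add: B_def)
  have V: "V \<ge> 0" by (simp add: V_def annulus_mass_nonneg)
  have [measurable]: "?A \<in> sets borel" by measurable
  have \<rho>: "\<rho> \<ge> 0" using \<epsilon> norm_ge_zero[of "x - q"] by linarith
  have ib: "set_integrable lborel (- ball x \<epsilon>) (\<lambda>y. ?f y * frac_kernel s x y)"
    by (rule set_integrable_kernel[where M="\<rho> powr (2 * s)"])
       (use s \<epsilon> \<rho> in \<open>auto simp: ball_profile_nonneg ball_profile_le\<close>)
  have ic: "set_integrable lborel (- ball x \<epsilon>) (\<lambda>y. ?f x * frac_kernel s x y)"
    by (rule set_integrable_kernel[where M="?f x"]) (use s \<epsilon> in \<open>auto simp: ball_profile_nonneg\<close>)
  \<comment> \<open>G and C are the two parts of the integral. They are compared additively in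
    \<open>ennreal\<close> and subtracted only after the return to real numbers.\<close>
  define G where "G = (LINT y:(- ball x \<epsilon>)|lborel. ?f y * frac_kernel s x y)"
  define C where "C = (LINT y:(- ball x \<epsilon>)|lborel. ?f x * frac_kernel s x y)"
  have nG: "(\<integral>\<^sup>+y. ennreal (?f y * frac_kernel s x y) * indicator (- ball x \<epsilon>) y \<partial>lborel) = ennreal G" "G \<ge> 0"
  proof -
    show "G \<ge> 0" unfolding G_def set_lebesgue_integral_def
      by (intro integral_nonneg_AE AE_I2) (simp add: ball_profile_nonneg frac_kernel_nonneg)
    have "ennreal G = (\<integral>\<^sup>+y. ennreal (indicat_real (- ball x \<epsilon>) y *\<^sub>R (?f y * frac_kernel s x y)) \<partial>lborel)"
      unfolding G_def set_lebesgue_integral_def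
      by (rule nn_integral_eq_integral[symmetric])
         (use ib in \<open>auto simp: set_integrable_def ball_profile_nonneg frac_kernel_nonneg\<close>)
    also have "\<dots> = (\<integral>\<^sup>+y. ennreal (?f y * frac_kernel s x y) * indicator (- ball x \<epsilon>) y \<partial>lborel)"
      by (intro nn_integral_cong) (auto simp: indicator_def)
    finally show "(\<integral>\<^sup>+y. ennreal (?f y * frac_kernel s x y) * indicator (- ball x \<epsilon>) y \<partial>lborel) = ennreal G" ..
  qed
  have nC: "ennreal (?f x) * (\<integral>\<^sup>+y. ennreal (frac_kernel s x y) * indicator (- ball x \<epsilon>) y \<partial>lborel) = ennreal C"
  proof -
    have [measurable]: "ball x \<epsilon> \<in> sets borel" by simp
    have "ennreal C = (\<integral>\<^sup>+y. ennreal (indicat_real (- ball x \<epsilon>) y *\<^sub>R (?f x * frac_kernel s x y)) \<partial>lborel)"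
      unfolding C_def set_lebesgue_integral_def
      by (rule nn_integral_eq_integral[symmetric])
         (use ic in \<open>auto simp: set_integrable_def ball_profile_nonneg frac_kernel_nonneg\<close>)
    also have "\<dots> = (\<integral>\<^sup>+y. ennreal (?f x) * (ennreal (frac_kernel s x y) * indicator (- ball x \<epsilon>) y) \<partial>lborel)"
      by (intro nn_integral_cong) (auto simp: indicator_def ennreal_mult ball_profile_nonneg frac_kernel_nonneg)
    also have "\<dots> = ennreal (?f x) * (\<integral>\<^sup>+y. ennreal (frac_kernel s x y) * indicator (- ball x \<epsilon>) y \<partial>lborel)"
      by (rule nn_integral_cmult) measurable
    finally show ?thesis ..
  qed
  have "(\<integral>\<^sup>+\<omega>. ?w \<omega> * ennreal (?f x * (\<epsilon> powr (- 2 * s) / s)) \<partial>lborel)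
    \<le> (\<integral>\<^sup>+\<omega>. ?w \<omega> * (\<integral>\<^sup>+r. ennreal ((?f (x + r *\<^sub>R (\<omega> /\<^sub>R norm \<omega>)) + ?f (x - r *\<^sub>R (\<omega> /\<^sub>R norm \<omega>))) * r powr (-1 - 2 * s))
         * indicator {\<epsilon>..} r \<partial>lborel) + ?w \<omega> * ennreal B \<partial>lborel)"
  proof (rule nn_integral_mono)
    fix \<omega> :: 'a
    show "?w \<omega> * ennreal (?f x * (\<epsilon> powr (- 2 * s) / s))
      \<le> ?w \<omega> * (\<integral>\<^sup>+r. ennreal ((?f (x + r *\<^sub>R (\<omega> /\<^sub>R norm \<omega>)) + ?f (x - r *\<^sub>R (\<omega> /\<^sub>R norm \<omega>))) * r powr (-1 - 2 * s))
         * indicator {\<epsilon>..} r \<partial>lborel) + ?w \<omega> * ennreal B"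
    proof (cases "\<omega> \<in> ?A")
      case True
      then have "norm \<omega> > 0" by auto
      then have "norm (\<omega> /\<^sub>R norm \<omega>) = 1" by simp
      from ball_profile_line_integral[OF s this \<epsilon>]
      show ?thesis unfolding distrib_left[symmetric] B_def by (rule mult_left_mono) simp
    qed simp
  qed
  also have "\<dots> = ennreal (2 * ln 2) * ennreal G + (\<integral>\<^sup>+\<omega>. ?w \<omega> * ennreal B \<partial>lborel)"
  proof -
    have "(\<lambda>\<omega>::'a. \<integral>\<^sup>+r. ennreal ((?f (x + r *\<^sub>R (\<omega> /\<^sub>R norm \<omega>)) + ?f (x - r *\<^sub>R (\<omega> /\<^sub>R norm \<omega>))) * r powr (-1 - 2 * s))
         * indicator {\<epsilon>..} r \<partial>lborel) \<in> borel_measurable borel" by measurable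
    note [measurable] = this
    show ?thesis
      unfolding nG(1)[symmetric] nn_integral_polar_kernel[OF measurable_ball_profile ball_profile_nonneg \<epsilon>(1)]
      by (rule nn_integral_add) measurable
  qed
  finally have "ennreal V * ennreal (?f x * (\<epsilon> powr (- 2 * s) / s)) \<le> ennreal (2 * ln 2) * ennreal G + ennreal V * ennreal B"
    by (simp add: nn_integral_multc annulus_mass V_def)
  moreover have "ennreal V * ennreal (?f x * (\<epsilon> powr (- 2 * s) / s)) = ennreal (2 * ln 2) * ennreal C"
  proof -
    have "ennreal (2 * ln 2) * ennreal C = ennreal (?f x) * (ennreal (2 * ln 2) * (\<integral>\<^sup>+y. ennreal (frac_kernel s x y) * indicator (- ball x \<epsilon>) y \<partial>lborel))"
      unfolding nC[symmetric] by (simp add: mult_ac)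
    also have "\<dots> = ennreal (?f x) * ennreal (V * (\<epsilon> powr (- 2 * s) / s))"
      by (simp only: nn_integral_kernel_tail[OF s(1) \<epsilon>(1)] V_def)
    finally show ?thesis using V s by (simp add: ennreal_mult[symmetric] ball_profile_nonneg mult_ac)
  qed
  ultimately have "ennreal (2 * ln 2) * ennreal C \<le> ennreal (2 * ln 2) * ennreal G + ennreal V * ennreal B" by simp
  then have "ennreal (2 * ln 2 * C) \<le> ennreal (2 * ln 2 * G + V * B)"
    using V B nG by (simp add: ennreal_mult' ennreal_plus)
  moreover have "2 * ln 2 * G + V * B \<ge> 0" using V B nG by simp
  ultimately have "2 * ln 2 * C \<le> 2 * ln 2 * G + V * B" by (simp only: ennreal_le_iff)
  then have "C - G \<le> V * B / (2 * ln 2)" by (simp add: field_simps)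
  moreover have "C - G = (LINT y:(- ball x \<epsilon>)|lborel. (?f x - ?f y) * frac_kernel s x y)"
    unfolding C_def G_def using set_integral_diff(2)[OF ic ib] by (simp add: left_diff_distrib)
  ultimately show ?thesis by (simp add: V_def B_def)
qed

section \<open>The truncated fractional Laplacian\<close>

text \<open>Comparison at a touching point is made at fixed \<epsilon> and passed to the limit
  afterwards; the barrier enters through these truncations alone.\<close>

definition frac_trunc :: "real \<Rightarrow> ('a::euclidean_space \<Rightarrow> real) \<Rightarrow> 'a \<Rightarrow> real \<Rightarrow> real" where
  "frac_trunc s u x \<epsilon> = (LINT y:(- ball x \<epsilon>)|lborel. (u x - u y) * frac_kernel s x y)"

lemma frac_lap_pv_trunc:
  "frac_lap_pv s u x L \<longleftrightarrow>
     (\<forall>\<epsilon>>0. set_integrable lborel (- ball x \<epsilon>) (\<lambda>y. (u x - u y) * frac_kernel s x y)) \<and>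
     ((\<lambda>\<epsilon>. frac_const DIM('a) s * frac_trunc s u x \<epsilon>) \<longlongrightarrow> L) (at_right 0)"
  for u :: "'a::euclidean_space \<Rightarrow> real"
  by (simp add: frac_lap_pv_def frac_trunc_def)

lemma frac_const_pos: "0 < s \<Longrightarrow> s < 1 \<Longrightarrow> 0 < frac_const N s"
  unfolding frac_const_def by (intro divide_pos_pos mult_pos_pos Gamma_real_pos) auto

lemma frac_trunc_lin:
  fixes f g :: "'a::euclidean_space \<Rightarrow> real"
  assumes "set_integrable lborel (- ball x \<epsilon>) (\<lambda>y. (f x - f y) * frac_kernel s x y)"
    and "set_integrable lborel (- ball x \<epsilon>) (\<lambda>y. (g x - g y) * frac_kernel s x y)"
  shows "set_integrable lborel (- ball x \<epsilon>) (\<lambda>y. ((a * f x + b * g x) - (a * f y + b * g y)) * frac_kernel s x y)"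
    and "frac_trunc s (\<lambda>y. a * f y + b * g y) x \<epsilon> = a * frac_trunc s f x \<epsilon> + b * frac_trunc s g x \<epsilon>"
proof -
  have eq: "((a * f x + b * g x) - (a * f y + b * g y)) * frac_kernel s x y
      = a * ((f x - f y) * frac_kernel s x y) + b * ((g x - g y) * frac_kernel s x y)" for y
    by (simp add: algebra_simps)
  show "set_integrable lborel (- ball x \<epsilon>) (\<lambda>y. ((a * f x + b * g x) - (a * f y + b * g y)) * frac_kernel s x y)"
    unfolding eq by (intro set_integral_add set_integrable_mult_right) (use assms in auto)
  show "frac_trunc s (\<lambda>y. a * f y + b * g y) x \<epsilon> = a * frac_trunc s f x \<epsilon> + b * frac_trunc s g x \<epsilon>"
    unfolding frac_trunc_def eq using assms
    by (subst set_integral_add) (auto intro!: set_integrable_mult_right)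
qed

lemma frac_lap_pv_lin:
  fixes f g :: "'a::euclidean_space \<Rightarrow> real"
  assumes "frac_lap_pv s f x L" "frac_lap_pv s g x L'"
  shows "frac_lap_pv s (\<lambda>y. a * f y + b * g y) x (a * L + b * L')"
  unfolding frac_lap_pv_trunc
proof (intro conjI allI impI)
  fix \<epsilon> :: real assume "\<epsilon> > 0"
  with assms show "set_integrable lborel (- ball x \<epsilon>) (\<lambda>y. ((a * f x + b * g x) - (a * f y + b * g y)) * frac_kernel s x y)"
    by (intro frac_trunc_lin) (auto simp: frac_lap_pv_trunc)
next
  have "((\<lambda>\<epsilon>. a * (frac_const DIM('a) s * frac_trunc s f x \<epsilon>) + b * (frac_const DIM('a) s * frac_trunc s g x \<epsilon>))
    \<longlongrightarrow> a * L + b * L') (at_right 0)"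
    using assms by (intro tendsto_intros) (auto simp: frac_lap_pv_trunc)
  moreover have "eventually (\<lambda>\<epsilon>::real. \<epsilon> > 0) (at_right 0)" by (simp add: eventually_at_right_less)
  then have "eventually (\<lambda>\<epsilon>. a * (frac_const DIM('a) s * frac_trunc s f x \<epsilon>) + b * (frac_const DIM('a) s * frac_trunc s g x \<epsilon>)
    = frac_const DIM('a) s * frac_trunc s (\<lambda>y. a * f y + b * g y) x \<epsilon>) (at_right 0)"
  proof eventually_elim
    case (elim \<epsilon>)
    then have "frac_trunc s (\<lambda>y. a * f y + b * g y) x \<epsilon> = a * frac_trunc s f x \<epsilon> + b * frac_trunc s g x \<epsilon>"
      using assms by (intro frac_trunc_lin) (auto simp: frac_lap_pv_trunc)
    then show ?case by (simp add: algebra_simps)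
  qed
  ultimately show "((\<lambda>\<epsilon>. frac_const DIM('a) s * frac_trunc s (\<lambda>y. a * f y + b * g y) x \<epsilon>) \<longlongrightarrow> a * L + b * L') (at_right 0)"
    by (rule Lim_transform_eventually)
qed

lemma frac_lap_pv_const: "frac_lap_pv s (\<lambda>_. c) x 0"
  by (simp add: frac_lap_pv_def set_integrable_def)

section \<open>The operator under dilations and reflections\<close>

lemma integral_lborel_affine:
  fixes f :: "'a::euclidean_space \<Rightarrow> real" and t :: 'a
  assumes [measurable]: "f \<in> borel_measurable borel" and c: "c \<noteq> 0"
  shows "integrable lborel (\<lambda>x. f (t + c *\<^sub>R x)) \<longleftrightarrow> integrable lborel f"
    and "(\<integral>x. f x \<partial>lborel) = \<bar>c\<bar> ^ DIM('a) * (\<integral>x. f (t + c *\<^sub>R x) \<partial>lborel)"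
proof -
  have d: "density (distr lborel borel (\<lambda>x. t + c *\<^sub>R x)) (\<lambda>_. ennreal (\<bar>c\<bar> ^ DIM('a))) = lborel"
    using lborel_affine[OF c, of t] by simp
  have "integrable lborel f \<longleftrightarrow> integrable (density (distr lborel borel (\<lambda>x. t + c *\<^sub>R x)) (\<lambda>_. ennreal (\<bar>c\<bar> ^ DIM('a)))) f"
    by (simp only: d)
  also have "\<dots> \<longleftrightarrow> integrable lborel (\<lambda>x. f (t + c *\<^sub>R x))"
    using c by (subst integrable_density) (auto simp: integrable_distr_eq)
  finally show "integrable lborel (\<lambda>x. f (t + c *\<^sub>R x)) \<longleftrightarrow> integrable lborel f" ..
  have "(\<integral>x. f x \<partial>lborel) = (\<integral>x. f x \<partial>density (distr lborel borel (\<lambda>x. t + c *\<^sub>R x)) (\<lambda>_. ennreal (\<bar>c\<bar> ^ DIM('a))))"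
    by (simp only: d)
  also have "\<dots> = \<bar>c\<bar> ^ DIM('a) * (\<integral>x. f (t + c *\<^sub>R x) \<partial>lborel)"
    by (subst integral_density) (auto simp: integral_distr)
  finally show "(\<integral>x. f x \<partial>lborel) = \<bar>c\<bar> ^ DIM('a) * (\<integral>x. f (t + c *\<^sub>R x) \<partial>lborel)" .
qed

lemma integral_hrefl:
  fixes f :: "'a::euclidean_space \<Rightarrow> real"
  assumes e: "norm e = 1" and [measurable]: "f \<in> borel_measurable borel"
  shows "integrable lborel (\<lambda>x. f (hrefl e \<mu> x)) \<longleftrightarrow> integrable lborel f"
    and "(\<integral>x. f (hrefl e \<mu> x) \<partial>lborel) = (\<integral>x. f x \<partial>lborel)"
proof -
  have "integrable lborel (\<lambda>x. f (hrefl e \<mu> x)) \<longleftrightarrow> integrable (distr lborel borel (hrefl e \<mu>)) f"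
    by (simp add: integrable_distr_eq)
  then show "integrable lborel (\<lambda>x. f (hrefl e \<mu> x)) \<longleftrightarrow> integrable lborel f"
    by (simp only: distr_lborel_hrefl[OF e])
  have "(\<integral>x. f (hrefl e \<mu> x) \<partial>lborel) = (\<integral>x. f x \<partial>distr lborel borel (hrefl e \<mu>))"
    by (simp add: integral_distr)
  then show "(\<integral>x. f (hrefl e \<mu> x) \<partial>lborel) = (\<integral>x. f x \<partial>lborel)"
    by (simp only: distr_lborel_hrefl[OF e])
qed

text \<open>The inverse of the contraction by k towards b: \<open>u (dil b k x)\<close> is the copy
  of u that lives on b + k(\<Omega> - b).\<close>

definition dil :: "'a::real_vector \<Rightarrow> real \<Rightarrow> 'a \<Rightarrow> 'a" where
  "dil b k y = b + (y - b) /\<^sub>R k"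

lemma dil_diff: "dil b k x - dil b k y = (x - y) /\<^sub>R k"
  by (simp add: dil_def algebra_simps)

lemma dil_inverse: "k \<noteq> 0 \<Longrightarrow> dil b k (dil b (inverse k) x) = x" "k \<noteq> 0 \<Longrightarrow> dil b (inverse k) (dil b k x) = x"
  by (simp_all add: dil_def)

lemma dil_inverse_eq: "dil b (inverse k) x = b + k *\<^sub>R (x - b)"
  by (simp add: dil_def)

lemma continuous_on_dil [continuous_intros]: "continuous_on A (dil b k :: 'a::real_normed_vector \<Rightarrow> 'a)"
  unfolding dil_def by (intro continuous_intros)

lemma measurable_dil [measurable]: "dil b k \<in> borel_measurable (borel :: 'a::euclidean_space measure)"
  by (rule borel_measurable_continuous_onI) (rule continuous_on_dil)

lemma dil_affine: "dil b k y = (b - b /\<^sub>R k) + inverse k *\<^sub>R y"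
  by (simp add: dil_def algebra_simps)

lemma integral_dil:
  fixes f :: "'a::euclidean_space \<Rightarrow> real"
  assumes [measurable]: "f \<in> borel_measurable borel" and k: "0 < k"
  shows "integrable lborel (\<lambda>x. f (dil b k x)) \<longleftrightarrow> integrable lborel f"
    and "(\<integral>x. f (dil b k x) \<partial>lborel) = k ^ DIM('a) * (\<integral>x. f x \<partial>lborel)"
  unfolding dil_affine
  using integral_lborel_affine[of f "inverse k" "b - b /\<^sub>R k"] k by (auto simp: power_inverse)

text \<open>By substitution: the kernel contributes k^(-N-2s) and the volume element k^N.\<close>

lemma frac_trunc_dil:
  fixes f :: "'a::euclidean_space \<Rightarrow> real"
  assumes [measurable]: "f \<in> borel_measurable borel" and k: "0 < k"
  shows "set_integrable lborel (- ball x \<epsilon>) (\<lambda>y. (f (dil b k x) - f (dil b k y)) * frac_kernel s x y)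
      \<longleftrightarrow> set_integrable lborel (- ball (dil b k x) (\<epsilon> / k)) (\<lambda>y. (f (dil b k x) - f y) * frac_kernel s (dil b k x) y)"
    and "frac_trunc s (\<lambda>y. f (dil b k y)) x \<epsilon> = k powr (- 2 * s) * frac_trunc s f (dil b k x) (\<epsilon> / k)"
proof -
  define G where "G z = indicat_real (- ball (dil b k x) (\<epsilon> / k)) z *\<^sub>R ((f (dil b k x) - f z) * frac_kernel s (dil b k x) z)" for z
  have [measurable]: "ball y r \<in> sets borel" for y :: 'a and r by simp
  have G[measurable]: "G \<in> borel_measurable borel" unfolding G_def by measurable
  have n: "norm (dil b k x - dil b k y) = norm (x - y) / k" for y
    using k by (simp add: dil_diff divide_inverse mult.commute)
  have K: "frac_kernel s x y = k powr (- (real DIM('a) + 2 * s)) * frac_kernel s (dil b k x) (dil b k y)" for y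
  proof -
    define \<gamma> where "\<gamma> = real DIM('a) + 2 * s"
    show ?thesis unfolding frac_kernel_def n \<gamma>_def[symmetric]
      using k by (simp add: powr_divide powr_minus_divide)
  qed
  have eq: "indicat_real (- ball x \<epsilon>) y *\<^sub>R ((f (dil b k x) - f (dil b k y)) * frac_kernel s x y)
     = k powr (- (real DIM('a) + 2 * s)) * G (dil b k y)" for y
  proof -
    have "dil b k y \<in> ball (dil b k x) (\<epsilon> / k) \<longleftrightarrow> y \<in> ball x \<epsilon>"
      using k by (simp add: dist_norm n divide_less_cancel)
    then show ?thesis by (simp add: G_def K indicator_def)
  qed
  have "integrable lborel (\<lambda>y. k powr (- (real DIM('a) + 2 * s)) * G (dil b k y)) \<longleftrightarrow> integrable lborel G"
    using k by (simp add: integral_dil(1))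
  then show "set_integrable lborel (- ball x \<epsilon>) (\<lambda>y. (f (dil b k x) - f (dil b k y)) * frac_kernel s x y)
      \<longleftrightarrow> set_integrable lborel (- ball (dil b k x) (\<epsilon> / k)) (\<lambda>y. (f (dil b k x) - f y) * frac_kernel s (dil b k x) y)"
    unfolding set_integrable_def eq G_def .
  have "frac_trunc s (\<lambda>y. f (dil b k y)) x \<epsilon> = k powr (- (real DIM('a) + 2 * s)) * (k ^ DIM('a) * (\<integral>z. G z \<partial>lborel))"
    unfolding frac_trunc_def set_lebesgue_integral_def eq using k by (simp add: integral_dil(2))
  also have "\<dots> = (k powr (- (real DIM('a) + 2 * s)) * k powr (real DIM('a))) * (\<integral>z. G z \<partial>lborel)"
    using k by (simp add: powr_realpow)
  also have "k powr (- (real DIM('a) + 2 * s)) * k powr (real DIM('a)) = k powr (- 2 * s)"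
    by (simp flip: powr_add)
  finally show "frac_trunc s (\<lambda>y. f (dil b k y)) x \<epsilon> = k powr (- 2 * s) * frac_trunc s f (dil b k x) (\<epsilon> / k)"
    by (simp add: frac_trunc_def set_lebesgue_integral_def G_def)
qed

lemma frac_lap_pv_dil:
  fixes f :: "'a::euclidean_space \<Rightarrow> real"
  assumes f: "f \<in> borel_measurable borel" and k: "0 < k" and L: "frac_lap_pv s f (dil b k x) L"
  shows "frac_lap_pv s (\<lambda>y. f (dil b k y)) x (k powr (- 2 * s) * L)"
  unfolding frac_lap_pv_trunc
proof (intro conjI allI impI)
  fix \<epsilon> :: real assume "\<epsilon> > 0"
  then show "set_integrable lborel (- ball x \<epsilon>) (\<lambda>y. (f (dil b k x) - f (dil b k y)) * frac_kernel s x y)"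
    using L k by (simp add: frac_trunc_dil(1)[OF f k] frac_lap_pv_trunc)
next
  have "filterlim (\<lambda>\<epsilon>. \<epsilon> / k) (at_right 0) (at_right 0)"
    using k by (auto simp: filterlim_at eventually_at_right_less intro!: tendsto_eq_intros eventually_mono[OF eventually_at_right_less])
  moreover have "((\<lambda>\<epsilon>. frac_const DIM('a) s * frac_trunc s f (dil b k x) \<epsilon>) \<longlongrightarrow> L) (at_right 0)"
    using L by (simp add: frac_lap_pv_trunc)
  ultimately have "((\<lambda>\<epsilon>. frac_const DIM('a) s * frac_trunc s f (dil b k x) (\<epsilon> / k)) \<longlongrightarrow> L) (at_right 0)"
    by (rule filterlim_compose[rotated])
  then have "((\<lambda>\<epsilon>. k powr (- 2 * s) * (frac_const DIM('a) s * frac_trunc s f (dil b k x) (\<epsilon> / k))) \<longlongrightarrow> k powr (- 2 * s) * L) (at_right 0)"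
    by (intro tendsto_intros)
  then show "((\<lambda>\<epsilon>. frac_const DIM('a) s * frac_trunc s (\<lambda>y. f (dil b k y)) x \<epsilon>) \<longlongrightarrow> k powr (- 2 * s) * L) (at_right 0)"
    unfolding frac_trunc_dil(2)[OF f k] by (simp add: mult_ac)
qed

lemma frac_trunc_hrefl:
  fixes f :: "'a::euclidean_space \<Rightarrow> real"
  assumes [measurable]: "f \<in> borel_measurable borel" and e: "norm e = 1"
  shows "set_integrable lborel (- ball x \<epsilon>) (\<lambda>y. (f (hrefl e \<mu> x) - f (hrefl e \<mu> y)) * frac_kernel s x y)
      \<longleftrightarrow> set_integrable lborel (- ball (hrefl e \<mu> x) \<epsilon>) (\<lambda>y. (f (hrefl e \<mu> x) - f y) * frac_kernel s (hrefl e \<mu> x) y)"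
    and "frac_trunc s (\<lambda>y. f (hrefl e \<mu> y)) x \<epsilon> = frac_trunc s f (hrefl e \<mu> x) \<epsilon>"
proof -
  define G where "G z = indicat_real (- ball (hrefl e \<mu> x) \<epsilon>) z *\<^sub>R ((f (hrefl e \<mu> x) - f z) * frac_kernel s (hrefl e \<mu> x) z)" for z
  have [measurable]: "ball y r \<in> sets borel" for y :: 'a and r by simp
  have G[measurable]: "G \<in> borel_measurable borel" unfolding G_def by measurable
  have K: "frac_kernel s x y = frac_kernel s (hrefl e \<mu> x) (hrefl e \<mu> y)" for y
    by (simp add: frac_kernel_def norm_hrefl_diff[OF e])
  have eq: "indicat_real (- ball x \<epsilon>) y *\<^sub>R ((f (hrefl e \<mu> x) - f (hrefl e \<mu> y)) * frac_kernel s x y) = G (hrefl e \<mu> y)" for y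
  proof -
    have "hrefl e \<mu> y \<in> ball (hrefl e \<mu> x) \<epsilon> \<longleftrightarrow> y \<in> ball x \<epsilon>"
      by (simp add: dist_norm norm_hrefl_diff[OF e])
    then show ?thesis by (simp add: G_def K indicator_def)
  qed
  show "set_integrable lborel (- ball x \<epsilon>) (\<lambda>y. (f (hrefl e \<mu> x) - f (hrefl e \<mu> y)) * frac_kernel s x y)
      \<longleftrightarrow> set_integrable lborel (- ball (hrefl e \<mu> x) \<epsilon>) (\<lambda>y. (f (hrefl e \<mu> x) - f y) * frac_kernel s (hrefl e \<mu> x) y)"
    unfolding set_integrable_def eq integral_hrefl(1)[OF e G] unfolding G_def ..
  show "frac_trunc s (\<lambda>y. f (hrefl e \<mu> y)) x \<epsilon> = frac_trunc s f (hrefl e \<mu> x) \<epsilon>"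
    unfolding frac_trunc_def set_lebesgue_integral_def eq integral_hrefl(2)[OF e G] unfolding G_def ..
qed

lemma frac_lap_pv_hrefl:
  fixes f :: "'a::euclidean_space \<Rightarrow> real"
  assumes f: "f \<in> borel_measurable borel" and e: "norm e = 1" and L: "frac_lap_pv s f (hrefl e \<mu> x) L"
  shows "frac_lap_pv s (\<lambda>y. f (hrefl e \<mu> y)) x L"
  using L unfolding frac_lap_pv_trunc frac_trunc_hrefl[OF f e] .

section \<open>The kernel and its mirror image\<close>

lemma frac_kernel_ge:
  fixes x y :: "'a::euclidean_space"
  assumes "x \<noteq> y" "norm (x - y) \<le> R" "0 < s"
  shows "1 / R powr (real DIM('a) + 2 * s) \<le> frac_kernel s x y"
  unfolding frac_kernel_def using assms
  by (intro frac_le powr_mono2) auto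

lemma frac_kernel_le:
  fixes x y :: "'a::euclidean_space"
  assumes "0 < d" "d \<le> norm (x - y)" "0 < s"
  shows "frac_kernel s x y \<le> 1 / d powr (real DIM('a) + 2 * s)"
  unfolding frac_kernel_def using assms
  by (intro frac_le powr_mono2) auto

lemma norm_diff_hrefl_ge:
  assumes e: "norm e = 1" and "x \<bullet> e \<le> \<mu>" "z \<bullet> e \<le> \<mu>"
  shows "norm (x - z) \<le> norm (x - hrefl e \<mu> z)"
proof (rule power2_le_imp_le)
  show "(norm (x - z))\<^sup>2 \<le> (norm (x - hrefl e \<mu> z))\<^sup>2"
    unfolding norm_diff_hrefl[OF e] using assms by simp
qed simp

lemma frac_kernel_hrefl_le:
  fixes x z :: "'a::euclidean_space"
  assumes "norm e = 1" "x \<bullet> e \<le> \<mu>" "z \<bullet> e \<le> \<mu>" "x \<noteq> z" "0 < s"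
  shows "frac_kernel s x (hrefl e \<mu> z) \<le> frac_kernel s x z"
  using frac_kernel_le[of "norm (x - z)" x "hrefl e \<mu> z" s] norm_diff_hrefl_ge[OF assms(1-3)] assms
  by (simp add: frac_kernel_def)

text \<open>Mean value theorem for t^(-\<alpha>) between the two squared distances, whose difference
  is the product in \<open>norm_diff_hrefl\<close>. The factor \<mu> - x \<bullet> e becomes the
  extra power of d in the Hopf estimate.\<close>

lemma frac_kernel_hrefl_gap:
  fixes x z :: "'a::euclidean_space"
  assumes e: "norm e = 1" and x: "x \<bullet> e < \<mu>" and z: "z \<bullet> e < \<mu>" and "x \<noteq> z" and s: "0 < s"
    and R: "norm (x - hrefl e \<mu> z) \<le> R"
  defines "\<alpha> \<equiv> (real DIM('a) + 2 * s) / 2"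
  shows "4 * \<alpha> / (R\<^sup>2) powr (\<alpha> + 1) * (\<mu> - x \<bullet> e) * (\<mu> - z \<bullet> e) \<le> frac_kernel s x z - frac_kernel s x (hrefl e \<mu> z)"
proof -
  define A where "A = (norm (x - z))\<^sup>2"
  define B where "B = (norm (x - hrefl e \<mu> z))\<^sup>2"
  have \<alpha>: "\<alpha> > 0" using s by (simp add: \<alpha>_def add_nonneg_pos)
  have A: "A > 0" using \<open>x \<noteq> z\<close> by (simp add: A_def)
  have BA: "B - A = 4 * (\<mu> - x \<bullet> e) * (\<mu> - z \<bullet> e)" by (simp add: A_def B_def norm_diff_hrefl[OF e])
  have "A < B" using x z by (smt (verit) BA mult_pos_pos)
  have BR: "B \<le> R\<^sup>2" unfolding B_def using R by (intro power_mono) auto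
  have K: "frac_kernel s x y = ((norm (x - y))\<^sup>2) powr (- \<alpha>)" if "x \<noteq> y" for y
  proof -
    have "((norm (x - y))\<^sup>2) powr (- \<alpha>) = norm (x - y) powr (- (real DIM('a) + 2 * s))"
    proof -
      have "2 * (- \<alpha>) = - (real DIM('a) + 2 * s)" by (simp add: \<alpha>_def field_simps)
      moreover have "((norm (x - y))\<^sup>2) powr (- \<alpha>) = norm (x - y) powr (2 * (- \<alpha>))"
      proof -
        have "(norm (x - y))\<^sup>2 = norm (x - y) powr 2" using that by simp
        then show ?thesis by (simp only: powr_powr)
      qed
      ultimately show ?thesis by (simp only:)
    qed
    then show ?thesis unfolding frac_kernel_def by (simp only: powr_minus_divide)
  qed
  have "x \<noteq> hrefl e \<mu> z" using \<open>A < B\<close> A by (auto simp: B_def)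
  have "\<exists>\<xi>>A. \<xi> < B \<and> B powr (- \<alpha>) - A powr (- \<alpha>) = (B - A) * (- \<alpha> * \<xi> powr (- \<alpha> - 1))"
    using A by (intro MVT2[OF \<open>A < B\<close>] has_real_derivative_powr) auto
  then obtain \<xi> where \<xi>: "A < \<xi>" "\<xi> < B" "B powr (- \<alpha>) - A powr (- \<alpha>) = (B - A) * (- \<alpha> * \<xi> powr (- \<alpha> - 1))" by blast
  have "(R\<^sup>2) powr (- \<alpha> - 1) \<le> \<xi> powr (- \<alpha> - 1)"
    using \<xi> BR A \<alpha> by (intro powr_mono2') auto
  then have "(B - A) * (\<alpha> * (R\<^sup>2) powr (- \<alpha> - 1)) \<le> (B - A) * (\<alpha> * \<xi> powr (- \<alpha> - 1))"
    using \<open>A < B\<close> \<alpha> by (intro mult_left_mono) auto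
  also have "\<dots> = A powr (- \<alpha>) - B powr (- \<alpha>)" using \<xi>(3) by simp
  also have "\<dots> = frac_kernel s x z - frac_kernel s x (hrefl e \<mu> z)"
    using K[OF \<open>x \<noteq> z\<close>] K[OF \<open>x \<noteq> hrefl e \<mu> z\<close>] by (simp add: A_def B_def)
  also have "(B - A) * (\<alpha> * (R\<^sup>2) powr (- \<alpha> - 1)) = 4 * \<alpha> / (R\<^sup>2) powr (\<alpha> + 1) * (\<mu> - x \<bullet> e) * (\<mu> - z \<bullet> e)"
  proof -
    have "- \<alpha> - 1 = - (\<alpha> + 1)" by simp
    then have "(R\<^sup>2) powr (- \<alpha> - 1) = 1 / (R\<^sup>2) powr (\<alpha> + 1)" by (simp only: powr_minus_divide)
    then show ?thesis by (simp add: BA)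
  qed
  finally show ?thesis .
qed

section \<open>The operator at a touching point\<close>

lemma tendsto_measure_ball: "((\<lambda>\<epsilon>. measure lborel (ball (x::'a::euclidean_space) \<epsilon>)) \<longlongrightarrow> 0) (at_right 0)"
proof -
  have "((\<lambda>\<epsilon>::real. unit_ball_vol (real DIM('a)) * \<epsilon> ^ DIM('a)) \<longlongrightarrow> unit_ball_vol (real DIM('a)) * 0 ^ DIM('a)) (at_right 0)"
    by (intro tendsto_intros)
  moreover have "eventually (\<lambda>\<epsilon>::real. unit_ball_vol (real DIM('a)) * \<epsilon> ^ DIM('a) = measure lborel (ball x \<epsilon>)) (at_right 0)"
    using eventually_at_right_less[of 0] by eventually_elim (simp add: content_ball)
  ultimately have "((\<lambda>\<epsilon>. measure lborel (ball x \<epsilon>)) \<longlongrightarrow> unit_ball_vol (real DIM('a)) * 0 ^ DIM('a)) (at_right 0)"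
    by (rule Lim_transform_eventually)
  then show ?thesis unfolding zero_power[OF DIM_positive] mult_zero_right .
qed

text \<open>\<open>g\<close> is an integrable minorant, bounded above by \<open>Gb\<close>, of the
  singular integrand. Removing the ball of radius \<epsilon> from its integral therefore costs at
  most \<open>Gb\<close> times a volume that vanishes in the limit.\<close>

lemma frac_trunc_touch_le:
  fixes F g :: "'a::euclidean_space \<Rightarrow> real"
  assumes int: "set_integrable lborel (- ball x \<epsilon>) (\<lambda>y. (F x - F y) * frac_kernel s x y)"
    and F: "F x = 0"
    and g: "integrable lborel g" "\<And>y. g y \<le> Gb" "\<And>y. y \<noteq> x \<Longrightarrow> g y \<le> F y * frac_kernel s x y"
    and "0 < \<epsilon>"
  shows "frac_trunc s F x \<epsilon> \<le> - (\<integral>y. g y \<partial>lborel) + Gb * measure lborel (ball x \<epsilon>)"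
proof -
  have [measurable]: "ball x \<epsilon> \<in> sets borel" by simp
  have ib: "integrable lborel (indicat_real (ball x \<epsilon>))"
    by (rule integrable_real_indicator) (use emeasure_lborel_ball_finite[of x \<epsilon>] in auto)
  have "(\<integral>y. g y - Gb * indicat_real (ball x \<epsilon>) y \<partial>lborel)
      \<le> (\<integral>y. - (indicat_real (- ball x \<epsilon>) y *\<^sub>R ((F x - F y) * frac_kernel s x y)) \<partial>lborel)"
  proof (rule integral_mono)
    show "integrable lborel (\<lambda>y. g y - Gb * indicat_real (ball x \<epsilon>) y)"
      using g ib by auto
    show "integrable lborel (\<lambda>y. - (indicat_real (- ball x \<epsilon>) y *\<^sub>R ((F x - F y) * frac_kernel s x y)))"
      using int unfolding set_integrable_def by (rule integrable_minus)
    fix y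
    show "g y - Gb * indicat_real (ball x \<epsilon>) y \<le> - (indicat_real (- ball x \<epsilon>) y *\<^sub>R ((F x - F y) * frac_kernel s x y))"
    proof (cases "y \<in> ball x \<epsilon>")
      case True
      then show ?thesis using g(2)[of y] by simp
    next
      case False
      then have "y \<noteq> x" using \<open>0 < \<epsilon>\<close> by auto
      then show ?thesis using False g(3)[of y] by (simp add: F)
    qed
  qed
  also have "\<dots> = - frac_trunc s F x \<epsilon>"
    by (simp add: frac_trunc_def set_lebesgue_integral_def)
  also have "(\<integral>y. g y - Gb * indicat_real (ball x \<epsilon>) y \<partial>lborel) = (\<integral>y. g y \<partial>lborel) - Gb * measure lborel (ball x \<epsilon>)"
    using g ib by simp
  finally show ?thesis by simp
qed

text \<open>Averaging the integrand over z and its mirror image puts the nonnegative weight K - K'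
  on F z - F x and the weight K' on F z plus F at the mirror image. A lower bound for that sum thus
  takes the place of antisymmetry.\<close>

lemma frac_trunc_antisym_le:
  fixes F g :: "'a::euclidean_space \<Rightarrow> real"
  assumes s: "0 < s" and e: "norm e = 1"
    and int: "set_integrable lborel (- ball x \<epsilon>) (\<lambda>y. (F x - F y) * frac_kernel s x y)"
    and Fm: "F \<in> borel_measurable borel" and Fb: "\<And>y. \<bar>F y\<bar> \<le> Mb"
    and Fx: "F x \<le> 0"
    and g: "integrable lborel g" "\<And>y. 0 \<le> g y" "\<And>y. g y \<le> Gb"
    and gF: "\<And>z. z \<bullet> e \<le> \<mu> \<Longrightarrow> z \<noteq> x \<Longrightarrow> g z + g (hrefl e \<mu> z)
        \<le> (F z - F x) * (frac_kernel s x z - frac_kernel s x (hrefl e \<mu> z)) + (F z + F (hrefl e \<mu> z)) * frac_kernel s x (hrefl e \<mu> z)"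
    and \<epsilon>: "0 < \<epsilon>" "\<epsilon> \<le> \<mu> - x \<bullet> e"
  shows "frac_trunc s F x \<epsilon> \<le> - (\<integral>y. g y \<partial>lborel)
    + (2 * Gb + Mb / (\<mu> - x \<bullet> e) powr (real DIM('a) + 2 * s)) * measure lborel (ball x \<epsilon>)"
proof -
  let ?R = "hrefl e \<mu>"
  define d where "d = \<mu> - x \<bullet> e"
  \<comment> \<open>The excised ball has no excised mirror image: for z in it the term at
    \<open>?R z\<close> survives. It is at least -Mb/d^(N+2s), because \<open>?R z\<close> has
    distance at least d from x.\<close>
  define E where "E = 2 * Gb + Mb / d powr (real DIM('a) + 2 * s)"
  define h where "h y = - (indicat_real (- ball x \<epsilon>) y *\<^sub>R ((F x - F y) * frac_kernel s x y))" for y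
  define I where "I y = E * indicat_real (ball x \<epsilon>) y" for y
  have d: "d > 0" using \<epsilon> by (simp add: d_def)
  have Gb: "Gb \<ge> 0" using g(2,3)[of x] by linarith
  have Mb: "Mb \<ge> 0" using Fb[of x] by linarith
  have E: "E \<ge> 0" using Gb Mb by (simp add: E_def)
  note Fm[measurable]
  have [measurable]: "ball x \<epsilon> \<in> sets borel" by simp
  have ih: "integrable lborel h" unfolding h_def using int unfolding set_integrable_def by (rule integrable_minus)
  have hm: "h \<in> borel_measurable borel" unfolding h_def by measurable
  have gm: "g \<in> borel_measurable borel" using g(1) by auto
  have iI: "integrable lborel I" unfolding I_def
    by (intro integrable_mult_right integrable_real_indicator) (use emeasure_lborel_ball_finite[of x \<epsilon>] in auto)
  have Im: "I \<in> borel_measurable borel" unfolding I_def by measurable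
  have far: "d \<le> norm (x - z)" if "\<mu> \<le> z \<bullet> e" for z
  proof -
    have "d \<le> (z - x) \<bullet> e" using that by (simp add: d_def inner_diff_left)
    also have "\<dots> \<le> norm (z - x) * norm e" by (rule norm_cauchy_schwarz)
    finally show ?thesis using e by (simp add: norm_minus_commute)
  qed
  have core: "g z + g (?R z) - (I z + I (?R z)) \<le> h z + h (?R z)" if z: "z \<bullet> e \<le> \<mu>" for z
  proof -
    have "\<mu> \<le> ?R z \<bullet> e" using z by (simp add: hrefl_inner[OF e])
    then have fz: "d \<le> norm (x - ?R z)" by (rule far)
    then have nb: "?R z \<notin> ball x \<epsilon>" using \<epsilon> by (simp add: dist_norm d_def)
    let ?K = "frac_kernel s x z" and ?K' = "frac_kernel s x (?R z)"
    have K': "0 \<le> ?K'" "?K' \<le> 1 / d powr (real DIM('a) + 2 * s)"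
      using frac_kernel_le[OF d fz s] by (auto simp: frac_kernel_nonneg)
    show ?thesis
    proof (cases "z \<in> ball x \<epsilon>")
      case False
      then have zx: "z \<noteq> x" using \<epsilon> by auto
      have "h z + h (?R z) = (F z - F x) * ?K + (F (?R z) - F x) * ?K'"
        using False nb by (simp add: h_def algebra_simps)
      \<comment> \<open>The term -2 F(x) K' left over by this rearrangement is nonnegative, since F
        x <= 0.\<close>
      also have "\<dots> = (F z - F x) * (?K - ?K') + (F z + F (?R z)) * ?K' + (- 2 * F x) * ?K'"
        by (simp add: algebra_simps)
      also have "\<dots> \<ge> (F z - F x) * (?K - ?K') + (F z + F (?R z)) * ?K'"
        using Fx K' by (simp add: mult_nonpos_nonneg)
      finally have "(F z - F x) * (?K - ?K') + (F z + F (?R z)) * ?K' \<le> h z + h (?R z)" by simp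
      moreover have "0 \<le> I z + I (?R z)" using E by (simp add: I_def)
      ultimately show ?thesis using gF[OF z zx] by linarith
    next
      case True
      have "h z + h (?R z) = (F (?R z) - F x) * ?K'" using True nb by (simp add: h_def algebra_simps)
      also have "\<dots> \<ge> (- Mb) * ?K'" using Fb[of "?R z"] Fx K' by (intro mult_right_mono) auto
      finally have "- (Mb * ?K') \<le> h z + h (?R z)" by simp
      moreover have "Mb * ?K' \<le> Mb * (1 / d powr (real DIM('a) + 2 * s))" using K' Mb by (intro mult_left_mono) auto
      moreover have "I z = E" "I (?R z) = 0" using True nb by (auto simp: I_def)
      moreover have "g z \<le> Gb" "g (?R z) \<le> Gb" by (rule g)+
      ultimately show ?thesis by (simp add: E_def)
    qed
  qed
  \<comment> \<open>Both sides are unchanged when z and its mirror image are exchanged, so the half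
    space suffices.\<close>
  have all: "g z + g (?R z) - (I z + I (?R z)) \<le> h z + h (?R z)" for z
  proof (cases "z \<bullet> e \<le> \<mu>")
    case True then show ?thesis by (rule core)
  next
    case False
    then have "?R z \<bullet> e \<le> \<mu>" by (simp add: hrefl_inner[OF e])
    from core[OF this] show ?thesis by (simp add: e add.commute)
  qed
  have iR: "integrable lborel (\<lambda>z. h (?R z))" "integrable lborel (\<lambda>z. g (?R z))" "integrable lborel (\<lambda>z. I (?R z))"
    using integral_hrefl(1)[OF e hm] integral_hrefl(1)[OF e gm] integral_hrefl(1)[OF e Im] ih iI g(1) by auto
  have "(\<integral>z. g z + g (?R z) - (I z + I (?R z)) \<partial>lborel) \<le> (\<integral>z. h z + h (?R z) \<partial>lborel)"
    by (rule integral_mono) (use all iR ih iI g(1) in auto)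
  also have "\<dots> = 2 * (\<integral>z. h z \<partial>lborel)"
    using ih iR by (simp add: integral_hrefl(2)[OF e hm])
  also have "(\<integral>z. g z + g (?R z) - (I z + I (?R z)) \<partial>lborel) = 2 * (\<integral>z. g z \<partial>lborel) - 2 * (\<integral>z. I z \<partial>lborel)"
    using iI g(1) iR by (simp add: integral_hrefl(2)[OF e gm] integral_hrefl(2)[OF e Im])
  also have "(\<integral>z. I z \<partial>lborel) = E * measure lborel (ball x \<epsilon>)" by (simp add: I_def)
  also have "(\<integral>z. h z \<partial>lborel) = - frac_trunc s F x \<epsilon>"
    by (simp add: h_def frac_trunc_def set_lebesgue_integral_def)
  finally show ?thesis by (simp add: E_def d_def)
qed

lemma frac_lap_touch_le:
  fixes F g :: "'a::euclidean_space \<Rightarrow> real"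
  assumes s: "0 < s" "s < 1" and L: "frac_lap_pv s F x L" and F: "F x = 0"
    and g: "integrable lborel g" "\<And>y. g y \<le> Gb" "\<And>y. y \<noteq> x \<Longrightarrow> g y \<le> F y * frac_kernel s x y"
  shows "L \<le> - frac_const DIM('a) s * (\<integral>y. g y \<partial>lborel)"
proof -
  let ?c = "frac_const DIM('a) s"
  have c: "?c > 0" by (rule frac_const_pos[OF s])
  have "((\<lambda>\<epsilon>. ?c * (- (\<integral>y. g y \<partial>lborel) + Gb * measure lborel (ball x \<epsilon>))) \<longlongrightarrow> ?c * (- (\<integral>y. g y \<partial>lborel) + Gb * 0)) (at_right 0)"
    by (intro tendsto_intros tendsto_measure_ball)
  moreover have "((\<lambda>\<epsilon>. ?c * frac_trunc s F x \<epsilon>) \<longlongrightarrow> L) (at_right 0)" using L by (simp add: frac_lap_pv_trunc)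
  moreover have "eventually (\<lambda>\<epsilon>. ?c * frac_trunc s F x \<epsilon> \<le> ?c * (- (\<integral>y. g y \<partial>lborel) + Gb * measure lborel (ball x \<epsilon>))) (at_right 0)"
    using eventually_at_right_less[of 0]
  proof eventually_elim
    case (elim \<epsilon>)
    then show ?case using L c by (intro mult_left_mono frac_trunc_touch_le[OF _ F g]) (auto simp: frac_lap_pv_trunc)
  qed
  ultimately show ?thesis using tendsto_le[OF trivial_limit_at_right_real] by fastforce
qed

lemma frac_lap_antisym_le:
  fixes F g :: "'a::euclidean_space \<Rightarrow> real"
  assumes s: "0 < s" "s < 1" and e: "norm e = 1" and x: "x \<bullet> e < \<mu>"
    and L: "frac_lap_pv s F x L"
    and Fm: "F \<in> borel_measurable borel" and Fb: "\<And>y. \<bar>F y\<bar> \<le> Mb"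
    and Fx: "F x \<le> 0"
    and g: "integrable lborel g" "\<And>y. 0 \<le> g y" "\<And>y. g y \<le> Gb"
    and gF: "\<And>z. z \<bullet> e \<le> \<mu> \<Longrightarrow> z \<noteq> x \<Longrightarrow> g z + g (hrefl e \<mu> z)
        \<le> (F z - F x) * (frac_kernel s x z - frac_kernel s x (hrefl e \<mu> z)) + (F z + F (hrefl e \<mu> z)) * frac_kernel s x (hrefl e \<mu> z)"
  shows "L \<le> - frac_const DIM('a) s * (\<integral>y. g y \<partial>lborel)"
proof -
  let ?c = "frac_const DIM('a) s"
  define E where "E = 2 * Gb + Mb / (\<mu> - x \<bullet> e) powr (real DIM('a) + 2 * s)"
  have c: "?c > 0" by (rule frac_const_pos[OF s])
  have "((\<lambda>\<epsilon>. ?c * (- (\<integral>y. g y \<partial>lborel) + E * measure lborel (ball x \<epsilon>))) \<longlongrightarrow> ?c * (- (\<integral>y. g y \<partial>lborel) + E * 0)) (at_right 0)"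
    by (intro tendsto_intros tendsto_measure_ball)
  moreover have "((\<lambda>\<epsilon>. ?c * frac_trunc s F x \<epsilon>) \<longlongrightarrow> L) (at_right 0)" using L by (simp add: frac_lap_pv_trunc)
  moreover have "eventually (\<lambda>\<epsilon>. \<epsilon> \<in> {0<..<\<mu> - x \<bullet> e}) (at_right 0)"
    using x by (intro eventually_at_right_real) simp
  then have "eventually (\<lambda>\<epsilon>. ?c * frac_trunc s F x \<epsilon> \<le> ?c * (- (\<integral>y. g y \<partial>lborel) + E * measure lborel (ball x \<epsilon>))) (at_right 0)"
  proof eventually_elim
    case (elim \<epsilon>)
    then have "set_integrable lborel (- ball x \<epsilon>) (\<lambda>y. (F x - F y) * frac_kernel s x y)"
      using L by (simp add: frac_lap_pv_trunc)
    from frac_trunc_antisym_le[OF s(1) e this Fm Fb Fx g gF] elim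
    have "frac_trunc s F x \<epsilon> \<le> - (\<integral>y. g y \<partial>lborel) + E * measure lborel (ball x \<epsilon>)"
      by (simp add: E_def)
    then show ?case using c by (intro mult_left_mono) auto
  qed
  ultimately show ?thesis using tendsto_le[OF trivial_limit_at_right_real] by fastforce
qed

section \<open>Comparison principles for sublinear solutions\<close>

lemma rpow_le:
  assumes "0 \<le> a" "0 \<le> q" "q \<le> 1" shows "0 \<le> rpow a q" "rpow a q \<le> 1 + a"
proof -
  show "0 \<le> rpow a q" by (simp add: rpow_def)
  have "a powr q \<le> 1 + a"
  proof (cases "a \<le> 1")
    case True
    then have "a powr q \<le> 1 powr q" using assms by (intro powr_mono2) auto
    then show ?thesis using assms by simp
  next
    case False
    then have "a powr q \<le> a powr 1" using assms by (intro powr_mono) auto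
    then show ?thesis using False by simp
  qed
  then show "rpow a q \<le> 1 + a" using assms by (simp add: rpow_def)
qed

lemma rpow_mono: "0 \<le> a \<Longrightarrow> a \<le> b \<Longrightarrow> 0 \<le> q \<Longrightarrow> rpow a q \<le> rpow b q"
  by (simp add: rpow_def powr_mono2)

text \<open>Here p <= 2 enters: for q = p - 1 <= 1 and t >= 1 one has t^q <= t.\<close>

lemma rpow_mult_le:
  assumes "0 \<le> a" "0 \<le> q" "q \<le> 1" "1 \<le> t" shows "rpow (t * a) q \<le> t * rpow a q"
proof (cases "q = 0")
  case True
  then show ?thesis using assms by (simp add: rpow_def)
next
  case False
  have "t powr q \<le> t powr 1" using assms by (intro powr_mono) auto
  then have "t powr q * a powr q \<le> t * a powr q" using assms by (intro mult_right_mono) auto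
  then show ?thesis using False assms by (simp add: rpow_def powr_mult)
qed

text \<open>The 8 is 2/(1/2)^2, a bound for (1 + k)/k^2 in 1/k^2 - 1 = (1 - k)(1 + k)/k^2.\<close>

lemma powr_minus_two_le:
  fixes k s :: real
  assumes "1 / 2 \<le> k" "k \<le> 1" "0 < s" "s < 1"
  shows "k powr (- 2 * s) \<le> 1 + 8 * (1 - k)" "1 \<le> k powr (- 2 * s)"
proof -
  have "k powr (- 2 * s) \<le> k powr (- 2)" using assms by (intro powr_mono') auto
  also have "\<dots> = 1 / k\<^sup>2" using assms by (simp add: powr_minus_divide)
  also have "\<dots> \<le> 1 + 8 * (1 - k)"
  proof -
    have "1 / k\<^sup>2 - 1 = (1 - k) * ((1 + k) / k\<^sup>2)" using assms by (simp add: field_simps power2_eq_square)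
    also have "(1 + k) / k\<^sup>2 \<le> 2 / (1 / 2)\<^sup>2" using assms by (intro frac_le power_mono) auto
    then have "(1 - k) * ((1 + k) / k\<^sup>2) \<le> (1 - k) * 8" using assms by (intro mult_left_mono) (auto simp: power2_eq_square)
    finally show ?thesis by simp
  qed
  finally show "k powr (- 2 * s) \<le> 1 + 8 * (1 - k)" .
  have "1 powr (- 2 * s) \<le> k powr (- 2 * s)" using assms by (intro powr_mono2') auto
  then show "1 \<le> k powr (- 2 * s)" by simp
qed

text \<open>Both maps fix b, and their linear parts, a reflection and a multiple of the identity,
  commute.\<close>

lemma hrefl_dil:
  assumes "b \<bullet> e = \<mu>"
  shows "hrefl e \<mu> (dil b k z) = dil b k (hrefl e \<mu> z)"
proof -
  have "dil b k z \<bullet> e - \<mu> = (z \<bullet> e - \<mu>) / k" using assms by (simp add: dil_def inner_add_left inner_diff_left divide_inverse mult.commute)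
  then have "hrefl e \<mu> (dil b k z) = dil b k z - (2 * ((z \<bullet> e - \<mu>) / k)) *\<^sub>R e" by (simp only: hrefl_def)
  also have "\<dots> = dil b k (hrefl e \<mu> z)"
    by (simp add: hrefl_def dil_def scaleR_diff_right divide_inverse mult_ac)
  finally show ?thesis .
qed

lemma dil_inner:
  assumes "b \<bullet> e = \<mu>" shows "dil b k z \<bullet> e = \<mu> + (z \<bullet> e - \<mu>) / k"
  using assms by (simp add: dil_def inner_add_left inner_diff_left divide_inverse mult.commute)

lemma hrefl_fixed: "z \<bullet> e = \<mu> \<Longrightarrow> hrefl e \<mu> z = z"
  by (simp add: hrefl_def)

text \<open>\<open>kmin\<close> is the least value of the kernel at distances up to 5D, which covers
  points of \<Omega> and the mirror images that occur. The constants of the comparison depend on u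
  only through \<open>M\<close> and the integral of u.\<close>

locale sublinear_solution =
  fixes \<Omega> :: "'a::euclidean_space set" and u :: "'a \<Rightarrow> real" and s p lam D M cN kmin :: real
  assumes s: "0 < s" "s < 1" and p: "1 \<le> p" "p \<le> 2"
    and \<Omega>_open: "open \<Omega>" and \<Omega>_convex: "convex \<Omega>" and \<Omega>_D: "\<Omega> \<subseteq> ball 0 D"
    and u_cont: "continuous_on UNIV u" and u_nonneg: "\<And>x. 0 \<le> u x" and u_le: "\<And>x. u x \<le> M"
    and u_nontrivial: "\<exists>x. u x \<noteq> 0"
    and u_outside: "\<And>x. x \<notin> \<Omega> \<Longrightarrow> u x = 0"
    and pde: "\<And>x. x \<in> \<Omega> \<Longrightarrow> frac_lap_pv s u x (lam * rpow (u x) (p - 1))"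
    and cN_def: "cN = frac_const DIM('a) s" and kmin_def: "kmin = 1 / (5 * D) powr (real DIM('a) + 2 * s)"
begin

lemma cN_pos: "cN > 0" unfolding cN_def by (rule frac_const_pos[OF s])

lemmas touch_le = frac_lap_touch_le[where 'a='a, OF s, folded cN_def]
lemmas antisym_le = frac_lap_antisym_le[where 'a='a, OF s, folded cN_def]

lemma \<Omega>_nonempty: "\<Omega> \<noteq> {}" using u_nontrivial u_outside by auto

lemma D_pos: "D > 0" using \<Omega>_nonempty \<Omega>_D by (metis ball_eq_empty not_le_imp_less subset_empty)

lemma norm_\<Omega>: "x \<in> \<Omega> \<Longrightarrow> norm x < D" using \<Omega>_D by auto

lemma norm_diff_\<Omega>: "x \<in> \<Omega> \<Longrightarrow> y \<in> \<Omega> \<Longrightarrow> norm (x - y) < 2 * D"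
  using norm_\<Omega>[of x] norm_\<Omega>[of y] norm_triangle_ineq4[of x y] by linarith

lemma compact_closure_\<Omega>: "compact (closure \<Omega>)"
  using \<Omega>_D bounded_ball bounded_subset by (metis compact_closure)

lemma M_nonneg: "M \<ge> 0" using u_nonneg u_le order_trans by blast

lemma u_measurable [measurable]: "u \<in> borel_measurable borel"
  using u_cont by (rule borel_measurable_continuous_onI)

lemma u_pos_imp: "u x \<noteq> 0 \<Longrightarrow> x \<in> \<Omega>" using u_outside by blast

lemma u_integrable: "integrable lborel u"
proof -
  have "integrable lborel (\<lambda>x. indicator (cball 0 D) x *\<^sub>R u x)"
    by (rule borel_integrable_compact) (use u_cont continuous_on_subset in auto)
  moreover have "(\<lambda>x. indicator (cball 0 D) x *\<^sub>R u x) = u"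
    using u_outside norm_\<Omega> by (fastforce simp: indicator_def)
  ultimately show ?thesis by simp
qed

definition "mass = (\<integral>x. u x \<partial>lborel)"

lemma mass_pos: "mass > 0"
proof -
  obtain x1 where "u x1 \<noteq> 0" using u_nontrivial by blast
  then have x1: "u x1 > 0" using u_nonneg[of x1] by linarith
  have "isCont u x1" using u_cont by (simp add: continuous_on_eq_continuous_at)
  then obtain r where r: "r > 0" "\<And>y. dist x1 y < r \<Longrightarrow> dist (u y) (u x1) < u x1 / 2"
    using x1 unfolding continuous_at_eps_delta by (metis dist_commute half_gt_zero)
  have ge: "u x1 / 2 * indicat_real (ball x1 r) y \<le> u y" for y
  proof (cases "dist x1 y < r")
    case True
    then have "u x1 / 2 \<le> u y" using r(2)[OF True] unfolding dist_real_def by linarith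
    then show ?thesis using True by simp
  qed (simp add: u_nonneg)
  have ib: "integrable lborel (indicat_real (ball x1 r))"
    by (rule integrable_real_indicator) (use emeasure_lborel_ball_finite[of x1 r] in auto)
  have "0 < u x1 / 2 * measure lborel (ball x1 r)"
    using x1 content_ball_pos[OF r(1), of x1] by simp
  also have "\<dots> = (\<integral>y. u x1 / 2 * indicat_real (ball x1 r) y \<partial>lborel)" by simp
  also have "\<dots> \<le> mass" unfolding mass_def
    by (rule integral_mono) (use ib u_integrable ge in auto)
  finally show ?thesis .
qed

lemma kmin_pos: "kmin > 0" using D_pos by (simp add: kmin_def)

lemma kernel_ge_kmin: "(x::'a) \<noteq> y \<Longrightarrow> norm (x - y) \<le> 5 * D \<Longrightarrow> kmin \<le> frac_kernel s x y"
  unfolding kmin_def by (rule frac_kernel_ge[OF _ _ s(1)])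

text \<open>At a maximum point of u the function max u - u touches zero from above, so the
  fractional Laplacian of u, and with it the right-hand side, is nonnegative there.\<close>

lemma lam_nonneg: "lam \<ge> 0"
proof -
  obtain x0 where x0: "x0 \<in> closure \<Omega>" "\<And>y. y \<in> closure \<Omega> \<Longrightarrow> u y \<le> u x0"
    using continuous_attains_sup[OF compact_closure_\<Omega>, of u] \<Omega>_nonempty continuous_on_subset[OF u_cont]
    by (metis closure_eq_empty subset_UNIV)
  have max: "u y \<le> u x0" for y
    using x0 u_outside[of y] closure_subset[of \<Omega>] u_nonneg[of x0] by (cases "y \<in> \<Omega>") auto
  obtain x1 where "u x1 \<noteq> 0" using u_nontrivial by blast
  then have pos: "u x0 > 0" using max[of x1] u_nonneg[of x1] by linarith
  then have "x0 \<in> \<Omega>" using u_outside by force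
  then have "frac_lap_pv s (\<lambda>y. (- 1) * u y + 1 * u x0) x0 ((- 1) * (lam * rpow (u x0) (p - 1)) + 1 * 0)"
    by (intro frac_lap_pv_lin pde frac_lap_pv_const)
  then have "(- 1) * (lam * rpow (u x0) (p - 1)) + 1 * 0 \<le> - cN * (\<integral>y. 0 \<partial>(lborel::'a measure))"
    by (rule touch_le) (use max in \<open>auto intro!: mult_nonneg_nonneg frac_kernel_nonneg\<close>)
  then have "lam * rpow (u x0) (p - 1) \<ge> 0" by simp
  moreover have "rpow (u x0) (p - 1) > 0" using pos by (simp add: rpow_def)
  ultimately show ?thesis by (simp add: zero_le_mult_iff)
qed

text \<open>At a zero inside \<Omega> the fractional Laplacian would be at most -cN kmin times the
  integral of u, hence negative, against a nonnegative right-hand side. So \<Omega> is exactly the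
  set where u > 0.\<close>

lemma u_pos: "x \<in> \<Omega> \<Longrightarrow> u x > 0"
proof (rule ccontr)
  assume x: "x \<in> \<Omega>" and "\<not> u x > 0"
  then have 0: "u x = 0" using u_nonneg[of x] by simp
  have "lam * rpow (u x) (p - 1) \<le> - cN * (\<integral>y. kmin * u y \<partial>lborel)"
  proof (rule touch_le[OF pde[OF x] 0])
    show "integrable lborel (\<lambda>y. kmin * u y)" using u_integrable by simp
    show "kmin * u y \<le> kmin * M" for y using kmin_pos u_le[of y] by simp
    show "kmin * u y \<le> u y * frac_kernel s x y" if "y \<noteq> x" for y
    proof (cases "y \<in> \<Omega>")
      case True
      then have "kmin \<le> frac_kernel s x y"
        using that norm_diff_\<Omega>[OF x True] D_pos by (intro kernel_ge_kmin) auto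
      then show ?thesis using u_nonneg[of y] by (metis mult.commute mult_left_mono)
    qed (simp add: u_outside)
  qed
  also have "\<dots> < 0" using cN_pos kmin_pos mass_pos by (simp add: mass_def[symmetric])
  finally have "lam * rpow (u x) (p - 1) < 0" .
  moreover have "0 \<le> lam * rpow (u x) (p - 1)" using lam_nonneg by (simp add: rpow_def)
  ultimately show False by simp
qed

text \<open>The error 8 lam (1 + M) of the right-hand sides in \<open>rhs_ge\<close>, divided by the
  gain cN kmin mass of the touching argument: Ca (1 - k) is the relative error in the comparison
  with a copy contracted by k.\<close>

definition "Ca = 8 * lam * (1 + M) / (cN * kmin * mass)"

lemma Ca_nonneg: "Ca \<ge> 0"
  unfolding Ca_def using lam_nonneg M_nonneg cN_pos kmin_pos mass_pos by simp

text \<open>The copy solves the equation with the extra factor k^(-2s) <= 1 + 8(1 - k). Sublinearity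
  absorbs the 1, and the rest is estimated by \<open>rpow (u x) (p - 1) \<le> 1 + M\<close>.\<close>

lemma rhs_ge:
  assumes k: "1 / 2 \<le> k" "k \<le> 1" and t: "1 \<le> t" and v: "0 \<le> v" "v \<le> t * u x"
  shows "- (8 * lam * (1 + M) * (1 - k) * t) \<le> t * (lam * rpow (u x) (p - 1)) - k powr (- 2 * s) * (lam * rpow v (p - 1))"
proof -
  have q: "0 \<le> p - 1" "p - 1 \<le> 1" using p by auto
  have "rpow v (p - 1) \<le> rpow (t * u x) (p - 1)" using v q by (intro rpow_mono) auto
  also have "\<dots> \<le> t * rpow (u x) (p - 1)" using u_nonneg q t by (intro rpow_mult_le)
  finally have r: "rpow v (p - 1) \<le> t * rpow (u x) (p - 1)" .
  have "k powr (- 2 * s) * (lam * rpow v (p - 1)) \<le> (1 + 8 * (1 - k)) * (lam * (t * rpow (u x) (p - 1)))"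
    using k t r lam_nonneg powr_minus_two_le[OF k s] rpow_le[OF v(1) q]
    by (intro mult_mono) (auto intro!: mult_nonneg_nonneg)
  moreover have "8 * (1 - k) * (lam * t * rpow (u x) (p - 1)) \<le> 8 * (1 - k) * (lam * t * (1 + M))"
    using k t lam_nonneg rpow_le[OF u_nonneg q, of x] u_le[of x]
    by (intro mult_left_mono) (auto intro: order_trans)
  ultimately show ?thesis by (simp add: algebra_simps)
qed

lemma ratio_bound:
  assumes k: "k \<le> 1" "Ca * (1 - k) \<le> 1 / 2"
    and "cN * (kmin * (t - 1 - c) * mass) \<le> 8 * lam * (1 + M) * (1 - k) * t"
  shows "t - 1 - c \<le> Ca * (1 - k) * t"
proof -
  have pos: "cN * kmin * mass > 0" using cN_pos kmin_pos mass_pos by simp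
  have "(t - 1 - c) * (cN * kmin * mass) \<le> 8 * lam * (1 + M) * (1 - k) * t"
    using assms(3) by (simp add: mult_ac)
  then have "t - 1 - c \<le> 8 * lam * (1 + M) * (1 - k) * t / (cN * kmin * mass)"
    using pos by (simp add: pos_le_divide_eq)
  then show ?thesis by (simp add: Ca_def)
qed

text \<open>Contraction without reflection. The copy vanishes outside a compact subset of \<Omega>,
  so the maximal ratio t is attained without any knowledge of u near the boundary; at the maximum t
  u minus the copy touches zero from above.\<close>

lemma dil_le:
  assumes b: "b \<in> \<Omega>" and k: "1 / 2 \<le> k" "k < 1" "Ca * (1 - k) \<le> 1 / 2"
  shows "u (dil b k x) \<le> (1 + 2 * (Ca * (1 - k))) * u x"
proof -
  define a where "a = Ca * (1 - k)"
  have a: "0 \<le> a" "a \<le> 1 / 2" using Ca_nonneg k by (auto simp: a_def)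
  define Kc where "Kc = dil b (inverse k) ` closure \<Omega>"
  have Kc: "compact Kc" unfolding Kc_def by (intro compact_continuous_image continuous_on_dil compact_closure_\<Omega>)
  have Kc\<Omega>: "Kc \<subseteq> \<Omega>"
  proof
    fix y assume "y \<in> Kc"
    then obtain x where x: "x \<in> closure \<Omega>" "y = b + k *\<^sub>R (x - b)" by (auto simp: Kc_def dil_inverse_eq)
    then have "y = x - (1 - k) *\<^sub>R (x - b)" by (simp add: algebra_simps)
    moreover have "x - (1 - k) *\<^sub>R (x - b) \<in> interior \<Omega>"
      using k x b \<Omega>_open interior_open by (intro mem_interior_closure_convex_shrink[OF \<Omega>_convex]) auto
    ultimately show "y \<in> \<Omega>" using interior_subset by blast
  qed
  have mem: "y \<in> Kc" if "u (dil b k y) \<noteq> 0" for y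
  proof -
    have "dil b k y \<in> closure \<Omega>" using u_pos_imp[OF that] closure_subset by blast
    then have "dil b (inverse k) (dil b k y) \<in> Kc" unfolding Kc_def by blast
    then show ?thesis using k by (simp add: dil_inverse)
  qed
  define rho where "rho y = u (dil b k y) / u y" for y
  have "continuous_on Kc rho" unfolding rho_def
  proof (intro continuous_on_divide)
    show "continuous_on Kc (\<lambda>y. u (dil b k y))"
      by (rule continuous_on_compose2[OF u_cont continuous_on_dil]) auto
    show "continuous_on Kc u" using u_cont continuous_on_subset by blast
    show "\<forall>y\<in>Kc. u y \<noteq> 0" using Kc\<Omega> u_pos by fastforce
  qed
  moreover have "Kc \<noteq> {}" using \<Omega>_nonempty by (auto simp: Kc_def)
  ultimately obtain x0 where x0: "x0 \<in> Kc" "\<And>y. y \<in> Kc \<Longrightarrow> rho y \<le> rho x0"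
    using continuous_attains_sup[OF Kc] by blast
  define t where "t = rho x0"
  have ux0: "u x0 > 0" using x0 Kc\<Omega> u_pos by blast
  have le: "u (dil b k y) \<le> t * u y" if "t \<ge> 0" for y
  proof (cases "y \<in> Kc")
    case True
    then have "u y > 0" using Kc\<Omega> u_pos by blast
    moreover have "rho y \<le> t" using x0(2)[OF True] by (simp add: t_def)
    ultimately show ?thesis by (simp add: rho_def field_simps)
  next
    case False
    then show ?thesis using mem[of y] that u_nonneg[of y] by force
  qed
  have t0: "t \<ge> 0" unfolding t_def rho_def using u_nonneg by simp
  have "t \<le> 1 + 2 * a"
  proof (rule ccontr)
    assume "\<not> t \<le> 1 + 2 * a"
    then have t: "t > 1 + 2 * a" "t \<ge> 1" using a by auto
    have eq: "u (dil b k x0) = t * u x0" using ux0 by (simp add: t_def rho_def)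
    then have "dil b k x0 \<in> \<Omega>" using ux0 t by (intro u_pos_imp) auto
    then have L: "frac_lap_pv s (\<lambda>y. t * u y + (- 1) * u (dil b k y)) x0
      (t * (lam * rpow (u x0) (p - 1)) + (- 1) * (k powr (- 2 * s) * (lam * rpow (u (dil b k x0)) (p - 1))))"
      using k x0 Kc\<Omega> by (intro frac_lap_pv_lin frac_lap_pv_dil pde u_measurable) auto
    have "t * (lam * rpow (u x0) (p - 1)) + (- 1) * (k powr (- 2 * s) * (lam * rpow (u (dil b k x0)) (p - 1)))
      \<le> - cN * (\<integral>y. kmin * (t * u y - u (dil b k y)) \<partial>lborel)"
    proof (rule touch_le[OF L])
      show "t * u x0 + - 1 * u (dil b k x0) = 0" using eq by simp
      show "integrable lborel (\<lambda>y. kmin * (t * u y - u (dil b k y)))"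
        using u_integrable k by (intro integrable_mult_right Bochner_Integration.integrable_diff) (auto simp: integral_dil)
      show "kmin * (t * u y - u (dil b k y)) \<le> kmin * (t * M)" for y
      proof -
        have "t * u y \<le> t * M" using u_le[of y] t0 by (rule mult_left_mono)
        then show ?thesis using u_nonneg[of "dil b k y"] kmin_pos by simp
      qed
      show "kmin * (t * u y - u (dil b k y)) \<le> (t * u y + - 1 * u (dil b k y)) * frac_kernel s x0 y" if "y \<noteq> x0" for y
      proof (cases "y \<in> \<Omega>")
        case True
        then have "kmin \<le> frac_kernel s x0 y"
          using that norm_diff_\<Omega>[OF _ True, of x0] x0 Kc\<Omega> D_pos by (intro kernel_ge_kmin) auto
        moreover have "0 \<le> t * u y - u (dil b k y)" using le[OF t0, of y] by simp
        ultimately have "kmin * (t * u y - u (dil b k y)) \<le> frac_kernel s x0 y * (t * u y - u (dil b k y))"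
          by (rule mult_right_mono)
        then show ?thesis by (simp add: mult.commute)
      next
        case False
        then have "u (dil b k y) = 0" using mem[of y] Kc\<Omega> by blast
        then show ?thesis using False u_outside by simp
      qed
    qed
    also have "(\<integral>y. kmin * (t * u y - u (dil b k y)) \<partial>lborel) = kmin * (t * mass - k ^ DIM('a) * mass)"
      using u_integrable k by (simp add: integral_dil mass_def)
    finally have "cN * (kmin * (t * mass - k ^ DIM('a) * mass)) \<le> 8 * lam * (1 + M) * (1 - k) * t"
      using rhs_ge[of k t "u (dil b k x0)" x0] k t u_nonneg eq by simp
    \<comment> \<open>The copy has the integral k^N mass, which is at most mass, so the gain is
      proportional to t - 1.\<close>
    moreover have "cN * (kmin * (t - 1 - 0) * mass) \<le> cN * (kmin * (t * mass - k ^ DIM('a) * mass))"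
    proof -
      have "k ^ DIM('a) * mass \<le> 1 * mass" using k mass_pos by (intro mult_right_mono power_le_one) auto
      then show ?thesis using cN_pos kmin_pos by (simp add: algebra_simps)
    qed
    ultimately have "t - 1 - 0 \<le> Ca * (1 - k) * t" using k by (intro ratio_bound) auto
    \<comment> \<open>For a <= 1/2 one has (1 + 2a)(1 - a) = 1 + a(1 - 2a) >= 1, which excludes t >
      1 + 2a.\<close>
    then have 1: "t * (1 - a) \<le> 1" by (simp add: a_def algebra_simps)
    have "(1 + 2 * a) * (1 - a) < t * (1 - a)" using t a by (intro mult_strict_right_mono) auto
    moreover have "(1 + 2 * a) * (1 - a) = 1 + a * (1 - 2 * a)" by (simp add: algebra_simps)
    moreover have "a * (1 - 2 * a) \<ge> 0" using a by (intro mult_nonneg_nonneg) auto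
    ultimately show False using 1 by linarith
  qed
  then have "t * u x \<le> (1 + 2 * a) * u x" using u_nonneg by (intro mult_right_mono)
  then show ?thesis using le[OF t0, of x] by (simp add: a_def)
qed

text \<open>The squared distance is at most 4 D^2 + 16 D^2, below (5 D)^2; this is the origin of the
  5 in \<open>kmin\<close>.\<close>

lemma norm_diff_hrefl_\<Omega>:
  assumes e: "norm e = 1" and b: "b \<in> \<Omega>" "b \<bullet> e = \<mu>" and x: "x \<in> \<Omega>" "x \<bullet> e \<le> \<mu>" and y: "y \<in> \<Omega>" "y \<bullet> e \<le> \<mu>"
  shows "norm (x - hrefl e \<mu> y) \<le> 5 * D"
proof (rule power2_le_imp_le)
  have small: "\<mu> - w \<bullet> e \<le> 2 * D" if "w \<in> \<Omega>" for w
  proof -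
    have "\<mu> - w \<bullet> e = (b - w) \<bullet> e" using b by (simp add: inner_diff_left)
    also have "\<dots> \<le> norm (b - w) * norm e" by (rule norm_cauchy_schwarz)
    finally show ?thesis using e norm_diff_\<Omega>[OF b(1) that] by simp
  qed
  have "(norm (x - hrefl e \<mu> y))\<^sup>2 = (norm (x - y))\<^sup>2 + 4 * (\<mu> - x \<bullet> e) * (\<mu> - y \<bullet> e)" by (rule norm_diff_hrefl[OF e])
  also have "\<dots> \<le> (2 * D)\<^sup>2 + 4 * (2 * D) * (2 * D)"
    using norm_diff_\<Omega>[OF x(1) y(1)] small[OF x(1)] small[OF y(1)] x y D_pos
    by (intro add_mono power_mono mult_mono) auto
  also have "\<dots> \<le> (5 * D)\<^sup>2" by (simp add: power2_eq_square)
  finally show "(norm (x - hrefl e \<mu> y))\<^sup>2 \<le> (5 * D)\<^sup>2" .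
qed (use D_pos in simp)

text \<open>The maximal ratio argument in the half space, for a copy that fits strictly into
  \<Omega>. Contraction destroys antisymmetry, but \<open>dil_le\<close> applied at y and at its
  mirror image shows that t u - v sums over the pair to at least t - 1 - 2a times the sum of u. For
  t > 1 + 2a this sum provides the gain.\<close>

lemma hrefl_dil_le_interior:
  assumes e: "norm e = 1" and b: "b \<in> \<Omega>" "b \<bullet> e = \<mu>" and k: "1 / 2 \<le> k" "k < 1" "Ca * (1 - k) \<le> 1 / 2"
    and inside: "\<And>x. x \<in> closure \<Omega> \<Longrightarrow> \<mu> \<le> x \<bullet> e \<Longrightarrow> b + k *\<^sub>R (hrefl e \<mu> x - b) \<in> \<Omega>"
    and z: "z \<bullet> e \<le> \<mu>"
  shows "u (dil b k (hrefl e \<mu> z)) \<le> (1 + 6 * (Ca * (1 - k))) * u z"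
proof -
  let ?R = "hrefl e \<mu>"
  define v where "v y = u (dil b k (?R y))" for y
  define a where "a = Ca * (1 - k)"
  have a: "0 \<le> a" "a \<le> 1 / 2" using Ca_nonneg k by (auto simp: a_def)
  \<comment> \<open>S inverts the map taking y to \<open>dil b k (?R y)\<close>, so
    \<open>Kc\<close> contains every point of the half space where v is nonzero.\<close>
  define S where "S x = b + k *\<^sub>R (?R x - b)" for x
  have S: "S x = ?R (dil b (inverse k) x)" for x
    by (subst hrefl_dil[OF b(2)]) (simp add: S_def dil_inverse_eq)
  have S1: "S (dil b k (?R y)) = y" for y using k e by (simp add: S dil_inverse)
  define Kc where "Kc = S ` (closure \<Omega> \<inter> {x. \<mu> \<le> x \<bullet> e})"
  have "closed {x. \<mu> \<le> x \<bullet> e}" using closed_halfspace_ge[of \<mu> e] by (simp add: inner_commute)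
  then have Kc: "compact Kc" unfolding Kc_def S_def
    by (intro compact_continuous_image compact_Int_closed compact_closure_\<Omega> continuous_intros)
  have Kc\<Omega>: "Kc \<subseteq> \<Omega>" using inside by (auto simp: Kc_def S_def)
  have dil_in: "dil b k (?R y) \<bullet> e = \<mu> + (\<mu> - y \<bullet> e) / k" for y
    using dil_inner[OF b(2), of k "?R y"] by (simp add: hrefl_inner[OF e])
  have mem: "y \<in> Kc" if "v y \<noteq> 0" "y \<bullet> e \<le> \<mu>" for y
  proof -
    have "dil b k (?R y) \<in> closure \<Omega>" using u_pos_imp that closure_subset unfolding v_def by blast
    moreover have "\<mu> \<le> dil b k (?R y) \<bullet> e" using that k by (simp add: dil_in)
    ultimately have "S (dil b k (?R y)) \<in> Kc" unfolding Kc_def by blast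
    then show ?thesis by (simp add: S1)
  qed
  show ?thesis
  proof (cases "Kc = {}")
    case True
    then have "v z = 0" using mem[OF _ z] by blast
    then show ?thesis using u_nonneg[of z] a by (simp add: v_def flip: a_def)
  next
    case False
    define rho where "rho y = v y / u y" for y
    have v_cont: "continuous_on A v" for A unfolding v_def
      by (rule continuous_on_compose2[OF u_cont]) (auto intro!: continuous_on_compose2[OF continuous_on_dil continuous_on_hrefl])
    have v_meas[measurable]: "v \<in> borel_measurable borel" unfolding v_def by measurable
    have "continuous_on Kc rho" unfolding rho_def
    proof (intro continuous_on_divide v_cont)
      show "continuous_on Kc u" using u_cont continuous_on_subset by blast
      show "\<forall>y\<in>Kc. u y \<noteq> 0" using Kc\<Omega> u_pos by fastforce
    qed
    then obtain x0 where x0: "x0 \<in> Kc" "\<And>y. y \<in> Kc \<Longrightarrow> rho y \<le> rho x0"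
      using continuous_attains_sup[OF Kc False] by blast
    define t where "t = rho x0"
    have ux0: "u x0 > 0" using x0 Kc\<Omega> u_pos by blast
    have t0: "t \<ge> 0" unfolding t_def rho_def v_def using u_nonneg by simp
    have le: "v y \<le> t * u y" if "y \<bullet> e \<le> \<mu>" for y
    proof (cases "y \<in> Kc")
      case True
      then have "u y > 0" using Kc\<Omega> u_pos by blast
      moreover have "rho y \<le> t" using x0(2)[OF True] by (simp add: t_def)
      ultimately show ?thesis by (simp add: rho_def field_simps)
    next
      case False
      then have "v y = 0" using mem that by blast
      then show ?thesis using t0 u_nonneg[of y] by simp
    qed
    have "t \<le> 1 + 6 * a"
    proof (rule ccontr)
      assume "\<not> t \<le> 1 + 6 * a"
      then have t: "t > 1 + 6 * a" "t \<ge> 1" using a by auto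
      define c where "c = t - 1 - 2 * a"
      have c: "c \<ge> 0" using t a by (simp add: c_def)
      have eq: "v x0 = t * u x0" using ux0 by (simp add: t_def rho_def)
      then have in\<Omega>: "dil b k (?R x0) \<in> \<Omega>" using ux0 t by (intro u_pos_imp) (auto simp: v_def)
      have x0\<Omega>: "x0 \<in> \<Omega>" using x0 Kc\<Omega> by blast
      have x0e: "x0 \<bullet> e \<le> \<mu>"
      proof -
        obtain x where x: "\<mu> \<le> x \<bullet> e" "x0 = S x" using x0 by (auto simp: Kc_def)
        have "S x \<bullet> e = 2 * \<mu> - (\<mu> + (x \<bullet> e - \<mu>) * k)"
          by (simp add: S hrefl_inner[OF e] dil_inner[OF b(2)] divide_inverse)
        moreover have "0 \<le> (x \<bullet> e - \<mu>) * k" using x k by (intro mult_nonneg_nonneg) auto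
        ultimately show ?thesis unfolding x(2) by linarith
      qed
      \<comment> \<open>On the plane the reflection is the identity and v is merely the contracted
        u, so \<open>dil_le\<close> bounds the ratio there by 1 + 2a. The maximum is therefore
        strictly inside the half space, as \<open>antisym_le\<close> demands.\<close>
      have x0lt: "x0 \<bullet> e < \<mu>"
      proof (rule ccontr)
        assume "\<not> ?thesis"
        then have "?R x0 = x0" using x0e by (intro hrefl_fixed) simp
        then have "v x0 \<le> (1 + 2 * a) * u x0" using dil_le[OF b(1) k, of x0] by (simp add: v_def a_def)
        then have "t * u x0 \<le> (1 + 2 * a) * u x0" by (simp add: eq)
        then have "t \<le> 1 + 2 * a" using ux0 by simp
        then show False using t a by linarith
      qed
      have L: "frac_lap_pv s (\<lambda>y. t * u y + (- 1) * v y) x0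
        (t * (lam * rpow (u x0) (p - 1)) + (- 1) * (k powr (- 2 * s) * (lam * rpow (v x0) (p - 1))))"
      proof (intro frac_lap_pv_lin pde[OF x0\<Omega>])
        have "frac_lap_pv s (\<lambda>y. u (dil b k y)) (?R x0) (k powr (- 2 * s) * (lam * rpow (v x0) (p - 1)))"
          unfolding v_def using k in\<Omega> by (intro frac_lap_pv_dil pde u_measurable) auto
        from frac_lap_pv_hrefl[OF _ e this]
        show "frac_lap_pv s v x0 (k powr (- 2 * s) * (lam * rpow (v x0) (p - 1)))"
          unfolding v_def[abs_def] by measurable
      qed
      have vR: "v (?R y) = u (dil b k y)" for y by (simp add: v_def e)
      have sum: "c * (u y + u (?R y)) \<le> (t * u y + (- 1) * v y) + (t * u (?R y) + (- 1) * v (?R y))" for y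
      proof -
        have "v (?R y) \<le> (1 + 2 * a) * u y" using dil_le[OF b(1) k, of y] by (simp add: vR a_def)
        moreover have "v y \<le> (1 + 2 * a) * u (?R y)" using dil_le[OF b(1) k, of "?R y"] by (simp add: v_def a_def)
        ultimately show ?thesis by (simp add: c_def algebra_simps)
      qed
      have "t * (lam * rpow (u x0) (p - 1)) + (- 1) * (k powr (- 2 * s) * (lam * rpow (v x0) (p - 1)))
        \<le> - cN * (\<integral>y. kmin * c * u y \<partial>lborel)"
      proof (rule antisym_le[OF e x0lt L])
        show "(\<lambda>y. t * u y + (- 1) * v y) \<in> borel_measurable borel" by measurable
        show "\<bar>t * u y + (- 1) * v y\<bar> \<le> t * M + M" for y
        proof -
          have "0 \<le> t * u y" "t * u y \<le> t * M" using u_le[of y] u_nonneg[of y] t0 by (auto intro: mult_left_mono)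
          moreover have "0 \<le> v y" "v y \<le> M" unfolding v_def using u_le u_nonneg by auto
          ultimately show ?thesis by linarith
        qed
        show "t * u x0 + (- 1) * v x0 \<le> 0" using eq by simp
        show "integrable lborel (\<lambda>y. kmin * c * u y)" using u_integrable by simp
        show "0 \<le> kmin * c * u y" for y using kmin_pos c u_nonneg[of y] by simp
        show "kmin * c * u y \<le> kmin * c * M" for y using kmin_pos c u_le[of y] by (simp add: mult_left_mono)
        show "kmin * c * u y + kmin * c * u (?R y)
          \<le> (t * u y + (- 1) * v y - (t * u x0 + (- 1) * v x0)) * (frac_kernel s x0 y - frac_kernel s x0 (?R y))
            + (t * u y + (- 1) * v y + (t * u (?R y) + (- 1) * v (?R y))) * frac_kernel s x0 (?R y)"
          if y: "y \<bullet> e \<le> \<mu>" "y \<noteq> x0" for y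
        proof -
          let ?K = "frac_kernel s x0 y" and ?K' = "frac_kernel s x0 (?R y)"
          have "0 \<le> (t * u y + (- 1) * v y - (t * u x0 + (- 1) * v x0)) * (?K - ?K')"
            using le[OF y(1)] eq frac_kernel_hrefl_le[OF e x0e y(1) _ s(1)] y by (intro mult_nonneg_nonneg) auto
          moreover have "kmin * (c * (u y + u (?R y))) \<le> (c * (u y + u (?R y))) * ?K'"
          proof (cases "u y + u (?R y) = 0")
            case False
            have "x0 \<noteq> ?R y" using x0lt y hrefl_inner[OF e, of \<mu> y] by auto
            moreover have "norm (x0 - ?R y) \<le> 5 * D"
            proof (cases "y \<in> \<Omega>")
              case True
              then show ?thesis using x0e y by (intro norm_diff_hrefl_\<Omega>[OF e b x0\<Omega>]) auto
            next
              case F: False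
              then have "?R y \<in> \<Omega>" using False u_outside by (metis add_0)
              then show ?thesis using norm_diff_\<Omega>[OF x0\<Omega>, of "?R y"] D_pos by simp
            qed
            ultimately have "kmin \<le> ?K'" by (rule kernel_ge_kmin)
            moreover have "0 \<le> c * (u y + u (?R y))" using c u_nonneg by simp
            ultimately show ?thesis unfolding mult.commute[of kmin] by (rule mult_left_mono)
          qed simp
          moreover have "(c * (u y + u (?R y))) * ?K' \<le> (t * u y + (- 1) * v y + (t * u (?R y) + (- 1) * v (?R y))) * ?K'"
            using sum[of y] by (intro mult_right_mono frac_kernel_nonneg)
          moreover have "kmin * c * u y + kmin * c * u (?R y) = kmin * (c * (u y + u (?R y)))" by (simp add: algebra_simps)
          ultimately show ?thesis by linarith
        qed
      qed
      also have "(\<integral>y. kmin * c * u y \<partial>lborel) = kmin * c * mass" by (simp add: mass_def)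
      finally have "cN * (kmin * c * mass) \<le> 8 * lam * (1 + M) * (1 - k) * t"
        using rhs_ge[of k t "v x0" x0] k t u_nonneg eq by (simp add: v_def)
      then have "t - 1 - 2 * a \<le> Ca * (1 - k) * t" using k unfolding c_def by (intro ratio_bound) auto
      \<comment> \<open>As in \<open>dil_le\<close>, with the surplus 3a(1 - 2a) in (1 + 6a)(1 - a)
        = 1 + 2a + 3a(1 - 2a); hence the constant 6.\<close>
      then have 1: "t * (1 - a) \<le> 1 + 2 * a" by (simp add: a_def algebra_simps)
      have "(1 + 6 * a) * (1 - a) < t * (1 - a)" using t a by (intro mult_strict_right_mono) auto
      moreover have "(1 + 6 * a) * (1 - a) = 1 + 2 * a + 3 * (a * (1 - 2 * a))" by (simp add: algebra_simps)
      moreover have "a * (1 - 2 * a) \<ge> 0" using a by (intro mult_nonneg_nonneg) auto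
      ultimately show False using 1 by linarith
    qed
    then have "t * u z \<le> (1 + 6 * a) * u z" using u_nonneg by (intro mult_right_mono)
    then show ?thesis using le[OF z] by (simp add: a_def v_def)
  qed
qed

end

section \<open>A Hopf lemma for the perturbed reflection\<close>

context sublinear_solution
begin

lemma closure_shrink:
  assumes "b \<in> \<Omega>" "w \<in> closure \<Omega>" "0 \<le> c" "c < 1"
  shows "b + c *\<^sub>R (w - b) \<in> \<Omega>"
proof -
  have "w - (1 - c) *\<^sub>R (w - b) \<in> interior \<Omega>"
    using assms \<Omega>_open interior_open by (intro mem_interior_closure_convex_shrink[OF \<Omega>_convex]) auto
  moreover have "w - (1 - c) *\<^sub>R (w - b) = b + c *\<^sub>R (w - b)" by (simp add: algebra_simps)
  ultimately show ?thesis using interior_subset by fastforce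
qed

text \<open>A smaller factor k' contracts by a further k'/k towards b, which by convexity moves the
  image from the closure into \<Omega>. The interior case applies to k', and continuity of u allows
  k' to increase to k.\<close>

lemma hrefl_dil_le:
  assumes e: "norm e = 1" and b: "b \<in> \<Omega>" "b \<bullet> e = \<mu>" and k: "1 / 2 < k" "k < 1" "Ca * (1 - k) < 1 / 2"
    and inside: "\<And>x. x \<in> closure \<Omega> \<Longrightarrow> \<mu> \<le> x \<bullet> e \<Longrightarrow> b + k *\<^sub>R (hrefl e \<mu> x - b) \<in> closure \<Omega>"
    and z: "z \<bullet> e \<le> \<mu>"
  shows "u (dil b k (hrefl e \<mu> z)) \<le> (1 + 6 * (Ca * (1 - k))) * u z"
proof -
  have "((\<lambda>k'. Ca * (1 - k')) \<longlongrightarrow> Ca * (1 - k)) (at_left k)" by (intro tendsto_intros)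
  then have ev1: "eventually (\<lambda>k'. Ca * (1 - k') < 1 / 2) (at_left k)" using k(3) by (rule order_tendstoD)
  have ev2: "eventually (\<lambda>k'. k' \<in> {1/2<..<k}) (at_left k)" using k(1) by (rule eventually_at_left_real)
  have ev: "eventually (\<lambda>k'. u (dil b k' (hrefl e \<mu> z)) \<le> (1 + 6 * (Ca * (1 - k'))) * u z) (at_left k)"
    using ev1 ev2
  proof eventually_elim
    case (elim k')
    show ?case
    proof (rule hrefl_dil_le_interior[OF e b _ _ _ _ z])
      fix x assume "x \<in> closure \<Omega>" "\<mu> \<le> x \<bullet> e"
      from inside[OF this] have "b + (k' / k) *\<^sub>R ((b + k *\<^sub>R (hrefl e \<mu> x - b)) - b) \<in> \<Omega>"
        using elim k b by (intro closure_shrink) auto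
      then show "b + k' *\<^sub>R (hrefl e \<mu> x - b) \<in> \<Omega>" using k by simp
    qed (use elim k in auto)
  qed
  have "((\<lambda>k'. dil b k' (hrefl e \<mu> z)) \<longlongrightarrow> dil b k (hrefl e \<mu> z)) (at_left k)"
    unfolding dil_def using k by (intro tendsto_intros) auto
  moreover have "isCont u (dil b k (hrefl e \<mu> z))" using u_cont by (simp add: continuous_on_eq_continuous_at)
  ultimately have "((\<lambda>k'. u (dil b k' (hrefl e \<mu> z))) \<longlongrightarrow> u (dil b k (hrefl e \<mu> z))) (at_left k)"
    by (rule isCont_tendsto_compose[rotated])
  moreover have "((\<lambda>k'. (1 + 6 * (Ca * (1 - k'))) * u z) \<longlongrightarrow> (1 + 6 * (Ca * (1 - k))) * u z) (at_left k)"
    by (intro tendsto_intros)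
  ultimately show ?thesis using ev by (intro tendsto_le[OF trivial_limit_at_left_real])
qed

text \<open>If the bound fails, W minus A times the antisymmetrised barrier has a negative minimum
  over the half space, attained inside the ball. The kernel gap towards Q pushes the operator down
  at that point by a multiple of h dQ |Q|; the barrier costs A times a scale-free constant and the
  equation an error of order 1 - k. The inequality assumed for A says that the gain wins.\<close>

lemma hopf_lower:
  fixes Q :: "'a set" and A c1 dQ h \<rho> \<alpha> :: real
  assumes e: "norm e = 1" and b: "b \<in> \<Omega>" "b \<bullet> e = \<mu>" and k: "1 / 2 \<le> k" "k < 1" "Ca * (1 - k) \<le> 1 / 2"
  defines "v \<equiv> \<lambda>z. u (dil b k (hrefl e \<mu> z))"
  defines "W \<equiv> \<lambda>z. (1 + 6 * (Ca * (1 - k))) * u z - v z"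
  assumes W: "\<And>z. z \<bullet> e \<le> \<mu> \<Longrightarrow> 0 \<le> W z"
    and Q: "Q \<in> sets borel" "Q \<subseteq> \<Omega>" "\<And>z. z \<in> Q \<Longrightarrow> z \<bullet> e \<le> \<mu> - dQ" "0 < dQ" "\<And>z. z \<in> Q \<Longrightarrow> c1 \<le> W z" "0 < c1"
    and ball: "0 < \<rho>" "\<rho> \<le> h" "ball q \<rho> \<subseteq> \<Omega>" "\<And>z. z \<in> ball q \<rho> \<Longrightarrow> dil b k (hrefl e \<mu> z) \<in> \<Omega>"
      "\<And>z. z \<in> cball q \<rho> \<Longrightarrow> z \<bullet> e \<le> \<mu> - h" "Q \<inter> ball q \<rho> = {}"
    and A: "0 \<le> A" "A * (annulus_mass TYPE('a) * (3 / s + 1 / (1 - s)) / (2 * ln 2) + unit_ball_vol (real DIM('a)))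
      + 32 * lam * (1 + M) * (1 - k) / cN
      < c1 * (4 * \<alpha> / ((5 * D)\<^sup>2) powr (\<alpha> + 1)) * h * dQ * measure lborel Q"
    and \<alpha>: "\<alpha> = (real DIM('a) + 2 * s) / 2"
    and z: "z \<in> ball q \<rho>"
  shows "A * ball_profile s q \<rho> z \<le> W z"
proof (rule ccontr)
  assume neg: "\<not> ?thesis"
  let ?R = "hrefl e \<mu>"
  define T where "T = 1 + 6 * (Ca * (1 - k))"
  have "0 \<le> Ca * (1 - k)" using k Ca_nonneg by simp
  then have T: "1 \<le> T" "T \<le> 4" using k(3) unfolding T_def by linarith+
  define \<phi> where "\<phi> = ball_profile s q \<rho>"
  define B where "B = annulus_mass TYPE('a) * (3 / s + 1 / (1 - s)) / (2 * ln 2)"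
  define V where "V = unit_ball_vol (real DIM('a))"
  \<comment> \<open>The barrier is made antisymmetric, so that it cancels in F y + F (?R y), which
    becomes W y + W (?R y); inside the half space its mirror image vanishes.\<close>
  define F where "F y = 1 * W y + (- A) * (1 * \<phi> y + (- 1) * \<phi> (?R y))" for y
  have h: "h > 0" using ball by simp
  have \<phi>0: "\<phi> y = 0" if "y \<notin> ball q \<rho>" for y
    unfolding \<phi>_def by (rule ball_profile_outside) (use that ball in \<open>auto simp: dist_norm norm_minus_commute\<close>)
  have \<phi>nn: "0 \<le> \<phi> y" for y by (simp add: \<phi>_def ball_profile_nonneg)
  have \<phi>le: "\<phi> y \<le> \<rho> powr (2 * s)" for y unfolding \<phi>_def using s ball by (intro ball_profile_le) auto
  have ballH: "y \<bullet> e < \<mu>" if "y \<in> cball q \<rho>" for y using ball(5)[OF that] h by simp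
  have \<phi>R0: "\<phi> (?R y) = 0" if "y \<bullet> e \<le> \<mu>" for y
  proof (rule \<phi>0, rule notI)
    assume "?R y \<in> ball q \<rho>"
    then have "?R y \<bullet> e < \<mu>" by (intro ballH) auto
    then show False using that by (simp add: hrefl_inner[OF e])
  qed
  have v_cont: "continuous_on UNIV v" unfolding v_def
    by (rule continuous_on_compose2[OF u_cont]) (auto intro!: continuous_on_compose2[OF continuous_on_dil continuous_on_hrefl])
  have W_cont: "continuous_on UNIV W" unfolding W_def by (intro continuous_intros u_cont v_cont)
  have \<phi>_cont: "continuous_on X \<phi>" for X unfolding \<phi>_def using s by (intro continuous_on_ball_profile)
  have [measurable]: "u \<in> borel_measurable borel" "v \<in> borel_measurable borel" "W \<in> borel_measurable borel"
    using u_cont v_cont W_cont by (auto intro: borel_measurable_continuous_onI)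
  have [measurable]: "\<phi> \<in> borel_measurable borel" unfolding \<phi>_def by measurable
  have F_cont: "continuous_on UNIV F" unfolding F_def
    by (intro continuous_intros W_cont \<phi>_cont continuous_on_compose2[OF \<phi>_cont continuous_on_hrefl]) auto
  have F_meas: "F \<in> borel_measurable borel" using F_cont by (rule borel_measurable_continuous_onI)
  have FW: "F y = W y" if "y \<bullet> e \<le> \<mu>" "y \<notin> ball q \<rho>" for y
    using that \<phi>0 \<phi>R0 by (simp add: F_def)
  obtain x0 where x0: "x0 \<in> cball q \<rho>" "\<And>y. y \<in> cball q \<rho> \<Longrightarrow> F x0 \<le> F y"
    using continuous_attains_inf[OF compact_cball, of q \<rho> F] continuous_on_subset[OF F_cont] ball(1)
    by (metis cball_eq_empty less_le_not_le not_le subset_UNIV)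
  have "F z < 0" using neg \<phi>R0[of z] ballH[of z] z by (simp add: F_def \<phi>_def)
  then have Fx0: "F x0 < 0" using x0(2)[of z] z by simp
  have x0b: "x0 \<in> ball q \<rho>"
    using Fx0 FW[of x0] W[of x0] ballH[OF x0(1)] by force
  have x0e: "x0 \<bullet> e < \<mu>" "h \<le> \<mu> - x0 \<bullet> e" using ballH[OF x0(1)] ball(5)[OF x0(1)] by auto
  have x0\<Omega>: "x0 \<in> \<Omega>" using x0b ball by blast
  have vR: "v (?R y) = u (dil b k y)" for y by (simp add: v_def e)
  \<comment> \<open>The sum is nonnegative because T = 1 + 6a is at least the factor 1 + 2a of
    \<open>dil_le\<close>.\<close>
  have WS: "0 \<le> W y + W (?R y)" for y
  proof -
    have a: "0 \<le> Ca * (1 - k)" using Ca_nonneg k by simp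
    have mono: "(1 + 2 * (Ca * (1 - k))) * u w \<le> T * u w" for w
    proof (rule mult_right_mono[OF _ u_nonneg])
      show "1 + 2 * (Ca * (1 - k)) \<le> T" using a unfolding T_def by linarith
    qed
    have "v (?R y) \<le> T * u y" using dil_le[OF b(1) k, of y] mono[of y] by (simp add: vR)
    moreover have "v y \<le> T * u (?R y)" using dil_le[OF b(1) k, of "?R y"] mono[of "?R y"] by (simp add: v_def)
    ultimately show ?thesis by (simp add: W_def T_def)
  qed
  have FS: "0 \<le> F y + F (?R y)" for y using WS[of y] by (simp add: F_def e algebra_simps)
  have FH: "F x0 \<le> F y" if "y \<bullet> e < \<mu>" for y
  proof (cases "y \<in> cball q \<rho>")
    case False
    then have "F y = W y" using that by (intro FW) auto
    then show ?thesis using W[of y] that Fx0 by simp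
  qed (rule x0(2))
  define \<kappa> where "\<kappa> = 4 * \<alpha> / ((5 * D)\<^sup>2) powr (\<alpha> + 1)"
  have \<kappa>: "\<kappa> \<ge> 0" using s by (simp add: \<kappa>_def \<alpha>)
  define c5 where "c5 = c1 * \<kappa> * h * dQ"
  have c5: "c5 \<ge> 0" using \<kappa> h Q by (simp add: c5_def)
  have Qfin: "emeasure lborel Q < \<infinity>"
  proof -
    have "bounded Q" using Q(2) \<Omega>_D by (intro bounded_subset[OF bounded_ball]) auto
    then show ?thesis by (rule emeasure_bounded_finite)
  qed
  \<comment> \<open>The gain is taken from Q only, where F y - F x0 >= c1 and the kernel gap is at
    least \<kappa> h dQ. Elsewhere nonnegativity suffices.\<close>
  define g where "g y = c5 * indicat_real Q y" for y
  have gi: "integrable lborel g" unfolding g_def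
    by (intro integrable_mult_right integrable_real_indicator) (use Q Qfin in auto)
  have gint: "(\<integral>y. g y \<partial>lborel) = c5 * measure lborel Q" by (simp add: g_def Q(1))
  define Mb where "Mb = T * M + M + A * \<rho> powr (2 * s)"
  have Fb: "\<bar>F y\<bar> \<le> Mb" for y
  proof -
    have "0 \<le> T * u y" "T * u y \<le> T * M" using u_le[of y] u_nonneg[of y] T by (auto intro: mult_left_mono)
    moreover have "0 \<le> v y" "v y \<le> M" unfolding v_def using u_le u_nonneg by auto
    moreover have "\<bar>A * (\<phi> y - \<phi> (?R y))\<bar> \<le> A * \<rho> powr (2 * s)"
    proof -
      have "\<bar>\<phi> y - \<phi> (?R y)\<bar> \<le> \<rho> powr (2 * s)"
        using \<phi>nn[of y] \<phi>nn[of "?R y"] \<phi>le[of y] \<phi>le[of "?R y"] by linarith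
      then show ?thesis using A(1) by (simp add: abs_mult mult_left_mono)
    qed
    moreover have "F y = T * u y - v y - A * (\<phi> y - \<phi> (?R y))" by (simp add: F_def W_def T_def)
    ultimately show ?thesis unfolding Mb_def by linarith
  qed
  have gF: "g y + g (?R y) \<le> (F y - F x0) * (frac_kernel s x0 y - frac_kernel s x0 (?R y)) + (F y + F (?R y)) * frac_kernel s x0 (?R y)"
    if y: "y \<bullet> e \<le> \<mu>" "y \<noteq> x0" for y
  proof -
    have RQ: "?R y \<notin> Q" using Q(3)[of "?R y"] Q(4) y by (auto simp: hrefl_inner[OF e])
    have 2: "0 \<le> (F y + F (?R y)) * frac_kernel s x0 (?R y)" by (intro mult_nonneg_nonneg FS frac_kernel_nonneg)
    have K: "frac_kernel s x0 (?R y) \<le> frac_kernel s x0 y"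
      using x0e y s e by (intro frac_kernel_hrefl_le) auto
    have F0: "F x0 \<le> F y"
    proof (cases "y \<bullet> e < \<mu>")
      case False
      then have "y \<bullet> e = \<mu>" using y by simp
      moreover have "y \<notin> ball q \<rho>" using False ballH[of y] by auto
      ultimately show ?thesis using FW[of y] W[of y] Fx0 by simp
    qed (rule FH)
    show ?thesis
    proof (cases "y \<in> Q")
      case True
      have yb: "y \<notin> ball q \<rho>" using True ball(6) by auto
      have "c1 \<le> F y - F x0" using FW[OF y(1) yb] Q(5)[OF True] Fx0 by linarith
      moreover have "\<kappa> * h * dQ \<le> frac_kernel s x0 y - frac_kernel s x0 (?R y)"
      proof -
        have ye: "y \<bullet> e < \<mu>" "dQ \<le> \<mu> - y \<bullet> e" using Q(3)[OF True] Q(4) by auto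
        have "\<kappa> * h * dQ \<le> \<kappa> * (\<mu> - x0 \<bullet> e) * (\<mu> - y \<bullet> e)"
          using \<kappa> x0e ye h Q(4) by (intro mult_mono) auto
        also have "\<dots> \<le> frac_kernel s x0 y - frac_kernel s x0 (?R y)"
          unfolding \<kappa>_def \<alpha>
          by (rule frac_kernel_hrefl_gap[OF e x0e(1) ye(1) _ s(1)])
             (use y True Q(2) x0e ye x0\<Omega> in \<open>auto intro!: norm_diff_hrefl_\<Omega>[OF e b]\<close>)
        finally show ?thesis .
      qed
      ultimately have "c1 * (\<kappa> * h * dQ) \<le> (F y - F x0) * (frac_kernel s x0 y - frac_kernel s x0 (?R y))"
        using Q(4,6) \<kappa> h by (intro mult_mono) auto
      then show ?thesis using 2 RQ True by (simp add: g_def c5_def mult.assoc)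
    next
      case False
      have "0 \<le> (F y - F x0) * (frac_kernel s x0 y - frac_kernel s x0 (?R y))"
        using F0 K by (intro mult_nonneg_nonneg) auto
      then show ?thesis using 2 RQ False by (simp add: g_def)
    qed
  qed
  define LW where "LW = T * (lam * rpow (u x0) (p - 1)) + (- 1) * (k powr (- 2 * s) * (lam * rpow (v x0) (p - 1)))"
  have LW: "frac_lap_pv s W x0 LW"
  proof -
    have "frac_lap_pv s v x0 (k powr (- 2 * s) * (lam * rpow (v x0) (p - 1)))"
    proof -
      have "frac_lap_pv s (\<lambda>y. u (dil b k y)) (?R x0) (k powr (- 2 * s) * (lam * rpow (v x0) (p - 1)))"
        unfolding v_def using k ball(4)[OF x0b] by (intro frac_lap_pv_dil pde u_measurable) auto
      from frac_lap_pv_hrefl[OF _ e this] show ?thesis unfolding v_def by measurable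
    qed
    from frac_lap_pv_lin[OF pde[OF x0\<Omega>] this, of T "- 1"]
    show ?thesis by (simp add: W_def LW_def T_def)
  qed
  \<comment> \<open>The 32 is 8 times 4, from \<open>rhs_ge\<close> and T <= 4.\<close>
  have LW_ge: "- (32 * lam * (1 + M) * (1 - k)) \<le> LW"
  proof -
    have "v x0 \<le> T * u x0" using W[of x0] x0e by (simp add: W_def T_def)
    then have "- (8 * lam * (1 + M) * (1 - k) * T) \<le> LW"
      using rhs_ge[of k T "v x0" x0] k T u_nonneg by (simp add: LW_def v_def)
    moreover have "8 * lam * (1 + M) * (1 - k) * T \<le> 8 * lam * (1 + M) * (1 - k) * 4"
      using T lam_nonneg M_nonneg k by (intro mult_left_mono) auto
    moreover have "8 * lam * (1 + M) * (1 - k) * 4 = 32 * lam * (1 + M) * (1 - k)" by simp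
    ultimately show ?thesis by linarith
  qed
  define E where "E = 2 * c5 + Mb / (\<mu> - x0 \<bullet> e) powr (real DIM('a) + 2 * s)"
  have dx: "norm (x0 - q) < \<rho>" using x0b by (simp add: dist_norm norm_minus_commute)
  have "eventually (\<lambda>\<epsilon>. \<epsilon> \<in> {0<..<min (\<mu> - x0 \<bullet> e) (\<rho> - norm (x0 - q))}) (at_right 0)"
    using x0e dx by (intro eventually_at_right_real) simp
  \<comment> \<open>The two barrier terms are bounded for each small \<epsilon>, and the limit is
    taken in W alone, whose principal value is known from the equation.\<close>
  then have ev: "eventually (\<lambda>\<epsilon>. cN * frac_trunc s W x0 \<epsilon> \<le> cN * (A * (B + V) - c5 * measure lborel Q + E * measure lborel (ball x0 \<epsilon>))) (at_right 0)"
  proof eventually_elim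
    case (elim \<epsilon>)
    then have \<epsilon>: "0 < \<epsilon>" "\<epsilon> \<le> \<mu> - x0 \<bullet> e" "\<epsilon> \<le> \<rho> - norm (x0 - q)" by auto
    have iW: "set_integrable lborel (- ball x0 \<epsilon>) (\<lambda>y. (W x0 - W y) * frac_kernel s x0 y)"
      using LW \<epsilon> by (simp add: frac_lap_pv_trunc)
    have i1: "set_integrable lborel (- ball x0 \<epsilon>) (\<lambda>y. (\<phi> x0 - \<phi> y) * frac_kernel s x0 y)"
    proof (rule set_integrable_kernel[OF s(1) \<epsilon>(1)])
      show "\<bar>\<phi> x0 - \<phi> y\<bar> \<le> \<rho> powr (2 * s)" for y
        using \<phi>nn[of y] \<phi>nn[of x0] \<phi>le[of y] \<phi>le[of x0] by linarith
    qed measurable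
    have i2: "set_integrable lborel (- ball x0 \<epsilon>) (\<lambda>y. (\<phi> (?R x0) - \<phi> (?R y)) * frac_kernel s x0 y)"
    proof (rule set_integrable_kernel[OF s(1) \<epsilon>(1)])
      show "\<bar>\<phi> (?R x0) - \<phi> (?R y)\<bar> \<le> \<rho> powr (2 * s)" for y
        using \<phi>nn[of "?R y"] \<phi>nn[of "?R x0"] \<phi>le[of "?R y"] \<phi>le[of "?R x0"] by linarith
    qed measurable
    note i3 = frac_trunc_lin[OF i1 i2, of 1 "- 1"]
    note i4 = frac_trunc_lin[OF iW i3(1), of 1 "- A"]
    have "frac_trunc s F x0 \<epsilon> = frac_trunc s W x0 \<epsilon> - A * (frac_trunc s \<phi> x0 \<epsilon> - frac_trunc s (\<lambda>y. \<phi> (?R y)) x0 \<epsilon>)"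
      using i4(2) unfolding i3(2) F_def[abs_def] by simp
    moreover have "frac_trunc s \<phi> x0 \<epsilon> \<le> B"
      unfolding frac_trunc_def \<phi>_def B_def by (rule trunc_ball_profile_le[OF s \<epsilon>(1,3)])
    \<comment> \<open>The mirrored barrier is at most \<rho>^(2s), lives on a ball of volume V
      \<rho>^N and has distance at least h from x0. Since \<rho> <= h, its contribution is at most V
      at every scale.\<close>
    moreover have "- V \<le> frac_trunc s (\<lambda>y. \<phi> (?R y)) x0 \<epsilon>"
    proof -
      define C where "C = \<rho> powr (2 * s) / h powr (real DIM('a) + 2 * s)"
      have C: "C \<ge> 0" by (simp add: C_def)
      have im: "(\<lambda>y. indicat_real (ball q \<rho>) y) \<in> borel_measurable borel"
        by (rule borel_measurable_indicator) (rule borel_open[OF open_ball])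
      have ii: "integrable lborel (indicat_real (ball q \<rho>))"
        by (rule integrable_real_indicator) (use emeasure_lborel_ball_finite[of q \<rho>] in auto)
      have iR: "integrable lborel (\<lambda>y. indicat_real (ball q \<rho>) (?R y))"
        using integral_hrefl(1)[OF e im] ii by blast
      have "(\<integral>y. - C * indicat_real (ball q \<rho>) (?R y) \<partial>lborel) \<le> frac_trunc s (\<lambda>y. \<phi> (?R y)) x0 \<epsilon>"
        unfolding frac_trunc_def set_lebesgue_integral_def
      proof (rule integral_mono)
        show "integrable lborel (\<lambda>y. - C * indicat_real (ball q \<rho>) (?R y))" using iR by simp
        show "integrable lborel (\<lambda>y. indicat_real (- ball x0 \<epsilon>) y *\<^sub>R ((\<phi> (?R x0) - \<phi> (?R y)) * frac_kernel s x0 y))"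
          using i2 by (simp add: set_integrable_def)
        fix y
        have "\<phi> (?R x0) = 0" using x0e by (intro \<phi>R0) simp
        moreover have "\<phi> (?R y) * frac_kernel s x0 y \<le> C * indicat_real (ball q \<rho>) (?R y)"
        proof (cases "?R y \<in> ball q \<rho>")
          case True
          then have "?R y \<bullet> e \<le> \<mu> - h" by (intro ball(5)) auto
          then have "\<mu> + h \<le> y \<bullet> e" by (simp add: hrefl_inner[OF e])
          then have "h \<le> (y - x0) \<bullet> e" using x0e by (simp add: inner_diff_left)
          also have "\<dots> \<le> norm (y - x0) * norm e" by (rule norm_cauchy_schwarz)
          finally have "h \<le> norm (x0 - y)" using e by (simp add: norm_minus_commute)
          then have "frac_kernel s x0 y \<le> 1 / h powr (real DIM('a) + 2 * s)" using h s by (intro frac_kernel_le)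
          then have "\<phi> (?R y) * frac_kernel s x0 y \<le> \<rho> powr (2 * s) * (1 / h powr (real DIM('a) + 2 * s))"
            using \<phi>le \<phi>nn by (intro mult_mono frac_kernel_nonneg) auto
          then show ?thesis using True by (simp add: C_def)
        next
          case False
          then show ?thesis using \<phi>0[OF False] by simp
        qed
        ultimately show "- C * indicat_real (ball q \<rho>) (?R y) \<le> indicat_real (- ball x0 \<epsilon>) y *\<^sub>R ((\<phi> (?R x0) - \<phi> (?R y)) * frac_kernel s x0 y)"
          using C by (cases "y \<in> ball x0 \<epsilon>") (auto simp: mult_nonneg_nonneg)
      qed
      moreover have "(\<integral>y. - C * indicat_real (ball q \<rho>) (?R y) \<partial>lborel) = - (C * (V * \<rho> ^ DIM('a)))"
        using ball(1) by (simp add: integral_hrefl(2)[OF e im] content_ball V_def)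
      moreover have "C * (V * \<rho> ^ DIM('a)) \<le> V"
      proof -
        have "\<rho> powr (2 * s) * \<rho> ^ DIM('a) = \<rho> powr (real DIM('a) + 2 * s)"
          using ball(1) by (simp add: powr_add powr_realpow)
        moreover have "\<rho> powr (real DIM('a) + 2 * s) \<le> h powr (real DIM('a) + 2 * s)"
          using ball s by (intro powr_mono2) auto
        ultimately have "C * \<rho> ^ DIM('a) \<le> 1" using h by (simp add: C_def field_simps)
        moreover have "V \<ge> 0" by (simp add: V_def)
        ultimately have "V * (C * \<rho> ^ DIM('a)) \<le> V * 1" by (intro mult_left_mono)
        then show ?thesis by (simp add: mult_ac)
      qed
      ultimately show ?thesis by linarith
    qed
    moreover have "frac_trunc s F x0 \<epsilon> \<le> - (\<integral>y. g y \<partial>lborel) + E * measure lborel (ball x0 \<epsilon>)"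
      unfolding E_def
    proof (rule frac_trunc_antisym_le[OF s(1) e _ F_meas Fb _ gi _ _ gF \<epsilon>(1,2)])
      show "set_integrable lborel (- ball x0 \<epsilon>) (\<lambda>y. (F x0 - F y) * frac_kernel s x0 y)"
        using i4(1) by (simp add: F_def)
    qed (use Fx0 c5 in \<open>auto simp: g_def indicator_def\<close>)
    ultimately have "frac_trunc s W x0 \<epsilon> \<le> A * (B + V) - c5 * measure lborel Q + E * measure lborel (ball x0 \<epsilon>)"
    proof -
      assume 1: "frac_trunc s F x0 \<epsilon> = frac_trunc s W x0 \<epsilon> - A * (frac_trunc s \<phi> x0 \<epsilon> - frac_trunc s (\<lambda>y. \<phi> (?R y)) x0 \<epsilon>)"
        and 2: "frac_trunc s \<phi> x0 \<epsilon> \<le> B" "- V \<le> frac_trunc s (\<lambda>y. \<phi> (?R y)) x0 \<epsilon>"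
        and 3: "frac_trunc s F x0 \<epsilon> \<le> - (\<integral>y. g y \<partial>lborel) + E * measure lborel (ball x0 \<epsilon>)"
      have "A * (frac_trunc s \<phi> x0 \<epsilon> - frac_trunc s (\<lambda>y. \<phi> (?R y)) x0 \<epsilon>) \<le> A * (B + V)"
        using 2 A(1) by (intro mult_left_mono) auto
      then show ?thesis using 1 3 gint by linarith
    qed
    then show ?case using cN_pos by (intro mult_left_mono) auto
  qed
  have "LW \<le> cN * (A * (B + V) - c5 * measure lborel Q + E * 0)"
  proof (rule tendsto_le[OF trivial_limit_at_right_real])
    show "((\<lambda>\<epsilon>. cN * (A * (B + V) - c5 * measure lborel Q + E * measure lborel (ball x0 \<epsilon>))) \<longlongrightarrow> cN * (A * (B + V) - c5 * measure lborel Q + E * 0)) (at_right 0)"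
      by (intro tendsto_intros tendsto_measure_ball)
    show "((\<lambda>\<epsilon>. cN * frac_trunc s W x0 \<epsilon>) \<longlongrightarrow> LW) (at_right 0)"
      using LW by (simp add: frac_lap_pv_trunc cN_def)
  qed (rule ev)
  then have "- (32 * lam * (1 + M) * (1 - k)) \<le> cN * (A * (B + V) - c5 * measure lborel Q)" using LW_ge by simp
  then have "- (A * (B + V) - c5 * measure lborel Q) * cN \<le> 32 * lam * (1 + M) * (1 - k)" by (simp add: algebra_simps)
  then have "- (A * (B + V) - c5 * measure lborel Q) \<le> 32 * lam * (1 + M) * (1 - k) / cN"
    by (simp only: pos_le_divide_eq[OF cN_pos])
  then show False using A(2) by (simp add: B_def V_def c5_def \<kappa>_def)
qed

end

section \<open>Convex sets with interior tangent balls\<close>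

lemma hrefl_affine: "hrefl e \<mu> (x + w) = hrefl e \<mu> x + hrefl e 0 w"
  by (simp add: hrefl_def algebra_simps)

lemma ball_subset_tangent:
  assumes "norm n = 1" "0 < \<rho>" "\<rho> \<le> r"
  shows "ball (y + \<rho> *\<^sub>R n) \<rho> \<subseteq> ball (y + r *\<^sub>R n) r"
proof
  fix z assume "z \<in> ball (y + \<rho> *\<^sub>R n) \<rho>"
  then have "dist (y + \<rho> *\<^sub>R n) z < \<rho>" by simp
  moreover have "dist (y + r *\<^sub>R n) (y + \<rho> *\<^sub>R n) = r - \<rho>"
    using assms by (simp add: dist_norm flip: scaleR_left_diff_distrib)
  ultimately show "z \<in> ball (y + r *\<^sub>R n) r"
    using dist_triangle[of "y + r *\<^sub>R n" z "y + \<rho> *\<^sub>R n"] by simp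
qed

text \<open>Tested at the point of the closed ball lowest in direction n, the half-space condition
  gives \<nu> \<bullet> n >= 1, the equality case of Cauchy-Schwarz.\<close>

lemma tangent_ball_normal_unique:
  fixes n \<nu> :: "'a::euclidean_space"
  assumes "norm n = 1" "norm \<nu> = 1" "0 < r" and pos: "\<And>z. z \<in> ball (y + r *\<^sub>R \<nu>) r \<Longrightarrow> 0 \<le> (z - y) \<bullet> n"
  shows "n = \<nu>"
proof -
  have "closed {z. 0 \<le> (z - y) \<bullet> n}"
    by (intro closed_Collect_le continuous_intros)
  moreover have "ball (y + r *\<^sub>R \<nu>) r \<subseteq> {z. 0 \<le> (z - y) \<bullet> n}" using pos by auto
  ultimately have "closure (ball (y + r *\<^sub>R \<nu>) r) \<subseteq> {z. 0 \<le> (z - y) \<bullet> n}" by (rule closure_minimal[rotated])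
  moreover have "y + r *\<^sub>R \<nu> - r *\<^sub>R n \<in> closure (ball (y + r *\<^sub>R \<nu>) r)"
    using assms by (simp add: dist_norm)
  ultimately have "0 \<le> (r *\<^sub>R \<nu> - r *\<^sub>R n) \<bullet> n" by auto
  then have "0 \<le> r * (\<nu> \<bullet> n - 1)" using assms by (simp add: inner_diff_left right_diff_distrib dot_square_norm)
  then have "1 \<le> \<nu> \<bullet> n" using assms by (simp add: zero_le_mult_iff)
  moreover have "(norm (\<nu> - n))\<^sup>2 = 2 - 2 * (\<nu> \<bullet> n)"
    using norm_add_scaleR_sq[OF assms(1), of \<nu> "- 1"] assms(2) by simp
  ultimately have "(norm (\<nu> - n))\<^sup>2 \<le> 0" by simp
  then show ?thesis by simp
qed

text \<open>Convexity supplies some supporting half-space at y; it contains the tangent ball, which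
  determines its normal.\<close>

lemma support_normal:
  fixes \<Omega> :: "'a::euclidean_space set"
  assumes "convex \<Omega>" "open \<Omega>" and y: "y \<in> frontier \<Omega>" and \<nu>: "norm \<nu> = 1" and r: "0 < r"
    and ball: "ball (y + r *\<^sub>R \<nu>) r \<subseteq> \<Omega>" and x: "x \<in> closure \<Omega>"
  shows "0 \<le> (x - y) \<bullet> \<nu>"
proof -
  have "y \<notin> \<Omega>" using y assms(2) by (simp add: frontier_def interior_open)
  moreover have "\<Omega> \<noteq> {}" using ball r by auto
  ultimately obtain a b where ab: "a \<noteq> 0" "\<And>x. x \<in> \<Omega> \<Longrightarrow> a \<bullet> x \<le> b" "b \<le> a \<bullet> y"
    using separating_hyperplane_sets[of \<Omega> "{y}"] assms(1) by auto
  define n where "n = - (a /\<^sub>R norm a)"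
  have n: "norm n = 1" using ab by (simp add: n_def)
  have pos: "0 \<le> (z - y) \<bullet> n" if "z \<in> \<Omega>" for z
  proof -
    have "(z - y) \<bullet> n = (a \<bullet> y - a \<bullet> z) / norm a"
      by (simp add: n_def inner_diff_left inner_commute diff_divide_distrib divide_inverse algebra_simps)
    then show ?thesis using ab(2)[OF that] ab(3) by simp
  qed
  then have "n = \<nu>" using n \<nu> r ball by (intro tangent_ball_normal_unique[where y=y and r=r]) auto
  have "closed {z. 0 \<le> (z - y) \<bullet> n}" by (intro closed_Collect_le continuous_intros)
  then have "closure \<Omega> \<subseteq> {z. 0 \<le> (z - y) \<bullet> n}" using pos by (intro closure_minimal) auto
  then show ?thesis using x \<open>n = \<nu>\<close> by auto
qed

lemma tangent_point_in_closure:
  fixes \<Omega> :: "'a::euclidean_space set"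
  assumes "ball (y + r *\<^sub>R \<nu>) r \<subseteq> \<Omega>" "0 < r" "norm w \<le> r"
  shows "y + r *\<^sub>R \<nu> + w \<in> closure \<Omega>"
proof -
  have "y + r *\<^sub>R \<nu> + w \<in> closure (ball (y + r *\<^sub>R \<nu>) r)" using assms by (simp add: dist_norm)
  then show ?thesis using closure_mono[OF assms(1)] by blast
qed

text \<open>From the centre of each tangent ball go a distance r against the other normal: the point
  reached lies in the closure, hence in the supporting half-space at the other boundary point.
  Adding the two inequalities gives r |\<nu> - \<nu>'|^2 <= (y' - y) \<bullet> (\<nu> -
  \<nu>').\<close>

lemma normal_lipschitz:
  fixes \<Omega> :: "'a::euclidean_space set"
  assumes "convex \<Omega>" "open \<Omega>" "0 < r"
    and y: "y \<in> frontier \<Omega>" "norm \<nu> = 1" "ball (y + r *\<^sub>R \<nu>) r \<subseteq> \<Omega>"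
    and y': "y' \<in> frontier \<Omega>" "norm \<nu>' = 1" "ball (y' + r *\<^sub>R \<nu>') r \<subseteq> \<Omega>"
  shows "r * norm (\<nu> - \<nu>') \<le> norm (y - y')"
proof -
  have "0 \<le> (y' + r *\<^sub>R \<nu>' + (- r) *\<^sub>R \<nu> - y) \<bullet> \<nu>"
    using assms by (intro support_normal[OF assms(1,2) y(1,2) assms(3) y(3)] tangent_point_in_closure) auto
  moreover have "0 \<le> (y + r *\<^sub>R \<nu> + (- r) *\<^sub>R \<nu>' - y') \<bullet> \<nu>'"
    using assms by (intro support_normal[OF assms(1,2) y'(1,2) assms(3) y'(3)] tangent_point_in_closure) auto
  ultimately have "0 \<le> (y' + r *\<^sub>R \<nu>' + (- r) *\<^sub>R \<nu> - y) \<bullet> \<nu> + (y + r *\<^sub>R \<nu> + (- r) *\<^sub>R \<nu>' - y') \<bullet> \<nu>'" by simp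
  also have "\<dots> = (y' - y) \<bullet> (\<nu> - \<nu>') - r * ((\<nu> - \<nu>') \<bullet> (\<nu> - \<nu>'))"
    by (simp add: inner_add_left inner_diff_left inner_diff_right inner_commute algebra_simps)
  finally have "r * (norm (\<nu> - \<nu>'))\<^sup>2 \<le> (y' - y) \<bullet> (\<nu> - \<nu>')" by (simp add: power2_norm_eq_inner)
  also have "\<dots> \<le> norm (y' - y) * norm (\<nu> - \<nu>')" by (rule norm_cauchy_schwarz)
  finally have "(r * norm (\<nu> - \<nu>')) * norm (\<nu> - \<nu>') \<le> norm (y - y') * norm (\<nu> - \<nu>')"
    by (simp add: power2_eq_square norm_minus_commute mult.assoc)
  then show ?thesis by (cases "norm (\<nu> - \<nu>') = 0") (auto simp: mult_le_cancel_right)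
qed

text \<open>Boundary points lie outside the large tangent ball, so none is nearer than y. This makes
  the boundary condition explicit along normals.\<close>

lemma bdist_normal:
  fixes \<Omega> :: "'a::euclidean_space set"
  assumes "open \<Omega>" and y: "y \<in> frontier \<Omega>" "norm \<nu> = 1" "ball (y + r *\<^sub>R \<nu>) r \<subseteq> \<Omega>" and \<sigma>: "0 < \<sigma>" "\<sigma> \<le> r"
  shows "bdist \<Omega> (y + \<sigma> *\<^sub>R \<nu>) = \<sigma>"
proof (rule antisym)
  show "bdist \<Omega> (y + \<sigma> *\<^sub>R \<nu>) \<le> \<sigma>"
    unfolding bdist_def using infdist_le[OF y(1), of "y + \<sigma> *\<^sub>R \<nu>"] y(2) \<sigma> by (simp add: dist_norm)
  have "\<sigma> \<le> dist (y + \<sigma> *\<^sub>R \<nu>) w" if "w \<in> frontier \<Omega>" for w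
  proof -
    have "w \<notin> \<Omega>" using that assms(1) by (simp add: frontier_def interior_open)
    then have "r \<le> dist (y + r *\<^sub>R \<nu>) w" using y(3) by (meson in_mono mem_ball not_le)
    moreover have "dist (y + r *\<^sub>R \<nu>) (y + \<sigma> *\<^sub>R \<nu>) = r - \<sigma>"
      using \<sigma> y by (simp add: dist_norm flip: scaleR_left_diff_distrib)
    ultimately show ?thesis using dist_triangle[of "y + r *\<^sub>R \<nu>" w "y + \<sigma> *\<^sub>R \<nu>"] by linarith
  qed
  then show "\<sigma> \<le> bdist \<Omega> (y + \<sigma> *\<^sub>R \<nu>)"
    unfolding bdist_def infdist_def using y(1) by (auto intro!: cINF_greatest)
qed

section \<open>From a C^(1,1) boundary to uniform interior tangent balls\<close>

lemma segment_derivative_bound: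
  fixes \<gamma> :: "'a::euclidean_space \<Rightarrow> real" and g :: "'a \<Rightarrow> 'a"
  assumes conv: "convex S"
    and der: "\<And>y. y \<in> S \<Longrightarrow> (\<gamma> has_derivative (\<lambda>h. g y \<bullet> h)) (at y within S)"
    and lip: "\<And>y z. y \<in> S \<Longrightarrow> z \<in> S \<Longrightarrow> norm (g y - g z) \<le> L * norm (y - z)"
    and yz: "y \<in> S" "z \<in> S"
  shows "\<gamma> z \<le> \<gamma> y + g y \<bullet> (z - y) + \<bar>L\<bar> * (norm (z - y))\<^sup>2"
proof -
  define c where "c t = y + t *\<^sub>R (z - y)" for t :: real
  have cS: "c t \<in> S" if "t \<in> {0..1}" for t
  proof -
    have "c t = (1 - t) *\<^sub>R y + t *\<^sub>R z" by (simp add: c_def algebra_simps)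
    then show ?thesis using conv yz that by (simp add: convexD_alt)
  qed
  have "((\<lambda>t. \<gamma> (c t)) has_derivative (\<lambda>h. g (c t) \<bullet> (h *\<^sub>R (z - y)))) (at t within {0..1})" if "t \<in> {0..1}" for t
  proof -
    have "(c has_derivative (\<lambda>h. h *\<^sub>R (z - y))) (at t within {0..1})"
      unfolding c_def by (auto intro!: derivative_eq_intros)
    moreover have "(\<gamma> has_derivative (\<lambda>h. g (c t) \<bullet> h)) (at (c t) within c ` {0..1})"
      using der[OF cS[OF that]] cS by (auto intro: has_derivative_subset)
    ultimately show ?thesis
      using has_derivative_in_compose[of c "\<lambda>h. h *\<^sub>R (z - y)" t "{0..1}" \<gamma> "\<lambda>h. g (c t) \<bullet> h"] by simp
  qed
  then have "\<exists>t\<in>{0<..<1}. \<gamma> (c 1) - \<gamma> (c 0) = g (c t) \<bullet> ((1 - 0) *\<^sub>R (z - y))"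
    by (intro mvt_simple[where f="\<lambda>t. \<gamma> (c t)" and f'="\<lambda>t h. g (c t) \<bullet> (h *\<^sub>R (z - y))"]) auto
  then obtain t where t: "t \<in> {0<..<1}" "\<gamma> (c 1) - \<gamma> (c 0) = g (c t) \<bullet> ((1 - 0) *\<^sub>R (z - y))" ..
  have "norm (g (c t) - g y) \<le> L * norm (c t - y)" using t cS yz by (intro lip) auto
  \<comment> \<open>L may be negative when S is a single point, as happens for N = 1; hence the
    absolute value.\<close>
  also have "\<dots> \<le> \<bar>L\<bar> * norm (c t - y)" by (intro mult_right_mono) auto
  also have "norm (c t - y) = t * norm (z - y)" using t by (simp add: c_def)
  also have "\<bar>L\<bar> * (t * norm (z - y)) \<le> \<bar>L\<bar> * (1 * norm (z - y))" using t by (intro mult_left_mono mult_right_mono) auto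
  finally have "norm (g (c t) - g y) \<le> \<bar>L\<bar> * norm (z - y)" by simp
  then have "norm (g (c t) - g y) * norm (z - y) \<le> \<bar>L\<bar> * norm (z - y) * norm (z - y)" by (intro mult_right_mono) auto
  moreover have "(g (c t) - g y) \<bullet> (z - y) \<le> norm (g (c t) - g y) * norm (z - y)" by (rule norm_cauchy_schwarz)
  ultimately have "(g (c t) - g y) \<bullet> (z - y) \<le> \<bar>L\<bar> * (norm (z - y))\<^sup>2" by (simp add: power2_eq_square)
  then show ?thesis using t(2) by (simp add: c_def inner_diff_left)
qed

text \<open>A point x of the ball satisfies |x - y|^2 < 2 \<rho> (x - y) \<bullet> \<nu>. For small
  \<rho> the quadratic Taylor remainder of \<gamma> is thus smaller than the linear term n (x - y)
  \<bullet> \<nu>, which puts x above the graph.\<close>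

lemma C11_interior_ball_local:
  fixes \<Omega> :: "'a::euclidean_space set"
  assumes "open \<Omega>" and "C11_boundary \<Omega>" and x0: "x0 \<in> frontier \<Omega>"
  obtains R \<rho> where "0 < R" "0 < \<rho>"
    "\<And>y. y \<in> frontier \<Omega> \<Longrightarrow> y \<in> ball x0 R \<Longrightarrow> \<exists>\<nu>. norm \<nu> = 1 \<and> ball (y + \<rho> *\<^sub>R \<nu>) \<rho> \<subseteq> \<Omega>"
proof -
  obtain r e \<gamma> g L where r: "r > 0" and e: "norm (e::'a) = 1"
    and der: "\<And>y. y \<bullet> e = 0 \<Longrightarrow> (\<gamma> has_derivative (\<lambda>h. g y \<bullet> h)) (at y within {y. y \<bullet> e = 0})"
    and lip: "\<And>y z. y \<bullet> e = 0 \<Longrightarrow> z \<bullet> e = 0 \<Longrightarrow> norm (g y - g z) \<le> L * norm (y - z)"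
    and epi: "\<Omega> \<inter> ball x0 r = {x \<in> ball x0 r. x \<bullet> e > \<gamma> (x - (x \<bullet> e) *\<^sub>R e)}"
    using bspec[OF assms(2)[unfolded C11_boundary_def] x0] by blast
  define P where "P x = x - (x \<bullet> e) *\<^sub>R e" for x
  have ee: "e \<bullet> e = 1" using e by (simp add: dot_square_norm)
  have P0: "P x \<bullet> e = 0" for x by (simp add: P_def inner_diff_left ee)
  have conv: "convex {y. y \<bullet> e = 0}" by (rule convexI) (simp add: inner_add_left)
  have \<gamma>_cont: "continuous_on {y. y \<bullet> e = 0} \<gamma>"
    unfolding continuous_on_eq_continuous_within by (intro ballI has_derivative_continuous[OF der]) simp
  have P_cont: "continuous_on A P" for A unfolding P_def by (intro continuous_intros)
  have \<gamma>P_cont: "continuous_on UNIV (\<lambda>x. \<gamma> (P x))"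
    by (rule continuous_on_compose2[OF \<gamma>_cont P_cont]) (auto simp: P0)
  \<comment> \<open>r/4 keeps the ball inside the chart; the other bound makes 2 \<rho> (|L| + 1) at
    most 1 and hence at most n.\<close>
  define \<rho> where "\<rho> = min (r / 4) (1 / (2 * (\<bar>L\<bar> + 1)))"
  have \<rho>: "\<rho> > 0" "\<rho> \<le> r / 4" "\<rho> \<le> 1 / (2 * (\<bar>L\<bar> + 1))" using r by (auto simp: \<rho>_def)
  have "\<exists>\<nu>. norm \<nu> = 1 \<and> ball (y + \<rho> *\<^sub>R \<nu>) \<rho> \<subseteq> \<Omega>" if y: "y \<in> frontier \<Omega>" "y \<in> ball x0 (r / 2)" for y
  proof -
    have yr: "y \<in> ball x0 r" using y r by simp
    have "y \<notin> \<Omega>" using y assms(1) by (simp add: frontier_def interior_open)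
    have ycl: "y \<in> closure \<Omega>" using y by (simp add: frontier_def)
    have yle: "\<not> \<gamma> (P y) < y \<bullet> e" using \<open>y \<notin> \<Omega>\<close> yr epi by (auto simp: P_def)
    \<comment> \<open>A boundary point strictly below the graph would have a neighbourhood below the
      graph, which is free of \<Omega>.\<close>
    have yeq: "y \<bullet> e = \<gamma> (P y)"
    proof (rule ccontr)
      assume "\<not> ?thesis"
      then have lt: "y \<bullet> e < \<gamma> (P y)" using yle by simp
      have "open {x. x \<bullet> e < \<gamma> (P x)}" using \<gamma>P_cont by (intro open_Collect_less continuous_intros)
      then have "open ({x. x \<bullet> e < \<gamma> (P x)} \<inter> ball x0 r)" by auto
      moreover have "y \<in> {x. x \<bullet> e < \<gamma> (P x)} \<inter> ball x0 r" using lt yr by simp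
      ultimately have "({x. x \<bullet> e < \<gamma> (P x)} \<inter> ball x0 r) \<inter> \<Omega> \<noteq> {}"
        using ycl open_Int_closure_eq_empty[of "{x. x \<bullet> e < \<gamma> (P x)} \<inter> ball x0 r" \<Omega>] by blast
      then obtain x where "x \<bullet> e < \<gamma> (P x)" "x \<in> \<Omega> \<inter> ball x0 r" by blast
      then show False using epi by (auto simp: P_def)
    qed
    \<comment> \<open>The derivative is taken within the hyperplane and determines only the
      tangential part of \<open>g\<close>. The component along e must be projected away before e - G
      can serve as a normal.\<close>
    define G where "G = P (g (P y))"
    have Ge: "G \<bullet> e = 0" by (simp add: G_def P0)
    have Gin: "g (P y) \<bullet> w = G \<bullet> w" if "w \<bullet> e = 0" for w
    proof -
      have "e \<bullet> w = 0" using that by (simp add: inner_commute)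
      then show ?thesis by (simp add: G_def P_def[of "g (P y)"] inner_diff_left)
    qed
    define n where "n = norm (e - G)"
    have "n\<^sup>2 = 1 + (norm G)\<^sup>2" unfolding n_def power2_norm_eq_inner
      using Ge by (simp add: inner_diff_left inner_diff_right ee inner_commute)
    then have n1: "n \<ge> 1" using power2_le_imp_le[of 1 n] by (simp add: n_def)
    define \<nu> where "\<nu> = (e - G) /\<^sub>R n"
    have "n \<noteq> 0" using n1 by auto
    then have \<nu>: "norm \<nu> = 1" by (simp add: \<nu>_def n_def)
    have e\<nu>: "e - G = n *\<^sub>R \<nu>" using n1 by (simp add: \<nu>_def)
    have "ball (y + \<rho> *\<^sub>R \<nu>) \<rho> \<subseteq> \<Omega>"
    proof
      fix x assume "x \<in> ball (y + \<rho> *\<^sub>R \<nu>) \<rho>"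
      then have d: "norm ((x - y) + (- \<rho>) *\<^sub>R \<nu>) < \<rho>" by (simp add: dist_norm norm_minus_commute algebra_simps)
      then have "(norm ((x - y) + (- \<rho>) *\<^sub>R \<nu>))\<^sup>2 < \<rho>\<^sup>2" by (intro power_strict_mono) auto
      then have d2: "(norm (x - y))\<^sup>2 < 2 * \<rho> * ((x - y) \<bullet> \<nu>)" unfolding norm_add_scaleR_sq[OF \<nu>] by simp
      have "norm (x - y) \<le> norm ((x - y) + (- \<rho>) *\<^sub>R \<nu>) + norm (\<rho> *\<^sub>R \<nu>)"
        using norm_triangle_ineq[of "(x - y) + (- \<rho>) *\<^sub>R \<nu>" "\<rho> *\<^sub>R \<nu>"] by simp
      then have "norm (x - y) < 2 * \<rho>" using d \<nu> \<rho> by simp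
      then have "dist y x < r / 2" using \<rho> by (simp add: dist_norm norm_minus_commute)
      then have xr: "x \<in> ball x0 r" using y dist_triangle[of x0 x y] by simp
      have "norm (P x - P y) \<le> norm (x - y)"
      proof -
        have "P x - P y = (x - y) + (- ((x - y) \<bullet> e)) *\<^sub>R e" by (simp add: P_def inner_diff_left algebra_simps)
        then have "(norm (P x - P y))\<^sup>2 = (norm (x - y))\<^sup>2 - ((x - y) \<bullet> e)\<^sup>2"
          using norm_add_scaleR_sq[OF e, of "x - y" "- ((x - y) \<bullet> e)"] by (simp add: power2_eq_square)
        then have "(norm (P x - P y))\<^sup>2 \<le> (norm (x - y))\<^sup>2" by simp
        then show ?thesis by (rule power2_le_imp_le) simp
      qed
      then have "\<bar>L\<bar> * (norm (P x - P y))\<^sup>2 \<le> \<bar>L\<bar> * (norm (x - y))\<^sup>2" by (intro mult_left_mono power_mono) auto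
      also have "\<dots> \<le> (\<bar>L\<bar> + 1) * (norm (x - y))\<^sup>2" by (intro mult_right_mono) auto
      also have "\<dots> < (\<bar>L\<bar> + 1) * (2 * \<rho> * ((x - y) \<bullet> \<nu>))" using d2 by (intro mult_strict_left_mono) auto
      also have "\<dots> = ((\<bar>L\<bar> + 1) * (2 * \<rho>)) * ((x - y) \<bullet> \<nu>)" by simp
      also have "\<dots> \<le> n * ((x - y) \<bullet> \<nu>)"
      proof (rule mult_right_mono)
        have "(\<bar>L\<bar> + 1) * (2 * \<rho>) \<le> (\<bar>L\<bar> + 1) * (2 * (1 / (2 * (\<bar>L\<bar> + 1))))" using \<rho>(3) by (intro mult_left_mono) auto
        also have "\<dots> = 1" by (simp add: field_simps)
        finally show "(\<bar>L\<bar> + 1) * (2 * \<rho>) \<le> n" using n1 by simp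
        have "0 \<le> (2 * \<rho>) * ((x - y) \<bullet> \<nu>)" using d2 zero_le_power2[of "norm (x - y)"] by linarith
        then show "0 \<le> (x - y) \<bullet> \<nu>" using \<rho>(1) by (simp add: zero_le_mult_iff)
      qed
      also have "\<dots> = (x - y) \<bullet> (e - G)" by (simp add: e\<nu>)
      also have "\<dots> = x \<bullet> e - y \<bullet> e - g (P y) \<bullet> (P x - P y)"
      proof -
        have "x - y = (P x - P y) + ((x - y) \<bullet> e) *\<^sub>R e" by (simp add: P_def inner_diff_left algebra_simps)
        then have "(x - y) \<bullet> G = (P x - P y) \<bullet> G" using Ge by (metis inner_add_left inner_commute inner_scaleR_left mult_zero_right add.right_neutral)
        moreover have "g (P y) \<bullet> (P x - P y) = G \<bullet> (P x - P y)" by (intro Gin) (simp add: inner_diff_left P0)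
        ultimately show ?thesis by (simp add: inner_diff_right inner_diff_left inner_commute)
      qed
      finally have "\<bar>L\<bar> * (norm (P x - P y))\<^sup>2 < x \<bullet> e - y \<bullet> e - g (P y) \<bullet> (P x - P y)" .
      moreover have "\<gamma> (P x) \<le> \<gamma> (P y) + g (P y) \<bullet> (P x - P y) + \<bar>L\<bar> * (norm (P x - P y))\<^sup>2"
        by (rule segment_derivative_bound[OF conv]) (use der lip P0 in auto)
      ultimately have "\<gamma> (P x) < x \<bullet> e" using yeq by linarith
      then show "x \<in> \<Omega>" using xr epi by (auto simp: P_def)
    qed
    with \<nu> show ?thesis by blast
  qed
  then show ?thesis using r \<rho>(1) by (intro that[of "r / 2" \<rho>]) auto
qed


lemma C11_interior_ball:
  fixes \<Omega> :: "'a::euclidean_space set"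
  assumes "open \<Omega>" "bounded \<Omega>" and "C11_boundary \<Omega>"
  obtains r where "0 < r" "\<And>y. y \<in> frontier \<Omega> \<Longrightarrow> \<exists>\<nu>. norm \<nu> = 1 \<and> ball (y + r *\<^sub>R \<nu>) r \<subseteq> \<Omega>"
proof -
  have "\<forall>x0\<in>frontier \<Omega>. \<exists>R \<rho>. 0 < R \<and> 0 < \<rho> \<and> (\<forall>y\<in>frontier \<Omega> \<inter> ball x0 R. \<exists>\<nu>. norm \<nu> = 1 \<and> ball (y + \<rho> *\<^sub>R \<nu>) \<rho> \<subseteq> \<Omega>)"
  proof
    fix x0 assume "x0 \<in> frontier \<Omega>"
    from C11_interior_ball_local[OF assms(1,3) this] show "\<exists>R \<rho>. 0 < R \<and> 0 < \<rho> \<and> (\<forall>y\<in>frontier \<Omega> \<inter> ball x0 R. \<exists>\<nu>. norm \<nu> = 1 \<and> ball (y + \<rho> *\<^sub>R \<nu>) \<rho> \<subseteq> \<Omega>)"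
      by (metis IntE)
  qed
  then obtain R \<rho> where R: "\<And>x0. x0 \<in> frontier \<Omega> \<Longrightarrow> 0 < R x0" and \<rho>: "\<And>x0. x0 \<in> frontier \<Omega> \<Longrightarrow> 0 < \<rho> x0"
    and ball: "\<And>x0 y. x0 \<in> frontier \<Omega> \<Longrightarrow> y \<in> frontier \<Omega> \<inter> ball x0 (R x0) \<Longrightarrow> \<exists>\<nu>. norm \<nu> = 1 \<and> ball (y + \<rho> x0 *\<^sub>R \<nu>) (\<rho> x0) \<subseteq> \<Omega>"
    by metis
  have "compact (frontier \<Omega>)" using assms(2) by (rule compact_frontier_bounded)
  then obtain C where C: "C \<subseteq> frontier \<Omega>" "finite C" "frontier \<Omega> \<subseteq> (\<Union>x\<in>C. ball x (R x))"
  proof (rule compactE_image)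
    show "frontier \<Omega> \<subseteq> (\<Union>x\<in>frontier \<Omega>. ball x (R x))" using R by force
  qed auto
  \<comment> \<open>The 1 keeps \<open>Min\<close> meaningful when the finite cover is
    empty.\<close>
  define r where "r = Min (insert 1 (\<rho> ` C))"
  have r: "0 < r" "\<And>x. x \<in> C \<Longrightarrow> r \<le> \<rho> x" using C \<rho> by (auto simp: r_def)
  have "\<exists>\<nu>. norm \<nu> = 1 \<and> ball (y + r *\<^sub>R \<nu>) r \<subseteq> \<Omega>" if y: "y \<in> frontier \<Omega>" for y
  proof -
    obtain x where x: "x \<in> C" "y \<in> ball x (R x)" using C(3) y by blast
    then obtain \<nu> where "norm \<nu> = 1" "ball (y + \<rho> x *\<^sub>R \<nu>) (\<rho> x) \<subseteq> \<Omega>" using ball[of x y] y C(1) by blast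
    then show ?thesis using ball_subset_tangent[of \<nu> r "\<rho> x" y] r x by blast
  qed
  with r(1) show ?thesis using that by blast
qed

section \<open>The critical plane\<close>

locale overdetermined = sublinear_solution \<Omega> u s p lam D M cN kmin
  for \<Omega> :: "'a::euclidean_space set" and u s p lam D M cN kmin +
  fixes r C0 :: real
  assumes r_pos: "0 < r"
    and interior_ball: "\<And>y. y \<in> frontier \<Omega> \<Longrightarrow> \<exists>\<nu>. norm \<nu> = 1 \<and> ball (y + r *\<^sub>R \<nu>) r \<subseteq> \<Omega>"
    and trace: "\<And>x0. x0 \<in> frontier \<Omega> \<Longrightarrow> ((\<lambda>x. u x / bdist \<Omega> x powr s) \<longlongrightarrow> C0) (at x0 within \<Omega>)"
begin

definition good :: "'a \<Rightarrow> real \<Rightarrow> bool" where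
  "good e \<mu> \<longleftrightarrow> (\<forall>x\<in>closure \<Omega>. \<mu> \<le> x \<bullet> e \<longrightarrow> hrefl e \<mu> x \<in> closure \<Omega>)"

lemma frontierI: "x \<in> closure \<Omega> \<Longrightarrow> x \<notin> \<Omega> \<Longrightarrow> x \<in> frontier \<Omega>"
  using \<Omega>_open by (simp add: frontier_def interior_open)

lemma frontierD: "x \<in> frontier \<Omega> \<Longrightarrow> x \<in> closure \<Omega> \<and> x \<notin> \<Omega>"
  using \<Omega>_open by (simp add: frontier_def interior_open)

text \<open>w is the last point of the closure on the segment from x to its mirror image. It lies
  within r of the top height, and its tangent ball must not exceed that height, so the inner normal
  at w points against e. But then the segment continues inside that ball.\<close>

lemma good_near_top:
  assumes e: "norm e = 1" and top: "\<And>x. x \<in> closure \<Omega> \<Longrightarrow> x \<bullet> e \<le> m" and \<mu>: "m - r / 2 < \<mu>"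
  shows "good e \<mu>"
  unfolding good_def
proof (intro ballI impI, rule ccontr)
  fix x assume x: "x \<in> closure \<Omega>" "\<mu> \<le> x \<bullet> e" and out: "hrefl e \<mu> x \<notin> closure \<Omega>"
  define d where "d = x \<bullet> e - \<mu>"
  have d: "0 \<le> d" "d < r / 2" using x top[OF x(1)] \<mu> by (auto simp: d_def)
  have ee: "e \<bullet> e = 1" using e by (simp add: dot_square_norm)
  have refl: "hrefl e \<mu> x = x - (2 * d) *\<^sub>R e" by (simp add: hrefl_def d_def)
  define S where "S = {\<sigma> \<in> {0..2 * d}. x - \<sigma> *\<^sub>R e \<in> closure \<Omega>}"
  have "S = {0..2 * d} \<inter> (\<lambda>\<sigma>. x - \<sigma> *\<^sub>R e) -` closure \<Omega>" by (auto simp: S_def)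
  moreover have "closed ((\<lambda>\<sigma>. x - \<sigma> *\<^sub>R e) -` closure \<Omega>)" by (intro closed_vimage closed_closure continuous_intros)
  ultimately have "compact S" by (simp add: compact_Int_closed)
  moreover have "0 \<in> S" using x d by (simp add: S_def)
  ultimately obtain \<sigma> where \<sigma>: "\<sigma> \<in> S" "\<And>\<tau>. \<tau> \<in> S \<Longrightarrow> \<tau> \<le> \<sigma>"
    using compact_attains_sup[of S] by (metis empty_iff)
  define w where "w = x - \<sigma> *\<^sub>R e"
  have w: "w \<in> closure \<Omega>" using \<sigma> by (simp add: w_def S_def)
  have \<sigma>2: "\<sigma> < 2 * d" using \<sigma>(1) out by (cases "\<sigma> = 2 * d") (auto simp: S_def refl)
  have max: False if "\<eta>0 > 0" "\<And>\<eta>. 0 < \<eta> \<Longrightarrow> \<eta> < \<eta>0 \<Longrightarrow> w - \<eta> *\<^sub>R e \<in> \<Omega>" for \<eta>0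
  proof -
    define \<eta> where "\<eta> = min (\<eta>0 / 2) (2 * d - \<sigma>)"
    have \<eta>: "0 < \<eta>" "\<eta> < \<eta>0" "\<eta> \<le> 2 * d - \<sigma>" using that(1) \<sigma>2 by (auto simp: \<eta>_def)
    have "w - \<eta> *\<^sub>R e = x - (\<sigma> + \<eta>) *\<^sub>R e" by (simp add: w_def algebra_simps)
    then have "x - (\<sigma> + \<eta>) *\<^sub>R e \<in> closure \<Omega>" using that(2)[OF \<eta>(1,2)] closure_subset by auto
    then have "\<sigma> + \<eta> \<in> S" using \<eta> \<sigma>(1) by (auto simp: S_def)
    then show False using \<sigma>(2)[of "\<sigma> + \<eta>"] \<eta> by simp
  qed
  have "w \<notin> \<Omega>"
  proof
    assume "w \<in> \<Omega>"
    then obtain \<eta>0 where \<eta>0: "\<eta>0 > 0" "ball w \<eta>0 \<subseteq> \<Omega>" using \<Omega>_open openE by blast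
    show False
    proof (rule max[OF \<eta>0(1)])
      fix \<eta> assume "0 < \<eta>" "\<eta> < \<eta>0"
      then have "w - \<eta> *\<^sub>R e \<in> ball w \<eta>0" using e by (simp add: dist_norm)
      then show "w - \<eta> *\<^sub>R e \<in> \<Omega>" using \<eta>0 by blast
    qed
  qed
  then have wf: "w \<in> frontier \<Omega>" using w by (intro frontierI)
  then obtain \<nu> where \<nu>: "norm \<nu> = 1" "ball (w + r *\<^sub>R \<nu>) r \<subseteq> \<Omega>" using interior_ball by blast
  have "w + r *\<^sub>R \<nu> + r *\<^sub>R e \<in> closure \<Omega>" using \<nu> r_pos e by (intro tangent_point_in_closure) auto
  from top[OF this] have "w \<bullet> e + r * (\<nu> \<bullet> e) + r \<le> m" by (simp add: inner_add_left ee)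
  moreover have "m - r < w \<bullet> e" using \<sigma>2 d \<mu> by (simp add: w_def inner_diff_left ee d_def)
  ultimately have "r * (\<nu> \<bullet> e) < 0" by linarith
  then have neg: "\<nu> \<bullet> e < 0" using r_pos by (simp add: mult_less_0_iff)
  show False
  proof (rule max)
    show "0 < - (2 * r * (\<nu> \<bullet> e))" using \<open>r * (\<nu> \<bullet> e) < 0\<close> by simp
    fix \<eta> assume \<eta>: "0 < \<eta>" "\<eta> < - (2 * r * (\<nu> \<bullet> e))"
    have "(norm ((w + r *\<^sub>R \<nu>) - (w - \<eta> *\<^sub>R e)))\<^sup>2 = (norm (r *\<^sub>R \<nu> + \<eta> *\<^sub>R e))\<^sup>2" by (simp add: algebra_simps)
    also have "\<dots> = r\<^sup>2 + \<eta> * (2 * r * (\<nu> \<bullet> e) + \<eta>)"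
      unfolding norm_add_scaleR_sq[OF e] using \<nu>(1) r_pos by (simp add: power2_eq_square algebra_simps)
    also have "\<dots> < r\<^sup>2" using \<eta> by (simp add: mult_less_0_iff)
    finally have "norm ((w + r *\<^sub>R \<nu>) - (w - \<eta> *\<^sub>R e)) < r" by (rule power2_less_imp_less) (use r_pos in simp)
    then show "w - \<eta> *\<^sub>R e \<in> \<Omega>" using \<nu>(2) by (metis dist_norm mem_ball subsetD)
  qed
qed

text \<open>m is the supremum of the bad planes: bad planes accumulate at m from below, and m itself
  is good as a limit of good ones. The lowest plane is bad and planes near the top are good, so m
  lies strictly between them and, by convexity, its plane meets \<Omega>.\<close>

lemma critical_plane:
  assumes e: "norm e = 1"
  obtains m b where "good e m" "b \<in> \<Omega>" "b \<bullet> e = m" "\<And>\<epsilon>. 0 < \<epsilon> \<Longrightarrow> \<exists>\<mu>. m - \<epsilon> < \<mu> \<and> \<mu> < m \<and> \<not> good e \<mu>"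
proof -
  have ee: "e \<bullet> e = 1" using e by (simp add: dot_square_norm)
  have cne: "closure \<Omega> \<noteq> {}" using \<Omega>_nonempty by simp
  have cont: "continuous_on (closure \<Omega>) (\<lambda>x. x \<bullet> e)" by (intro continuous_intros)
  obtain xt where xt: "xt \<in> closure \<Omega>" "\<And>x. x \<in> closure \<Omega> \<Longrightarrow> x \<bullet> e \<le> xt \<bullet> e"
    using continuous_attains_sup[OF compact_closure_\<Omega> cne cont] by blast
  obtain xb where xb: "xb \<in> closure \<Omega>" "\<And>x. x \<in> closure \<Omega> \<Longrightarrow> xb \<bullet> e \<le> x \<bullet> e"
    using continuous_attains_inf[OF compact_closure_\<Omega> cne cont] by blast
  define Bd where "Bd = {\<mu>. \<not> good e \<mu>}"
  have up: "\<mu> \<le> xt \<bullet> e - r / 2" if "\<mu> \<in> Bd" for \<mu>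
    using good_near_top[OF e xt(2), of \<mu>] that by (force simp: Bd_def)
  then have bdd: "bdd_above Bd" by (auto simp: bdd_above_def)
  have xbB: "xb \<bullet> e \<in> Bd"
  proof -
    obtain x where "x \<in> \<Omega>" using \<Omega>_nonempty by blast
    then obtain \<eta> where \<eta>: "\<eta> > 0" "ball x \<eta> \<subseteq> \<Omega>" using \<Omega>_open openE by blast
    have "x - (\<eta> / 2) *\<^sub>R e \<in> ball x \<eta>" using \<eta> e by (simp add: dist_norm)
    then have "xb \<bullet> e \<le> (x - (\<eta> / 2) *\<^sub>R e) \<bullet> e" using \<eta> closure_subset by (intro xb) blast
    then have lt: "xb \<bullet> e < x \<bullet> e" using \<eta> by (simp add: inner_diff_left ee)
    have "hrefl e (xb \<bullet> e) x \<bullet> e < xb \<bullet> e" using lt by (simp add: hrefl_inner[OF e])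
    then have "hrefl e (xb \<bullet> e) x \<notin> closure \<Omega>" using xb(2) by force
    moreover have "x \<in> closure \<Omega>" using \<open>x \<in> \<Omega>\<close> closure_subset by blast
    ultimately show ?thesis using lt less_imp_le unfolding Bd_def good_def by blast
  qed
  define m where "m = Sup Bd"
  have mle: "m \<le> xt \<bullet> e - r / 2" unfolding m_def using xbB up by (intro cSup_least) auto
  have good_above: "good e \<mu>" if "m < \<mu>" for \<mu>
    using that cSup_upper[OF _ bdd, of \<mu>] by (force simp: Bd_def m_def)
  have good_m: "good e m" unfolding good_def
  proof (intro ballI impI)
    fix x assume x: "x \<in> closure \<Omega>" "m \<le> x \<bullet> e"
    show "hrefl e m x \<in> closure \<Omega>"
    proof (cases "m = x \<bullet> e")
      case True
      then show ?thesis using x by (simp add: hrefl_fixed)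
    next
      case False
      then have lt: "m < x \<bullet> e" using x by simp
      show ?thesis
      proof (rule Lim_in_closed_set[OF closed_closure])
        show "((\<lambda>\<mu>. hrefl e \<mu> x) \<longlongrightarrow> hrefl e m x) (at_right m)"
          unfolding hrefl_def by (intro tendsto_intros)
        have "eventually (\<lambda>\<mu>. \<mu> \<in> {m<..<x \<bullet> e}) (at_right m)" using lt by (rule eventually_at_right_real)
        then show "eventually (\<lambda>\<mu>. hrefl e \<mu> x \<in> closure \<Omega>) (at_right m)"
          by eventually_elim (use good_above x in \<open>auto simp: good_def\<close>)
      qed simp
    qed
  qed
  have mgt: "xb \<bullet> e < m"
  proof -
    have "xb \<bullet> e \<le> m" unfolding m_def using xbB bdd by (rule cSup_upper)
    moreover have "xb \<bullet> e \<noteq> m" using xbB good_m by (auto simp: Bd_def)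
    ultimately show ?thesis by simp
  qed
  have mlt: "m < xt \<bullet> e" using mle r_pos by simp
  obtain x1 where x1: "x1 \<in> \<Omega>" "x1 \<bullet> e < m"
  proof -
    have "open {x. x \<bullet> e < m}" by (intro open_Collect_less continuous_intros)
    then have "\<Omega> \<inter> {x. x \<bullet> e < m} \<noteq> {}" using xb(1) mgt open_Int_closure_eq_empty[of "{x. x \<bullet> e < m}" \<Omega>] by blast
    then show ?thesis using that by blast
  qed
  obtain x2 where x2: "x2 \<in> \<Omega>" "m < x2 \<bullet> e"
  proof -
    have "open {x. m < x \<bullet> e}" by (intro open_Collect_less continuous_intros)
    then have "\<Omega> \<inter> {x. m < x \<bullet> e} \<noteq> {}" using xt(1) mlt open_Int_closure_eq_empty[of "{x. m < x \<bullet> e}" \<Omega>] by blast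
    then show ?thesis using that by blast
  qed
  define th where "th = (m - x1 \<bullet> e) / (x2 \<bullet> e - x1 \<bullet> e)"
  have th: "0 \<le> th" "th \<le> 1" using x1 x2 by (auto simp: th_def divide_simps)
  define b where "b = (1 - th) *\<^sub>R x1 + th *\<^sub>R x2"
  have b: "b \<in> \<Omega>" unfolding b_def using \<Omega>_convex x1 x2 th by (simp add: convexD_alt)
  have "b \<bullet> e = x1 \<bullet> e + th * (x2 \<bullet> e - x1 \<bullet> e)" by (simp add: b_def inner_add_left algebra_simps)
  also have "\<dots> = m" using x1 x2 by (simp add: th_def)
  finally have be: "b \<bullet> e = m" .
  have "\<exists>\<mu>. m - \<epsilon> < \<mu> \<and> \<mu> < m \<and> \<not> good e \<mu>" if "0 < \<epsilon>" for \<epsilon>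
  proof -
    have "m - \<epsilon> < Sup Bd" using that by (simp add: m_def)
    then obtain \<mu> where \<mu>: "\<mu> \<in> Bd" "m - \<epsilon> < \<mu>" using less_cSup_iff[OF _ bdd] xbB by blast
    then have "\<not> good e \<mu>" by (simp add: Bd_def)
    moreover have "\<mu> \<le> m" unfolding m_def using \<mu>(1) bdd by (rule cSup_upper)
    ultimately have "\<mu> < m" using good_m by (cases "\<mu> = m") auto
    with \<mu> \<open>\<not> good e \<mu>\<close> show ?thesis by blast
  qed
  with good_m b be show ?thesis using that by blast
qed

text \<open>k is the largest factor for which the contracted mirror image of the cap fits into the
  closure. Factors slightly above k let some points escape; a limit x of such points yields the
  contact.\<close>

lemma contact_point:
  assumes e: "norm e = 1" and bad: "\<not> good e \<mu>" and b: "b \<in> \<Omega>" "b \<bullet> e = \<mu>"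
  obtains k x where "0 \<le> k" "k < 1" "x \<in> frontier \<Omega>" "\<mu> < x \<bullet> e" "b + k *\<^sub>R (hrefl e \<mu> x - b) \<in> frontier \<Omega>"
    "\<And>x. x \<in> closure \<Omega> \<Longrightarrow> \<mu> \<le> x \<bullet> e \<Longrightarrow> b + k *\<^sub>R (hrefl e \<mu> x - b) \<in> closure \<Omega>"
proof -
  let ?R = "hrefl e \<mu>"
  define Cc where "Cc = closure \<Omega> \<inter> {x. \<mu> \<le> x \<bullet> e}"
  have "closed {x. \<mu> \<le> x \<bullet> e}" by (intro closed_Collect_le continuous_intros)
  then have Cc: "compact Cc" unfolding Cc_def by (intro compact_Int_closed compact_closure_\<Omega>)
  define Kset where "Kset = {0..1} \<inter> (\<Inter>x\<in>Cc. (\<lambda>k. b + k *\<^sub>R (?R x - b)) -` closure \<Omega>)"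
  have "closed ((\<lambda>k. b + k *\<^sub>R (?R x - b)) -` closure \<Omega>)" for x by (intro closed_vimage closed_closure continuous_intros)
  then have "compact Kset" unfolding Kset_def by (intro compact_Int_closed) auto
  moreover have "0 \<in> Kset" using b closure_subset by (auto simp: Kset_def)
  ultimately obtain k where k: "k \<in> Kset" "\<And>k'. k' \<in> Kset \<Longrightarrow> k' \<le> k"
    using compact_attains_sup[of Kset] by (metis empty_iff)
  have k01: "0 \<le> k" "k \<le> 1" using k by (auto simp: Kset_def)
  have kin: "b + k *\<^sub>R (?R x - b) \<in> closure \<Omega>" if "x \<in> closure \<Omega>" "\<mu> \<le> x \<bullet> e" for x
    using k(1) that by (auto simp: Kset_def Cc_def)
  have "k \<noteq> 1" using kin bad by (auto simp: good_def)
  then have k1: "k < 1" using k01 by simp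
  define kn where "kn n = k + (1 - k) / real (n + 2)" for n :: nat
  have kn: "k < kn n" "kn n \<le> 1" "0 \<le> kn n" for n
  proof -
    show "k < kn n" using k1 by (simp add: kn_def)
    then show "0 \<le> kn n" using k01 by simp
    have "(1 - k) / real (n + 2) \<le> (1 - k) / 1" using k1 by (intro divide_left_mono) auto
    then show "kn n \<le> 1" by (simp add: kn_def)
  qed
  have "\<exists>x\<in>Cc. b + kn n *\<^sub>R (?R x - b) \<notin> closure \<Omega>" for n
  proof (rule ccontr)
    assume "\<not> ?thesis"
    then have "kn n \<in> Kset" using kn[of n] by (auto simp: Kset_def)
    then show False using k(2)[of "kn n"] kn(1)[of n] by simp
  qed
  then obtain X where X: "\<And>n. X n \<in> Cc" "\<And>n. b + kn n *\<^sub>R (?R (X n) - b) \<notin> closure \<Omega>" by metis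
  obtain x \<phi> where x: "x \<in> Cc" and \<phi>: "strict_mono (\<phi> :: nat \<Rightarrow> nat)" "(X \<circ> \<phi>) \<longlonglongrightarrow> x"
    using Cc X(1) unfolding compact_def by metis
  have xc: "x \<in> closure \<Omega>" "\<mu> \<le> x \<bullet> e" using x by (auto simp: Cc_def)
  define y where "y = b + k *\<^sub>R (?R x - b)"
  have "kn \<longlonglongrightarrow> k + 0"
    unfolding kn_def by (intro tendsto_add tendsto_const LIMSEQ_ignore_initial_segment[OF lim_const_over_n])
  then have knl: "(\<lambda>n. kn (\<phi> n)) \<longlonglongrightarrow> k" using LIMSEQ_subseq_LIMSEQ[OF _ \<phi>(1)] by (simp add: o_def)
  have "isCont ?R x" using continuous_on_hrefl[of UNIV e \<mu>] by (simp add: continuous_on_eq_continuous_at)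
  then have Rl: "(\<lambda>n. ?R (X (\<phi> n))) \<longlonglongrightarrow> ?R x" using isCont_tendsto_compose[OF _ \<phi>(2)] by (simp add: o_def)
  have lim: "(\<lambda>n. b + kn (\<phi> n) *\<^sub>R (?R (X (\<phi> n)) - b)) \<longlonglongrightarrow> y"
    unfolding y_def by (intro tendsto_intros knl Rl)
  have y: "y \<notin> \<Omega>"
  proof
    assume "y \<in> \<Omega>"
    with lim \<Omega>_open have "eventually (\<lambda>n. b + kn (\<phi> n) *\<^sub>R (?R (X (\<phi> n)) - b) \<in> \<Omega>) sequentially"
      by (rule topological_tendstoD)
    then obtain n where "b + kn (\<phi> n) *\<^sub>R (?R (X (\<phi> n)) - b) \<in> \<Omega>" by (auto simp: eventually_sequentially)
    then show False using X(2)[of "\<phi> n"] closure_subset by blast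
  qed
  have yf: "y \<in> frontier \<Omega>" using kin[OF xc] y by (intro frontierI) (auto simp: y_def)
  \<comment> \<open>A point on the plane is its own mirror image and is drawn into \<Omega> by k <
    1. Contact is therefore off the plane, and no corner case remains.\<close>
  have xe: "\<mu> < x \<bullet> e"
  proof (rule ccontr)
    assume "\<not> ?thesis"
    then have "?R x = x" using xc by (intro hrefl_fixed) simp
    then have "y \<in> \<Omega>" unfolding y_def using closure_shrink[OF b(1) xc(1) k01(1) k1] by simp
    then show False using y by simp
  qed
  \<comment> \<open>If x were in \<Omega>, it could be moved away from b by a factor 1 + t. Its
    image would still be in the closure, and contracting back by 1/(1 + t) would put y into
    \<Omega>.\<close>
  have xf: "x \<in> frontier \<Omega>"
  proof (rule frontierI[OF xc(1)], rule notI)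
    assume "x \<in> \<Omega>"
    define f where "f t = b + (1 + t) *\<^sub>R (x - b)" for t :: real
    have "(f \<longlongrightarrow> b + (1 + 0) *\<^sub>R (x - b)) (at_right 0)" unfolding f_def by (intro tendsto_intros)
    then have fl: "(f \<longlongrightarrow> x) (at_right 0)" by simp
    have ev1: "eventually (\<lambda>t. f t \<in> \<Omega>) (at_right 0)" using fl \<Omega>_open \<open>x \<in> \<Omega>\<close> by (rule topological_tendstoD)
    have "eventually (\<lambda>t. f t \<in> \<Omega> \<and> 0 < t) (at_right 0)" using ev1 eventually_at_right_less by (rule eventually_conj)
    then obtain t where t: "f t \<in> \<Omega>" "0 < t"
      using eventually_happens'[OF trivial_limit_at_right_real, of "\<lambda>t. f t \<in> \<Omega> \<and> 0 < t" 0] by blast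
    have "f t \<bullet> e = \<mu> + (1 + t) * (x \<bullet> e - \<mu>)" using b(2) by (simp add: f_def inner_add_left inner_diff_left)
    then have fe: "\<mu> \<le> f t \<bullet> e" using xe t by simp
    have Rf: "?R (f t) = b + (1 + t) *\<^sub>R (?R x - b)"
    proof -
      have "f t = dil b (inverse (1 + t)) x" by (simp add: dil_inverse_eq f_def)
      then show ?thesis using hrefl_dil[OF b(2), of "inverse (1 + t)" x] by (simp add: dil_inverse_eq)
    qed
    have "b + k *\<^sub>R (?R (f t) - b) \<in> closure \<Omega>" using t closure_subset fe by (intro kin) auto
    then have "b + (1 / (1 + t)) *\<^sub>R ((b + k *\<^sub>R (?R (f t) - b)) - b) \<in> \<Omega>" using t b by (intro closure_shrink) auto
    then have "y \<in> \<Omega>" using t by (simp add: Rf y_def)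
    then show False using y by simp
  qed
  show ?thesis using that[OF k01(1) k1 xf xe] yf kin unfolding y_def by blast
qed

end

section \<open>Geometry at the contact point\<close>

lemma hrefl_0_scaleR: "hrefl e 0 (c *\<^sub>R w) = c *\<^sub>R hrefl e 0 w"
  by (simp add: hrefl_def algebra_simps)

lemma norm_hrefl_0: "norm e = 1 \<Longrightarrow> norm (hrefl e 0 w) = norm w"
  using norm_hrefl_diff[of e 0 w 0] by (simp add: hrefl_def)

context overdetermined
begin

lemma norm_closure: "x \<in> closure \<Omega> \<Longrightarrow> norm x \<le> D"
proof -
  have "closure \<Omega> \<subseteq> cball 0 D"
    using \<Omega>_D ball_subset_cball by (intro closure_minimal) auto
  then show "x \<in> closure \<Omega> \<Longrightarrow> norm x \<le> D" by auto
qed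

lemma norm_diff_closure: "x \<in> closure \<Omega> \<Longrightarrow> y \<in> closure \<Omega> \<Longrightarrow> norm (x - y) \<le> 2 * D"
  using norm_closure[of x] norm_closure[of y] norm_triangle_ineq4[of x y] by linarith

text \<open>The contracted mirror image of the tangent ball at x is tangent at y and has radius k r;
  smaller balls tangent there lie inside it. This makes the equation of the copy available
  throughout the barrier ball.\<close>

lemma tangent_ball_pullback:
  assumes e: "norm e = 1" and b: "b \<bullet> e = \<mu>" and k: "0 < k" and y: "y = b + k *\<^sub>R (hrefl e \<mu> x - b)"
    and \<nu>: "norm \<nu> = 1" "ball (x + r *\<^sub>R \<nu>) r \<subseteq> \<Omega>" and \<rho>: "0 < \<rho>" "\<rho> \<le> k * r"
    and z: "z \<in> ball (y + \<rho> *\<^sub>R hrefl e 0 \<nu>) \<rho>"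
  shows "dil b k (hrefl e \<mu> z) \<in> \<Omega>"
proof -
  let ?R = "hrefl e \<mu>"
  define q where "q = y + \<rho> *\<^sub>R hrefl e 0 \<nu>"
  have "y = dil b (inverse k) (?R x)" by (simp add: y dil_inverse_eq)
  then have Ry: "dil b k (?R y) = x" using k e by (simp add: hrefl_dil[OF b] dil_inverse)
  have "?R q = ?R y + \<rho> *\<^sub>R \<nu>" unfolding q_def hrefl_affine by (simp add: hrefl_0_scaleR e)
  then have "dil b k (?R q) - dil b k (?R y) = (\<rho> / k) *\<^sub>R \<nu>" by (simp add: dil_diff divide_inverse mult.commute)
  then have Rq: "dil b k (?R q) = x + (\<rho> / k) *\<^sub>R \<nu>" by (simp add: Ry algebra_simps)
  have "norm (dil b k (?R q) - dil b k (?R z)) = norm (q - z) / k"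
    using k by (simp add: dil_diff norm_hrefl_diff[OF e] divide_inverse mult.commute)
  also have "\<dots> < \<rho> / k" using z k by (simp add: q_def[symmetric] dist_norm divide_strict_right_mono)
  finally have "dil b k (?R z) \<in> ball (x + (\<rho> / k) *\<^sub>R \<nu>) (\<rho> / k)" by (simp add: Rq dist_norm)
  moreover have "ball (x + (\<rho> / k) *\<^sub>R \<nu>) (\<rho> / k) \<subseteq> ball (x + r *\<^sub>R \<nu>) r"
    using \<nu> \<rho> k by (intro ball_subset_tangent) (auto simp: field_simps)
  ultimately show ?thesis using \<nu>(2) by blast
qed

text \<open>A small ball tangent at y inside the copy lies in the closure of \<Omega>, hence in the
  supporting half-space of \<Omega> at y; \<open>tangent_ball_normal_unique\<close> then identifies
  the two normals.\<close>

lemma contact_normal: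
  assumes e: "norm e = 1" and b: "b \<bullet> e = \<mu>" and k: "0 < k" and y: "y = b + k *\<^sub>R (hrefl e \<mu> x - b)"
    and x: "\<mu> < x \<bullet> e" "norm \<nu> = 1" "ball (x + r *\<^sub>R \<nu>) r \<subseteq> \<Omega>"
    and yf: "y \<in> frontier \<Omega>" "norm \<nu>' = 1" "ball (y + r *\<^sub>R \<nu>') r \<subseteq> \<Omega>"
    and inside: "\<And>x. x \<in> closure \<Omega> \<Longrightarrow> \<mu> \<le> x \<bullet> e \<Longrightarrow> b + k *\<^sub>R (hrefl e \<mu> x - b) \<in> closure \<Omega>"
  shows "\<nu>' = hrefl e 0 \<nu>"
proof -
  let ?R = "hrefl e \<mu>"
  \<comment> \<open>Only the copy of the cap is known to lie in the closure, so the ball must not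
    cross the plane. Its points are within 2 \<rho> of y, at most half the distance k (x \<bullet> e
    - \<mu>) of y from the plane.\<close>
  define \<rho> where "\<rho> = min (k * r) (k * (x \<bullet> e - \<mu>) / 4)"
  have \<rho>: "0 < \<rho>" "\<rho> \<le> k * r" "4 * \<rho> \<le> k * (x \<bullet> e - \<mu>)" using k r_pos x by (auto simp: \<rho>_def)
  have n: "norm (hrefl e 0 \<nu>) = 1" using x e by (simp add: norm_hrefl_0)
  have ye: "y \<bullet> e = \<mu> - k * (x \<bullet> e - \<mu>)"
  proof -
    have "y \<bullet> e = b \<bullet> e + k * (?R x \<bullet> e - b \<bullet> e)" by (simp add: y inner_add_left inner_diff_left)
    then show ?thesis by (simp add: b hrefl_inner[OF e] algebra_simps)
  qed
  show ?thesis
  proof (rule tangent_ball_normal_unique[OF yf(2) n \<rho>(1)])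
    fix z assume z: "z \<in> ball (y + \<rho> *\<^sub>R hrefl e 0 \<nu>) \<rho>"
    define w where "w = dil b k (?R z)"
    have "w \<in> \<Omega>" unfolding w_def by (rule tangent_ball_pullback[OF e b k y x(2,3) \<rho>(1,2) z])
    then have wc: "w \<in> closure \<Omega>" using closure_subset by blast
    have "norm (z - y) \<le> norm (z - (y + \<rho> *\<^sub>R hrefl e 0 \<nu>)) + norm (\<rho> *\<^sub>R hrefl e 0 \<nu>)"
      using norm_triangle_ineq[of "z - (y + \<rho> *\<^sub>R hrefl e 0 \<nu>)" "\<rho> *\<^sub>R hrefl e 0 \<nu>"] by simp
    also have "\<dots> < 2 * \<rho>" using z n \<rho> by (simp add: dist_norm norm_minus_commute)
    finally have "norm (z - y) < 2 * \<rho>" .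
    moreover have "(z - y) \<bullet> e \<le> norm (z - y) * norm e" by (rule norm_cauchy_schwarz)
    ultimately have "z \<bullet> e < y \<bullet> e + 2 * \<rho>" using e by (simp add: inner_diff_left)
    then have "z \<bullet> e \<le> \<mu>" using ye \<rho> by linarith
    then have "\<mu> \<le> w \<bullet> e" unfolding w_def dil_inner[OF b] using k by (simp add: hrefl_inner[OF e])
    from inside[OF wc this] have "b + k *\<^sub>R (?R w - b) \<in> closure \<Omega>" .
    moreover have "b + k *\<^sub>R (?R w - b) = z"
    proof -
      have "?R w = dil b k z" by (simp add: w_def hrefl_dil[OF b] e)
      then show ?thesis using k dil_inverse(2)[of k b z] by (simp add: dil_inverse_eq)
    qed
    ultimately have "z \<in> closure \<Omega>" by simp
    then show "0 \<le> (z - y) \<bullet> \<nu>'"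
      by (rule support_normal[OF \<Omega>_convex \<Omega>_open yf(1,2) r_pos yf(3)])
  qed
qed

text \<open>Two estimates of e \<bullet> \<nu>'. The step from \<open>?R x\<close> to y has depth at
  least (1 - k) r0 along \<nu>', while x lies in the supporting half-space at y; so 2 d e \<bullet>
  \<nu>' >= (1 - k) r0. On the other hand the normals are mirror images, so 2 e \<bullet> \<nu>' = e
  \<bullet> (\<nu>' - \<nu>) <= |y - x|/r, which is O(d + 1 - k).\<close>

lemma contact_gap:
  assumes e: "norm e = 1" and b: "b \<bullet> e = \<mu>" "ball b r0 \<subseteq> \<Omega>" "0 < r0" and k: "1 / 2 \<le> k" "k < 1"
    and y: "y = b + k *\<^sub>R (hrefl e \<mu> x - b)"
    and x: "x \<in> frontier \<Omega>" "\<mu> < x \<bullet> e" "norm \<nu> = 1" "ball (x + r *\<^sub>R \<nu>) r \<subseteq> \<Omega>"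
    and yf: "y \<in> frontier \<Omega>" "norm \<nu>' = 1" "ball (y + r *\<^sub>R \<nu>') r \<subseteq> \<Omega>"
    and \<nu>': "\<nu>' = hrefl e 0 \<nu>"
  shows "(1 - k) * r0 * r \<le> (x \<bullet> e - \<mu>) * (2 * (x \<bullet> e - \<mu>) + 4 * D * (1 - k))"
proof -
  let ?R = "hrefl e \<mu>"
  define d where "d = x \<bullet> e - \<mu>"
  have d: "d > 0" using x by (simp add: d_def)
  have Rx: "?R x = x - (2 * d) *\<^sub>R e" by (simp add: hrefl_def d_def)
  have xc: "x \<in> closure \<Omega>" and yc: "y \<in> closure \<Omega>" using x yf frontierD by auto
  have "b \<in> \<Omega>" using b by auto
  then have bc: "b \<in> closure \<Omega>" using closure_subset by blast
  \<comment> \<open>A point at distance r0 outward from b is still in the closure, so b has depth at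
    least r0 in the supporting half-space at y.\<close>
  have "b + (- r0) *\<^sub>R \<nu>' \<in> closure (ball b r0)" using b yf by (simp add: dist_norm)
  then have "b + (- r0) *\<^sub>R \<nu>' \<in> closure \<Omega>" using closure_mono[OF b(2)] by blast
  from support_normal[OF \<Omega>_convex \<Omega>_open yf(1,2) r_pos yf(3) this]
  have bn: "r0 \<le> (b - y) \<bullet> \<nu>'" using yf(2) by (simp add: inner_diff_left inner_add_left dot_square_norm)
  define c where "c = (1 - k) / k"
  have c: "0 \<le> c" "1 - k \<le> c" "c \<le> 2 * (1 - k)" 
  proof -
    show "0 \<le> c" using k by (simp add: c_def)
    have "(1 - k) / 1 \<le> (1 - k) / k" using k by (intro divide_left_mono) auto
    then show "1 - k \<le> c" by (simp add: c_def)
    have "(1 - k) / k \<le> (1 - k) / (1 / 2)" using k by (intro divide_left_mono) auto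
    then show "c \<le> 2 * (1 - k)" by (simp add: c_def)
  qed
  have xy: "?R x - y = c *\<^sub>R (y - b)"
  proof -
    have "y - b = k *\<^sub>R (?R x - b)" by (simp add: y)
    then have "c *\<^sub>R (y - b) = (1 - k) *\<^sub>R (?R x - b)" using k by (simp add: c_def)
    also have "\<dots> = ?R x - y" by (simp add: y algebra_simps)
    finally show ?thesis ..
  qed
  have Rxy: "(?R x - y) \<bullet> \<nu>' = - (c * ((b - y) \<bullet> \<nu>'))" "norm (?R x - y) = c * norm (y - b)"
    unfolding xy norm_scaleR abs_of_nonneg[OF c(1)] by (simp_all add: inner_diff_left algebra_simps)
  have "(1 - k) * r0 \<le> c * ((b - y) \<bullet> \<nu>')"
    using bn k b(3) c by (intro mult_mono) auto
  then have "(?R x - y) \<bullet> \<nu>' \<le> - ((1 - k) * r0)" using Rxy by simp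
  moreover have "(?R x - y) \<bullet> \<nu>' = (x - y) \<bullet> \<nu>' - 2 * d * (e \<bullet> \<nu>')" by (simp add: Rx inner_diff_left)
  moreover have "0 \<le> (x - y) \<bullet> \<nu>'" by (rule support_normal[OF \<Omega>_convex \<Omega>_open yf(1,2) r_pos yf(3) xc])
  ultimately have 1: "(1 - k) * r0 \<le> d * (2 * (e \<bullet> \<nu>'))" by linarith
  have "e \<bullet> \<nu>' = - (e \<bullet> \<nu>)"
    using hrefl_inner[OF e, of 0 \<nu>] by (simp add: \<nu>' inner_commute)
  then have "2 * (e \<bullet> \<nu>') = e \<bullet> (\<nu>' - \<nu>)" by (simp add: inner_diff_right)
  also have "\<dots> \<le> norm e * norm (\<nu>' - \<nu>)" by (rule norm_cauchy_schwarz)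
  finally have "r * (2 * (e \<bullet> \<nu>')) \<le> r * norm (\<nu>' - \<nu>)" using e r_pos by simp
  also have "\<dots> \<le> norm (y - x)" by (rule normal_lipschitz[OF \<Omega>_convex \<Omega>_open r_pos yf x(1,3,4)])
  also have "\<dots> \<le> norm (?R x - y) + norm (?R x - x)"
    using norm_triangle_ineq4[of "?R x - x" "?R x - y"] by (simp add: add.commute)
  also have "norm (?R x - x) = 2 * d" using e d by (simp add: Rx)
  also have "norm (?R x - y) \<le> (2 * (1 - k)) * (2 * D)"
    unfolding Rxy(2) using k c norm_diff_closure[OF yc bc] by (intro mult_mono) auto
  finally have 2: "r * (2 * (e \<bullet> \<nu>')) \<le> 2 * d + 4 * D * (1 - k)" by (simp add: algebra_simps)
  have "(1 - k) * r0 * r \<le> d * (2 * (e \<bullet> \<nu>')) * r" using 1 r_pos by (intro mult_right_mono) auto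
  also have "\<dots> = d * (r * (2 * (e \<bullet> \<nu>')))" by simp
  also have "\<dots> \<le> d * (2 * d + 4 * D * (1 - k))" using 2 d by (intro mult_left_mono) auto
  finally show ?thesis by (simp add: d_def)
qed

text \<open>Since the plane at m is good, the mirror image at \<mu> is within 2(m - \<mu>) of the
  closure. If that error is small against (1 - k) r0, moving the centre b within its ball
  compensates it, and the image lies in \<Omega>. Hence k tends to 1 at the critical plane.\<close>

lemma contact_ratio:
  assumes e: "norm e = 1" and g: "good e m" and \<mu>: "\<mu> \<le> m" and b: "ball b r0 \<subseteq> \<Omega>" "0 < r0" and k: "0 \<le> k" "k < 1"
    and x: "x \<in> closure \<Omega>" "\<mu> \<le> x \<bullet> e" and y: "b + k *\<^sub>R (hrefl e \<mu> x - b) \<notin> \<Omega>"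
  shows "(1 - k) * r0 \<le> 2 * (m - \<mu>)"
proof (rule ccontr)
  assume "\<not> ?thesis"
  then have lt: "2 * (m - \<mu>) < (1 - k) * r0" by simp
  obtain w where w: "w \<in> closure \<Omega>" "norm (hrefl e \<mu> x - w) \<le> 2 * (m - \<mu>)"
  proof (cases "m \<le> x \<bullet> e")
    case True
    have "hrefl e \<mu> x - hrefl e m x = (- 2 * (m - \<mu>)) *\<^sub>R e" by (simp add: hrefl_def algebra_simps)
    then have "norm (hrefl e \<mu> x - hrefl e m x) = 2 * (m - \<mu>)" using e \<mu> by simp
    then show ?thesis using that[of "hrefl e m x"] g x True by (simp add: good_def)
  next
    case False
    have "hrefl e \<mu> x - x = (- 2 * (x \<bullet> e - \<mu>)) *\<^sub>R e" by (simp add: hrefl_def algebra_simps)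
    then have "norm (hrefl e \<mu> x - x) = 2 * (x \<bullet> e - \<mu>)" using e x by simp
    then show ?thesis using that[of x] x False by simp
  qed
  \<comment> \<open>c solves (1 - k) c + k w = (1 - k) b + k hrefl e \<mu> x, so contracting w
    towards c yields the same point.\<close>
  define c where "c = b + (k / (1 - k)) *\<^sub>R (hrefl e \<mu> x - w)"
  have "norm ((k / (1 - k)) *\<^sub>R (hrefl e \<mu> x - w)) = (k * norm (hrefl e \<mu> x - w)) / (1 - k)" using k by simp
  also have "\<dots> \<le> (1 * norm (hrefl e \<mu> x - w)) / (1 - k)" using k by (intro divide_right_mono mult_right_mono) auto
  also have "\<dots> < r0" using k w lt by (simp add: field_simps)
  finally have "c \<in> \<Omega>" using b by (auto simp: c_def dist_norm)
  from closure_shrink[OF this w(1) k] have "c + k *\<^sub>R (w - c) \<in> \<Omega>" .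
  moreover have "c + k *\<^sub>R (w - c) = b + k *\<^sub>R (hrefl e \<mu> x - b)"
  proof -
    have "(1 - k) *\<^sub>R c = (1 - k) *\<^sub>R b + k *\<^sub>R (hrefl e \<mu> x - w)" using k by (simp add: c_def scaleR_add_right)
    moreover have "c + k *\<^sub>R (w - c) = (1 - k) *\<^sub>R c + k *\<^sub>R w" by (simp add: algebra_simps)
    ultimately show ?thesis by (simp add: algebra_simps)
  qed
  ultimately show False using y by simp
qed

section \<open>Boundary trace and approach to the critical plane\<close>

lemma trace_normal:
  assumes y: "y \<in> frontier \<Omega>" "norm \<nu> = 1" "ball (y + r *\<^sub>R \<nu>) r \<subseteq> \<Omega>"
  shows "((\<lambda>\<sigma>. u (y + \<sigma> *\<^sub>R \<nu>) / \<sigma> powr s) \<longlongrightarrow> C0) (at_right 0)"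
proof -
  have mem: "y + \<sigma> *\<^sub>R \<nu> \<in> \<Omega>" if "0 < \<sigma>" "\<sigma> < r" for \<sigma>
  proof -
    have "dist (y + r *\<^sub>R \<nu>) (y + \<sigma> *\<^sub>R \<nu>) = r - \<sigma>"
      using that y by (simp add: dist_norm flip: scaleR_left_diff_distrib)
    then show ?thesis using y(3) that by (auto simp: mem_ball)
  qed
  have small: "eventually (\<lambda>\<sigma>. \<sigma> \<in> {0<..<r}) (at_right 0)" using r_pos by (rule eventually_at_right_real)
  have "filterlim (\<lambda>\<sigma>. y + \<sigma> *\<^sub>R \<nu>) (at y within \<Omega>) (at_right 0)"
    unfolding filterlim_at
  proof (intro conjI)
    have "((\<lambda>\<sigma>. y + \<sigma> *\<^sub>R \<nu>) \<longlongrightarrow> y + 0 *\<^sub>R \<nu>) (at_right 0)" by (intro tendsto_intros)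
    then show "((\<lambda>\<sigma>. y + \<sigma> *\<^sub>R \<nu>) \<longlongrightarrow> y) (at_right 0)" by simp
  next
    show "eventually (\<lambda>\<sigma>. y + \<sigma> *\<^sub>R \<nu> \<in> \<Omega> \<and> y + \<sigma> *\<^sub>R \<nu> \<noteq> y) (at_right 0)"
      using small by eventually_elim (use mem y in auto)
  qed
  from filterlim_compose[OF trace[OF y(1)] this]
  have "((\<lambda>\<sigma>. u (y + \<sigma> *\<^sub>R \<nu>) / bdist \<Omega> (y + \<sigma> *\<^sub>R \<nu>) powr s) \<longlongrightarrow> C0) (at_right 0)" .
  moreover have "eventually (\<lambda>\<sigma>. u (y + \<sigma> *\<^sub>R \<nu>) / bdist \<Omega> (y + \<sigma> *\<^sub>R \<nu>) powr s = u (y + \<sigma> *\<^sub>R \<nu>) / \<sigma> powr s) (at_right 0)"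
    using small by eventually_elim (use bdist_normal[OF \<Omega>_open y] in auto)
  ultimately show ?thesis by (rule Lim_transform_eventually)
qed

lemma u_uniformly_continuous:
  assumes "0 < \<eta>"
  obtains \<delta> where "0 < \<delta>" "\<And>a b. norm (a - b) < \<delta> \<Longrightarrow> \<bar>u a - u b\<bar> < \<eta>"
proof -
  have "uniformly_continuous_on (cball 0 (D + 1)) u"
    using u_cont continuous_on_subset by (intro compact_uniformly_continuous) auto
  then obtain d where d: "d > 0" "\<And>a b. a \<in> cball 0 (D + 1) \<Longrightarrow> b \<in> cball 0 (D + 1) \<Longrightarrow> dist b a < d \<Longrightarrow> dist (u b) (u a) < \<eta>"
    using assms unfolding uniformly_continuous_on_def by metis
  have "\<bar>u a - u b\<bar> < \<eta>" if "norm (a - b) < min d 1" for a b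
  proof (cases "a \<in> \<Omega> \<or> b \<in> \<Omega>")
    case True
    then have "norm a < D \<or> norm b < D" using norm_\<Omega> by blast
    then have "norm a \<le> D + 1" "norm b \<le> D + 1"
      using that norm_triangle_ineq2[of a b] norm_triangle_ineq2[of b a] by (auto simp: norm_minus_commute)
    then show ?thesis using d(2)[of b a] that by (auto simp: dist_norm)
  next
    case False
    then show ?thesis using u_outside assms by simp
  qed
  then show ?thesis using that[of "min d 1"] d(1) by simp
qed

lemma perturbed_reflection_close:
  assumes e: "norm e = 1" and b: "b \<in> \<Omega>" "b \<bullet> e = \<mu>" and k: "1 / 2 \<le> k" "k < 1" and \<mu>: "\<mu> \<le> m"
  shows "norm (dil b k (hrefl e \<mu> z) - hrefl e m z) \<le> 2 * (m - \<mu>) + 2 * (1 - k) * (norm z + D)"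
proof -
  have "dil b k (hrefl e \<mu> z) - hrefl e \<mu> z = (inverse k - 1) *\<^sub>R (hrefl e \<mu> z - b)"
    by (simp add: dil_def algebra_simps)
  then have "norm (dil b k (hrefl e \<mu> z) - hrefl e \<mu> z) = \<bar>inverse k - 1\<bar> * norm (hrefl e \<mu> z - hrefl e \<mu> b)"
    by (simp add: hrefl_fixed[OF b(2)])
  also have "\<dots> \<le> (2 * (1 - k)) * (norm z + D)"
  proof (rule mult_mono)
    have "inverse k - 1 = (1 - k) / k" using k by (simp add: field_simps)
    also have "\<dots> \<le> (1 - k) / (1 / 2)" using k by (intro divide_left_mono) auto
    finally show "\<bar>inverse k - 1\<bar> \<le> 2 * (1 - k)" using k by (simp add: field_simps)
    show "norm (hrefl e \<mu> z - hrefl e \<mu> b) \<le> norm z + D"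
      unfolding norm_hrefl_diff[OF e] using norm_triangle_ineq4[of z b] norm_\<Omega>[OF b(1)] by simp
  qed (use k in auto)
  finally have 1: "norm (dil b k (hrefl e \<mu> z) - hrefl e \<mu> z) \<le> 2 * (1 - k) * (norm z + D)" .
  have "hrefl e \<mu> z - hrefl e m z = (- 2 * (m - \<mu>)) *\<^sub>R e" by (simp add: hrefl_def algebra_simps)
  then have 2: "norm (hrefl e \<mu> z - hrefl e m z) = 2 * (m - \<mu>)" using e \<mu> by simp
  have "dil b k (hrefl e \<mu> z) - hrefl e m z = (dil b k (hrefl e \<mu> z) - hrefl e \<mu> z) + (hrefl e \<mu> z - hrefl e m z)" by simp
  then show ?thesis using norm_triangle_ineq[of "dil b k (hrefl e \<mu> z) - hrefl e \<mu> z" "hrefl e \<mu> z - hrefl e m z"] 1 2 by simp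
qed

text \<open>A limit of the perturbed comparisons gives the inequality between u and its critical
  mirror image. If it is strict somewhere, constants are fixed in the order c1 and Q, cs, \<eta>,
  d1, and the plane last. None of them depends on the contact point, so its unknown distance d can
  be treated by the cases d <= d1 and d > d1.\<close>

lemma reflection_symmetric:
  assumes e: "norm e = 1"
  shows "\<exists>m. \<forall>z. u (hrefl e m z) = u z"
proof -
  obtain m bs where gm: "good e m" and bs: "bs \<in> \<Omega>" "bs \<bullet> e = m"
    and bad: "\<And>\<epsilon>. 0 < \<epsilon> \<Longrightarrow> \<exists>\<mu>. m - \<epsilon> < \<mu> \<and> \<mu> < m \<and> \<not> good e \<mu>"
    using critical_plane[OF e] by blast
  have ee: "e \<bullet> e = 1" using e by (simp add: dot_square_norm)
  obtain r1 where r1: "r1 > 0" "ball bs r1 \<subseteq> \<Omega>" using bs(1) \<Omega>_open openE by blast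
  \<comment> \<open>Half the radius, so that the same r0 serves all centres b within r0 of
    bs.\<close>
  define r0 where "r0 = r1 / 2"
  have r0: "r0 > 0" using r1 by (simp add: r0_def)
  \<comment> \<open>Chosen so that 1 - k <= 2 \<epsilon>m/r0 implies both k > 1/2 and Ca (1 - k) <
    1/2, as the comparison requires.\<close>
  define \<epsilon>m where "\<epsilon>m = r0 / (8 * (1 + Ca))"
  have \<epsilon>m: "\<epsilon>m > 0" "\<epsilon>m \<le> r0" "2 * \<epsilon>m / r0 \<le> 1 / 4" "Ca * (2 * \<epsilon>m / r0) \<le> 1 / 4"
  proof -
    have pos: "0 < 1 + Ca" using Ca_nonneg by simp
    show "\<epsilon>m > 0" using r0 pos by (simp add: \<epsilon>m_def)
    have "r0 / (8 * (1 + Ca)) \<le> r0 / 1" using r0 Ca_nonneg by (intro divide_left_mono) auto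
    then show "\<epsilon>m \<le> r0" by (simp add: \<epsilon>m_def)
    have eq: "2 * \<epsilon>m / r0 = 1 / (4 * (1 + Ca))" 
    proof -
      have "2 * (r0 / (8 * t)) / r0 = 1 / (4 * t)" for t using r0 by simp
      from this[of "1 + Ca"] show ?thesis by (simp only: \<epsilon>m_def)
    qed
    show "2 * \<epsilon>m / r0 \<le> 1 / 4" unfolding eq using Ca_nonneg by (intro frac_le) auto
    have "Ca * (1 / (4 * (1 + Ca))) = (Ca / (1 + Ca)) / 4" by simp
    also have "\<dots> \<le> 1 / 4" using pos by (intro divide_right_mono) (auto simp: divide_le_eq)
    finally show "Ca * (2 * \<epsilon>m / r0) \<le> 1 / 4" unfolding eq .
  qed
  have data: "\<exists>\<mu> b k x. m - \<epsilon> < \<mu> \<and> \<mu> < m \<and> b \<in> \<Omega> \<and> b \<bullet> e = \<mu> \<and> ball b r0 \<subseteq> \<Omega> \<and> 1 / 2 < k \<and> k < 1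
      \<and> Ca * (1 - k) < 1 / 2 \<and> (1 - k) \<le> 2 * \<epsilon> / r0 \<and> x \<in> frontier \<Omega> \<and> \<mu> < x \<bullet> e \<and> b + k *\<^sub>R (hrefl e \<mu> x - b) \<in> frontier \<Omega>
      \<and> (\<forall>x. x \<in> closure \<Omega> \<longrightarrow> \<mu> \<le> x \<bullet> e \<longrightarrow> b + k *\<^sub>R (hrefl e \<mu> x - b) \<in> closure \<Omega>)"
    if \<epsilon>: "0 < \<epsilon>" "\<epsilon> \<le> \<epsilon>m" for \<epsilon>
  proof -
    obtain \<mu> where \<mu>: "m - \<epsilon> < \<mu>" "\<mu> < m" "\<not> good e \<mu>" using bad[OF \<epsilon>(1)] by blast
    define b where "b = bs - (m - \<mu>) *\<^sub>R e"
    have be: "b \<bullet> e = \<mu>" by (simp add: b_def inner_diff_left bs ee)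
    have "dist bs b < r0" using e \<mu> \<epsilon> \<epsilon>m by (simp add: b_def dist_norm)
    have bb: "ball b r0 \<subseteq> \<Omega>"
    proof
      fix w assume "w \<in> ball b r0"
      then have "dist bs w < r1" using dist_triangle[of bs w b] \<open>dist bs b < r0\<close> by (simp add: r0_def)
      then show "w \<in> \<Omega>" using r1 by auto
    qed
    then have b: "b \<in> \<Omega>" using r0 by auto
    obtain k x where kx: "0 \<le> k" "k < 1" "x \<in> frontier \<Omega>" "\<mu> < x \<bullet> e" "b + k *\<^sub>R (hrefl e \<mu> x - b) \<in> frontier \<Omega>"
      "\<And>x. x \<in> closure \<Omega> \<Longrightarrow> \<mu> \<le> x \<bullet> e \<Longrightarrow> b + k *\<^sub>R (hrefl e \<mu> x - b) \<in> closure \<Omega>"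
      using contact_point[OF e \<mu>(3) b be] by blast
    have "(1 - k) * r0 \<le> 2 * (m - \<mu>)"
      using frontierD kx \<mu> by (intro contact_ratio[OF e gm _ bb r0 kx(1,2)]) auto
    also have "\<dots> \<le> 2 * \<epsilon>" using \<mu> by simp
    finally have \<kappa>: "1 - k \<le> 2 * \<epsilon> / r0" using r0 by (simp add: field_simps)
    also have "\<dots> \<le> 2 * \<epsilon>m / r0" using \<epsilon> r0 by (intro divide_right_mono) auto
    finally have \<kappa>m: "1 - k \<le> 2 * \<epsilon>m / r0" .
    then have k2: "1 / 2 < k" using \<epsilon>m(3) by linarith
    have "Ca * (1 - k) \<le> Ca * (2 * \<epsilon>m / r0)" using \<kappa>m Ca_nonneg by (rule mult_left_mono)
    then have Ck: "Ca * (1 - k) < 1 / 2" using \<epsilon>m(4) by linarith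
    show ?thesis using \<mu> b be bb k2 Ck \<kappa> kx by blast
  qed
  have le: "u (hrefl e m z) \<le> u z" if z: "z \<bullet> e < m" for z
  proof (rule ccontr)
    assume gt: "\<not> ?thesis"
    define \<eta> where "\<eta> = (u (hrefl e m z) - u z) / 2"
    have \<eta>: "\<eta> > 0" using gt by (simp add: \<eta>_def)
    obtain \<delta> where \<delta>: "0 < \<delta>" "\<And>a b. norm (a - b) < \<delta> \<Longrightarrow> \<bar>u a - u b\<bar> < \<eta>" using u_uniformly_continuous[OF \<eta>] by blast
    \<comment> \<open>The arguments of the perturbed and the critical copy differ by at most
      \<epsilon> X, and the perturbed copy exceeds u z by at most \<epsilon> Y.\<close>
    define X where "X = 2 + (4 / r0) * (norm z + D)"
    define Y where "Y = 12 * Ca * M / r0 + 1"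
    have X: "X > 0" using r0 D_pos by (simp add: X_def add_pos_nonneg)
    have Y: "Y > 0" using r0 Ca_nonneg M_nonneg by (simp add: Y_def add_nonneg_pos)
    define \<epsilon> where "\<epsilon> = min (min \<epsilon>m (m - z \<bullet> e)) (min (\<delta> / (2 * X)) (\<eta> / Y))"
    have \<epsilon>: "0 < \<epsilon>" "\<epsilon> \<le> \<epsilon>m" "\<epsilon> \<le> m - z \<bullet> e" "\<epsilon> \<le> \<delta> / (2 * X)" "\<epsilon> \<le> \<eta> / Y"
      using \<epsilon>m z \<delta> \<eta> X Y by (auto simp: \<epsilon>_def)
    have \<epsilon>X: "\<epsilon> * X < \<delta>" "\<epsilon> * Y \<le> \<eta>" using \<epsilon>(4,5) X Y \<delta>(1) by (auto simp: field_simps)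
    obtain \<mu> b k x where \<mu>: "m - \<epsilon> < \<mu>" "\<mu> < m" and b: "b \<in> \<Omega>" "b \<bullet> e = \<mu>" and k: "1 / 2 < k" "k < 1" "Ca * (1 - k) < 1 / 2"
      and \<kappa>: "1 - k \<le> 2 * \<epsilon> / r0"
      and inside: "\<forall>x. x \<in> closure \<Omega> \<longrightarrow> \<mu> \<le> x \<bullet> e \<longrightarrow> b + k *\<^sub>R (hrefl e \<mu> x - b) \<in> closure \<Omega>"
      using data[OF \<epsilon>(1,2)] by blast
    have "norm (dil b k (hrefl e \<mu> z) - hrefl e m z) \<le> 2 * (m - \<mu>) + 2 * (1 - k) * (norm z + D)"
      using k \<mu> by (intro perturbed_reflection_close[OF e b]) auto
    also have "\<dots> \<le> 2 * \<epsilon> + 2 * (2 * \<epsilon> / r0) * (norm z + D)"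
      using \<mu> \<kappa> D_pos by (intro add_mono mult_right_mono) auto
    also have "\<dots> = \<epsilon> * X" by (simp add: X_def algebra_simps)
    finally have "norm (dil b k (hrefl e \<mu> z) - hrefl e m z) < \<delta>" using \<epsilon>X by simp
    from \<delta>(2)[OF this] have 1: "u (hrefl e m z) < u (dil b k (hrefl e \<mu> z)) + \<eta>" by linarith
    have "z \<bullet> e \<le> \<mu>" using \<epsilon>(3) \<mu> by simp
    then have "u (dil b k (hrefl e \<mu> z)) \<le> (1 + 6 * (Ca * (1 - k))) * u z"
      using inside by (intro hrefl_dil_le[OF e b k]) auto
    also have "\<dots> = u z + 6 * Ca * ((1 - k) * u z)" by (simp add: algebra_simps)
    also have "\<dots> \<le> u z + 6 * Ca * ((2 * \<epsilon> / r0) * M)"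
      using Ca_nonneg \<kappa> u_le[of z] u_nonneg[of z] k \<epsilon>(1) r0 by (intro add_left_mono mult_left_mono mult_mono) auto
    also have "\<dots> \<le> u z + \<epsilon> * Y" using \<epsilon>(1) by (simp add: Y_def algebra_simps)
    also have "\<dots> \<le> u z + \<eta>" using \<epsilon>X by simp
    finally have "u (dil b k (hrefl e \<mu> z)) \<le> u z + \<eta>" .
    moreover have "u (hrefl e m z) - u z = 2 * \<eta>" by (simp add: \<eta>_def)
    ultimately show False using 1 by linarith
  qed
  have "u (hrefl e m z) = u z" for z
  proof (rule ccontr)
    assume ne: "u (hrefl e m z) \<noteq> u z"
    \<comment> \<open>Of z and its mirror image one lies below the plane, where the inequality just
      proved is then strict.\<close>
    obtain z1 where z1: "z1 \<bullet> e < m" "u (hrefl e m z1) < u z1"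
    proof (cases "z \<bullet> e < m")
      case True
      then show ?thesis using that[of z] le[OF True] ne by simp
    next
      case False
      have "z \<bullet> e \<noteq> m" using ne hrefl_fixed by metis
      then have lt: "hrefl e m z \<bullet> e < m" using False by (simp add: hrefl_inner[OF e])
      show ?thesis using that[OF lt] le[OF lt] ne e by simp
    qed
    have "u z1 > 0" using z1(2) u_nonneg[of "hrefl e m z1"] by linarith
    then have z1\<Omega>: "z1 \<in> \<Omega>" using u_outside by force
    \<comment> \<open>The gap at z1 is 4 c1; 2 c1 survives on Q, and c1 after the critical
      reflection is replaced by the perturbed one.\<close>
    define c1 where "c1 = (u z1 - u (hrefl e m z1)) / 4"
    have c1: "c1 > 0" using z1 by (simp add: c1_def)
    obtain \<delta> where \<delta>: "0 < \<delta>" "\<And>a b. norm (a - b) < \<delta> \<Longrightarrow> \<bar>u a - u b\<bar> < c1" using u_uniformly_continuous[OF c1] by blast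
    obtain \<delta>1 where \<delta>1: "\<delta>1 > 0" "ball z1 \<delta>1 \<subseteq> \<Omega>" using z1\<Omega> \<Omega>_open openE by blast
    define dQ where "dQ = (m - z1 \<bullet> e) / 4"
    have dQ: "dQ > 0" using z1 by (simp add: dQ_def)
    \<comment> \<open>Q keeps distance 2 rq from the boundary, which leaves room for the barrier
      ball touching it, and lies 2 dQ below the critical plane, hence at least dQ below the shifted
      one.\<close>
    define rq where "rq = min (\<delta>1 / 3) (min (\<delta> / 2) (2 * dQ))"
    have rq: "rq > 0" "3 * rq \<le> \<delta>1" "rq < \<delta>" "rq \<le> 2 * dQ" using \<delta>1 \<delta> dQ by (auto simp: rq_def)
    define Q where "Q = cball z1 rq"
    have Q\<Omega>: "Q \<subseteq> \<Omega>" using rq \<delta>1 by (fastforce simp: Q_def)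
    have QW: "2 * c1 \<le> u w - u (hrefl e m w)" if "w \<in> Q" for w
    proof -
      have n: "norm (w - z1) < \<delta>" using that rq by (simp add: Q_def dist_norm norm_minus_commute)
      then have "\<bar>u w - u z1\<bar> < c1" "\<bar>u (hrefl e m w) - u (hrefl e m z1)\<bar> < c1"
        using \<delta>(2) by (auto simp: norm_hrefl_diff[OF e])
      moreover have "u z1 - u (hrefl e m z1) = 4 * c1" by (simp add: c1_def)
      ultimately show ?thesis by linarith
    qed
    have Qe: "w \<bullet> e \<le> m - 2 * dQ" if "w \<in> Q" for w
    proof -
      have "(w - z1) \<bullet> e \<le> norm (w - z1) * norm e" by (rule norm_cauchy_schwarz)
      also have "\<dots> \<le> 2 * dQ" using that rq e by (simp add: Q_def dist_norm norm_minus_commute)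
      finally have "w \<bullet> e - z1 \<bullet> e \<le> 2 * dQ" by (simp add: inner_diff_left)
      moreover have "m - z1 \<bullet> e = 4 * dQ" by (simp add: dQ_def)
      ultimately show ?thesis by linarith
    qed
    have Qfar: "2 * rq \<le> dist w y" if "w \<in> Q" "y \<in> frontier \<Omega>" for w y
    proof -
      have "y \<notin> ball z1 \<delta>1" using that(2) frontierD \<delta>1 by blast
      then have "3 * rq \<le> dist z1 y" using rq by simp
      then show ?thesis using that(1) dist_triangle[of z1 y w] by (simp add: Q_def)
    qed
    define mQ where "mQ = measure lborel Q"
    have mQ: "mQ > 0" unfolding mQ_def Q_def using content_cball_pos[OF rq(1)] .
    define \<alpha> where "\<alpha> = (real DIM('a) + 2 * s) / 2"
    define ca where "ca = 4 * \<alpha> / ((5 * D)\<^sup>2) powr (\<alpha> + 1)"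
    have ca: "ca > 0" using s D_pos by (simp add: ca_def \<alpha>_def add_nonneg_pos)
    \<comment> \<open>With h = d/4 the gain in \<open>hopf_lower\<close> becomes G0 d.\<close>
    define G0 where "G0 = c1 * ca * dQ * mQ / 4"
    have G0: "G0 > 0" using c1 ca dQ mQ by (simp add: G0_def)
    define BV where "BV = annulus_mass TYPE('a) * (3 / s + 1 / (1 - s)) / (2 * ln 2) + unit_ball_vol (real DIM('a))"
    have BV: "BV \<ge> 0" using s annulus_mass_nonneg[where 'a='a] by (simp add: BV_def)
    \<comment> \<open>For \<rho> = \<rho>0 d and d <= 2D: \<rho> <= d/8 keeps the ball d/4 below the
      plane, \<rho> <= r/4 fits it into the tangent balls of \<Omega> and of the copy, and 2 \<rho>
      <= rq separates it from Q.\<close>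
    define \<rho>0 where "\<rho>0 = min (1 / 8) (min (r / (8 * D)) (rq / (4 * D)))"
    have \<rho>0: "0 < \<rho>0" "\<rho>0 \<le> 1 / 8" "\<rho>0 \<le> r / (8 * D)" "\<rho>0 \<le> rq / (4 * D)"
      using r_pos rq D_pos by (auto simp: \<rho>0_def)
    \<comment> \<open>\<open>A * \<rho> powr s\<close> will equal cs d^(1+s), with one power of d
      from A and s powers from \<rho>; BV + 1 avoids a zero denominator.\<close>
    define cs where "cs = G0 / (4 * (BV + 1)) * \<rho>0 powr s"
    have cs: "cs > 0" using G0 BV \<rho>0 by (simp add: cs_def)
    \<comment> \<open>X1 controls the limit given by the boundary condition and X2 the error of the
      equation; the added 1 makes them positive.\<close>
    define X1 where "X1 = \<bar>C0\<bar> * (6 * Ca + 8) + 1"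
    define X2 where "X2 = 32 * lam * (1 + M) / cN * (2 * D) powr s + 1"
    have X1: "X1 > 0" using Ca_nonneg by (simp add: X1_def add_nonneg_pos)
    have X2: "X2 > 0" using lam_nonneg M_nonneg cN_pos by (simp add: X2_def add_nonneg_pos)
    \<comment> \<open>The smallness wanted in 1 - k <= \<eta> d^(1+s): the boundary limit must stay
      strictly below cs d^(1+s) and the error of the equation below a quarter of the gain.\<close>
    define \<eta> where "\<eta> = min (cs / (2 * X1)) (G0 / (4 * X2))"
    have \<eta>: "\<eta> > 0" "\<eta> * X1 < cs" "\<eta> * X2 \<le> G0 / 4"
    proof -
      show "\<eta> > 0" using cs X1 X2 G0 by (simp add: \<eta>_def)
      have "\<eta> * X1 \<le> cs / (2 * X1) * X1" using X1 by (intro mult_right_mono) (auto simp: \<eta>_def)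
      also have "\<dots> < cs" using X1 cs by simp
      finally show "\<eta> * X1 < cs" .
      have "\<eta> * X2 \<le> G0 / (4 * X2) * X2" using X2 by (intro mult_right_mono) (auto simp: \<eta>_def)
      then show "\<eta> * X2 \<le> G0 / 4" using X2 by simp
    qed
    \<comment> \<open>For d <= d1 the mixed term 4 D d (1 - k) of \<open>contact_gap\<close> is
      absorbed, leaving (1 - k) r0 r <= 4 d^2, and d^(1-s) is small enough to turn d^2 into a
      multiple of \<eta> d^(1+s).\<close>
    define d1 where "d1 = min (r0 * r / (8 * D)) ((\<eta> * r0 * r / 4) powr (1 / (1 - s)))"
    have d1: "d1 > 0" "4 * D * d1 \<le> r0 * r / 2" "d1 powr (1 - s) \<le> \<eta> * r0 * r / 4"
    proof -
      show d1p: "d1 > 0" using r0 r_pos D_pos \<eta> by (simp add: d1_def)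
      have "d1 \<le> r0 * r / (8 * D)" by (simp add: d1_def)
      then show "4 * D * d1 \<le> r0 * r / 2" using D_pos by (simp add: field_simps)
      have "d1 powr (1 - s) \<le> ((\<eta> * r0 * r / 4) powr (1 / (1 - s))) powr (1 - s)"
        using d1p s by (intro powr_mono2) (auto simp: d1_def)
      also have "\<dots> = \<eta> * r0 * r / 4" using s \<eta> r0 r_pos by (simp add: powr_powr)
      finally show "d1 powr (1 - s) \<le> \<eta> * r0 * r / 4" .
    qed
    define X3 where "X3 = 2 + (4 / r0) * (2 * D)"
    have X3: "X3 > 0" using r0 D_pos by (simp add: X3_def add_pos_pos)
    \<comment> \<open>The plane comes last, so close to m that 1 - k <= \<eta> d1^(1+s); this
      settles every contact with d > d1.\<close>
    define \<epsilon> where "\<epsilon> = min (min \<epsilon>m dQ) (min (\<delta> / (2 * X3)) (\<eta> * d1 powr (1 + s) * r0 / 2))"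
    have \<epsilon>: "0 < \<epsilon>" "\<epsilon> \<le> \<epsilon>m" "\<epsilon> \<le> dQ" "\<epsilon> \<le> \<delta> / (2 * X3)" "\<epsilon> \<le> \<eta> * d1 powr (1 + s) * r0 / 2"
      using \<epsilon>m dQ \<delta> X3 \<eta> d1 r0 by (auto simp: \<epsilon>_def)
    have \<epsilon>X: "\<epsilon> * X3 < \<delta>" "2 * \<epsilon> / r0 \<le> \<eta> * d1 powr (1 + s)"
      using \<epsilon>(4,5) X3 \<delta>(1) r0 by (auto simp: field_simps)
    obtain \<mu> b k x where \<mu>: "m - \<epsilon> < \<mu>" "\<mu> < m" and b: "b \<in> \<Omega>" "b \<bullet> e = \<mu>" and bb: "ball b r0 \<subseteq> \<Omega>"
      and k: "1 / 2 < k" "k < 1" "Ca * (1 - k) < 1 / 2" and \<kappa>: "1 - k \<le> 2 * \<epsilon> / r0"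
      and x: "x \<in> frontier \<Omega>" "\<mu> < x \<bullet> e" and yf: "b + k *\<^sub>R (hrefl e \<mu> x - b) \<in> frontier \<Omega>"
      and inside: "\<forall>x. x \<in> closure \<Omega> \<longrightarrow> \<mu> \<le> x \<bullet> e \<longrightarrow> b + k *\<^sub>R (hrefl e \<mu> x - b) \<in> closure \<Omega>"
      using data[OF \<epsilon>(1,2)] by blast
    let ?R = "hrefl e \<mu>"
    define y where "y = b + k *\<^sub>R (?R x - b)"
    have yfr: "y \<in> frontier \<Omega>" using yf by (simp add: y_def)
    obtain \<nu>x where \<nu>x: "norm \<nu>x = 1" "ball (x + r *\<^sub>R \<nu>x) r \<subseteq> \<Omega>" using interior_ball[OF x(1)] by blast
    obtain \<nu> where \<nu>: "norm \<nu> = 1" "ball (y + r *\<^sub>R \<nu>) r \<subseteq> \<Omega>" using interior_ball[OF yfr] by blast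
    have k0: "0 < k" "1 / 2 \<le> k" "Ca * (1 - k) \<le> 1 / 2" using k by auto
    have \<nu>eq: "\<nu> = hrefl e 0 \<nu>x"
      using inside by (intro contact_normal[OF e b(2) k0(1) y_def x(2) \<nu>x yfr \<nu>]) auto
    define d where "d = x \<bullet> e - \<mu>"
    have d: "d > 0" using x by (simp add: d_def)
    have d2D: "d \<le> 2 * D"
    proof -
      have "d = (x - b) \<bullet> e" using b by (simp add: d_def inner_diff_left)
      also have "\<dots> \<le> norm (x - b) * norm e" by (rule norm_cauchy_schwarz)
      also have "\<dots> \<le> 2 * D" using norm_diff_closure[of x b] frontierD[OF x(1)] b closure_subset e by auto
      finally show ?thesis .
    qed
    have gap: "(1 - k) * r0 * r \<le> d * (2 * d + 4 * D * (1 - k))"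
      unfolding d_def by (rule contact_gap[OF e b(2) bb r0 k0(2) k(2) y_def x \<nu>x yfr \<nu> \<nu>eq])
    have \<kappa>d: "1 - k \<le> \<eta> * d powr (1 + s)"
    proof (cases "d \<le> d1")
      case True
      have "d * (4 * D * (1 - k)) = (4 * D * d) * (1 - k)" by simp
      also have "\<dots> \<le> (r0 * r / 2) * (1 - k)"
      proof (rule mult_right_mono)
        have "4 * D * d \<le> 4 * D * d1" using True D_pos by simp
        then show "4 * D * d \<le> r0 * r / 2" using d1(2) by linarith
      qed (use k in simp)
      finally have "d * (4 * D * (1 - k)) \<le> (1 - k) * (r0 * r) / 2" by (simp add: mult_ac)
      moreover have "d * (2 * d + 4 * D * (1 - k)) = 2 * d\<^sup>2 + d * (4 * D * (1 - k))"
        by (simp add: distrib_left power2_eq_square)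
      moreover have "(1 - k) * r0 * r = (1 - k) * (r0 * r)" by simp
      ultimately have "(1 - k) * (r0 * r) \<le> 4 * d\<^sup>2" using gap by linarith
      also have "d\<^sup>2 = d powr (1 - s) * d powr (1 + s)"
        using d by (simp flip: powr_add)
      also have "4 * (d powr (1 - s) * d powr (1 + s)) \<le> 4 * ((\<eta> * r0 * r / 4) * d powr (1 + s))"
      proof -
        have "d powr (1 - s) \<le> d1 powr (1 - s)" using True d s by (intro powr_mono2) auto
        then have "d powr (1 - s) \<le> \<eta> * r0 * r / 4" using d1(3) by linarith
        then show ?thesis by (intro mult_left_mono mult_right_mono) auto
      qed
      finally have "(1 - k) * (r0 * r) \<le> (\<eta> * d powr (1 + s)) * (r0 * r)" by (simp add: mult_ac)
      then show ?thesis using r0 r_pos by simp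
    next
      case False
      have "1 - k \<le> \<eta> * d1 powr (1 + s)" using \<kappa> \<epsilon>X by linarith
      also have "\<dots> \<le> \<eta> * d powr (1 + s)" using False \<eta>(1) d1 s by (intro mult_left_mono powr_mono2) auto
      finally show ?thesis .
    qed
    define \<rho> where "\<rho> = \<rho>0 * d"
    have \<rho>: "\<rho> > 0" "\<rho> \<le> d / 8" "\<rho> \<le> r / 4" "2 * \<rho> \<le> rq"
    proof -
      show "\<rho> > 0" using \<rho>0 d by (simp add: \<rho>_def)
      show "\<rho> \<le> d / 8" using mult_right_mono[OF \<rho>0(2), of d] d by (simp add: \<rho>_def)
      have \<rho>2: "\<rho> \<le> \<rho>0 * (2 * D)" unfolding \<rho>_def using d2D \<rho>0 by (intro mult_left_mono) auto
      have "\<rho>0 * (2 * D) \<le> r / (8 * D) * (2 * D)" using \<rho>0 D_pos by (intro mult_right_mono) auto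
      also have "\<dots> = r / 4" using D_pos by simp
      finally show "\<rho> \<le> r / 4" using \<rho>2 by linarith
      have "\<rho>0 * (2 * D) \<le> rq / (4 * D) * (2 * D)" using \<rho>0 D_pos by (intro mult_right_mono) auto
      also have "\<dots> = rq / 2" using D_pos by simp
      finally show "2 * \<rho> \<le> rq" using \<rho>2 by linarith
    qed
    define h where "h = d / 4"
    define q where "q = y + \<rho> *\<^sub>R \<nu>"
    \<comment> \<open>The barrier takes at most a quarter of the gain G0 d; the equation takes at
      most another.\<close>
    define A where "A = G0 * d / (4 * (BV + 1))"
    have A: "A \<ge> 0" using G0 d BV by (simp add: A_def)
    have ye: "y \<bullet> e = \<mu> - k * d"
    proof -
      have "y \<bullet> e = b \<bullet> e + k * (?R x \<bullet> e - b \<bullet> e)" by (simp add: y_def inner_add_left inner_diff_left)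
      then show ?thesis by (simp add: b hrefl_inner[OF e] d_def algebra_simps)
    qed
    have cball_e: "w \<bullet> e \<le> \<mu> - h" if "w \<in> cball q \<rho>" for w
    proof -
      have "norm (w - y) \<le> norm (w - q) + norm (\<rho> *\<^sub>R \<nu>)"
        using norm_triangle_ineq[of "w - q" "\<rho> *\<^sub>R \<nu>"] by (simp add: q_def)
      also have "\<dots> \<le> 2 * \<rho>" using that \<nu> \<rho> by (simp add: dist_norm norm_minus_commute)
      finally have "norm (w - y) \<le> 2 * \<rho>" .
      moreover have "(w - y) \<bullet> e \<le> norm (w - y) * norm e" by (rule norm_cauchy_schwarz)
      ultimately have "w \<bullet> e \<le> y \<bullet> e + 2 * \<rho>" using e by (simp add: inner_diff_left)
      moreover have "d / 2 \<le> k * d" using mult_right_mono[OF k0(2), of d] d by simp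
      ultimately show ?thesis using ye \<rho>(2) by (simp add: h_def)
    qed
    define T where "T = 1 + 6 * (Ca * (1 - k))"
    have T1: "1 \<le> T" using Ca_nonneg k by (simp add: T_def)
    have lower: "A * ball_profile s q \<rho> w \<le> T * u w - u (dil b k (?R w))" if "w \<in> ball q \<rho>" for w
      unfolding T_def
    proof (rule hopf_lower[OF e b k0(2) k(2) k0(3), where Q=Q and ?c1.0=c1 and dQ=dQ and h=h and \<rho>=\<rho> and q=q and \<alpha>=\<alpha>])
      show "0 \<le> (1 + 6 * (Ca * (1 - k))) * u z - u (dil b k (?R z))" if "z \<bullet> e \<le> \<mu>" for z
        using hrefl_dil_le[OF e b k _ that] inside by simp
      show "Q \<in> sets borel" by (simp add: Q_def)
      show "z \<bullet> e \<le> \<mu> - dQ" if "z \<in> Q" for z using Qe[OF that] \<mu> \<epsilon>(3) by simp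
      show "c1 \<le> (1 + 6 * (Ca * (1 - k))) * u z - u (dil b k (?R z))" if "z \<in> Q" for z
      proof -
        have "norm (dil b k (?R z) - hrefl e m z) \<le> 2 * (m - \<mu>) + 2 * (1 - k) * (norm z + D)"
          using k \<mu> by (intro perturbed_reflection_close[OF e b]) auto
        also have "\<dots> \<le> 2 * \<epsilon> + 2 * (2 * \<epsilon> / r0) * (2 * D)"
          using \<mu> \<kappa> D_pos norm_\<Omega>[of z] Q\<Omega> that k \<epsilon>(1) r0 by (intro add_mono mult_mono) auto
        also have "\<dots> = \<epsilon> * X3" by (simp add: X3_def algebra_simps)
        finally have "norm (dil b k (?R z) - hrefl e m z) < \<delta>" using \<epsilon>X by simp
        from \<delta>(2)[OF this] have "u (dil b k (?R z)) < u (hrefl e m z) + c1" by linarith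
        moreover have "1 * u z \<le> T * u z" using T1 u_nonneg by (rule mult_right_mono)
        ultimately show ?thesis using QW[OF that] by (simp add: T_def)
      qed
      show "\<rho> \<le> h" using \<rho> d by (simp add: h_def)
      show "ball q \<rho> \<subseteq> \<Omega>" unfolding q_def using ball_subset_tangent[of \<nu> \<rho> r y] \<nu> \<rho> r_pos by (intro order_trans[OF _ \<nu>(2)]) auto
      show "dil b k (?R z) \<in> \<Omega>" if "z \<in> ball q \<rho>" for z
      proof (rule tangent_ball_pullback[OF e b(2) k0(1) y_def \<nu>x \<rho>(1)])
        have "1 / 2 * r \<le> k * r" using k r_pos by (intro mult_right_mono) auto
        then show "\<rho> \<le> k * r" using \<rho>(3) r_pos by linarith
      qed (use that in \<open>simp add: q_def \<nu>eq\<close>)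
      show "Q \<inter> ball q \<rho> = {}"
      proof (rule ccontr)
        assume "Q \<inter> ball q \<rho> \<noteq> {}"
        then obtain w where w: "w \<in> Q" "w \<in> ball q \<rho>" by blast
        have "dist q y = \<rho>" using \<nu> \<rho> by (simp add: q_def dist_norm)
        then have "dist w y < 2 * \<rho>" using w(2) dist_triangle[of w y q] by (simp add: dist_commute)
        then show False using Qfar[OF w(1) yfr] \<rho>(4) rq(1) by linarith
      qed
      show "A * (annulus_mass TYPE('a) * (3 / s + 1 / (1 - s)) / (2 * ln 2) + unit_ball_vol (real DIM('a)))
        + 32 * lam * (1 + M) * (1 - k) / cN < c1 * (4 * \<alpha> / ((5 * D)\<^sup>2) powr (\<alpha> + 1)) * h * dQ * measure lborel Q"
      proof -
        have "A * BV = G0 * d / 4 * (BV / (BV + 1))" by (simp add: A_def)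
        also have "\<dots> \<le> G0 * d / 4 * 1" using G0 d BV by (intro mult_left_mono) auto
        finally have 1: "A * BV \<le> G0 * d / 4" by simp
        define Z where "Z = 32 * lam * (1 + M) / cN"
        have Z: "Z \<ge> 0" using lam_nonneg M_nonneg cN_pos by (simp add: Z_def)
        have "Z * (1 - k) \<le> Z * (\<eta> * (d powr s * d))"
          using \<kappa>d Z d by (intro mult_left_mono) (auto simp: powr_add mult_ac)
        also have "\<dots> \<le> Z * (\<eta> * ((2 * D) powr s * d))"
          using Z \<eta> d d2D s by (intro mult_left_mono mult_right_mono powr_mono2) auto
        also have "\<dots> = \<eta> * (Z * (2 * D) powr s) * d" by simp
        also have "\<dots> \<le> \<eta> * X2 * d" using \<eta>(1) d by (intro mult_right_mono mult_left_mono) (auto simp: X2_def Z_def)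
        also have "\<dots> \<le> G0 / 4 * d" using \<eta>(3) d by (intro mult_right_mono) auto
        finally have 2: "32 * lam * (1 + M) * (1 - k) / cN \<le> G0 * d / 4" by (simp add: Z_def)
        have eq: "c1 * (4 * \<alpha> / ((5 * D)\<^sup>2) powr (\<alpha> + 1)) * h * dQ * measure lborel Q = G0 * d"
          by (simp add: G0_def ca_def h_def mQ_def)
        have "0 < G0 * d" using G0 d by simp
        then have "A * BV + 32 * lam * (1 + M) * (1 - k) / cN < G0 * d" using 1 2 by linarith
        then show ?thesis unfolding eq BV_def .
      qed
    qed (use Q\<Omega> dQ c1 \<rho> cball_e A \<alpha>_def that in auto)
    \<comment> \<open>Divide by \<sigma>^s along the normal at y. There u has trace C0, whereas the
      copy, which is u at x + (\<sigma>/k) \<nu>x, has trace C0/k^s.\<close>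
    have "A * \<rho> powr s \<le> T * C0 - C0 / k powr s"
    proof (rule tendsto_le[OF trivial_limit_at_right_real])
      have t1: "((\<lambda>\<sigma>. u (y + \<sigma> *\<^sub>R \<nu>) / \<sigma> powr s) \<longlongrightarrow> C0) (at_right 0)" by (rule trace_normal[OF yfr \<nu>])
      have t2: "((\<lambda>\<sigma>. u (x + \<sigma> *\<^sub>R \<nu>x) / \<sigma> powr s) \<longlongrightarrow> C0) (at_right 0)" by (rule trace_normal[OF x(1) \<nu>x])
      have "filterlim (\<lambda>\<sigma>. \<sigma> / k) (at_right 0) (at_right 0)"
        unfolding filterlim_at using k0 by (auto intro!: tendsto_eq_intros eventually_mono[OF eventually_at_right_less])
      from filterlim_compose[OF t2 this]
      have t3: "((\<lambda>\<sigma>. u (x + (\<sigma> / k) *\<^sub>R \<nu>x) / (\<sigma> / k) powr s) \<longlongrightarrow> C0) (at_right 0)" .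
      show "((\<lambda>\<sigma>. T * (u (y + \<sigma> *\<^sub>R \<nu>) / \<sigma> powr s) - (u (x + (\<sigma> / k) *\<^sub>R \<nu>x) / (\<sigma> / k) powr s) / k powr s) \<longlongrightarrow> T * C0 - C0 / k powr s) (at_right 0)"
        by (intro tendsto_intros t1 t3) (use k0 in auto)
      show "((\<lambda>\<sigma>. A * \<rho> powr s) \<longlongrightarrow> A * \<rho> powr s) (at_right 0)" by simp
      have "eventually (\<lambda>\<sigma>. \<sigma> \<in> {0<..<\<rho>}) (at_right 0)" using \<rho>(1) by (rule eventually_at_right_real)
      then show "eventually (\<lambda>\<sigma>. A * \<rho> powr s \<le> T * (u (y + \<sigma> *\<^sub>R \<nu>) / \<sigma> powr s) - (u (x + (\<sigma> / k) *\<^sub>R \<nu>x) / (\<sigma> / k) powr s) / k powr s) (at_right 0)"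
      proof eventually_elim
        case (elim \<sigma>)
        then have \<sigma>: "0 < \<sigma>" "\<sigma> < \<rho>" by auto
        define w where "w = y + \<sigma> *\<^sub>R \<nu>"
        have nw: "norm (w - q) = \<rho> - \<sigma>"
        proof -
          have "w - q = (\<sigma> - \<rho>) *\<^sub>R \<nu>" by (simp add: w_def q_def algebra_simps)
          then show ?thesis using \<sigma> \<nu> by simp
        qed
        then have wb: "w \<in> ball q \<rho>" using \<sigma> by (simp add: dist_norm norm_minus_commute)
        have "\<rho> * \<sigma> \<le> \<rho>\<^sup>2 - (\<rho> - \<sigma>)\<^sup>2"
        proof -
          have "\<sigma> * \<sigma> \<le> \<rho> * \<sigma>" using \<sigma> by (intro mult_right_mono) auto
          then show ?thesis by (simp add: power2_eq_square algebra_simps)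
        qed
        then have "(\<rho> * \<sigma>) powr s \<le> ball_profile s q \<rho> w"
          unfolding ball_profile_def nw using s \<rho> \<sigma> by (intro powr_mono2) auto
        then have "A * (\<rho> powr s * \<sigma> powr s) \<le> A * ball_profile s q \<rho> w"
          using A \<rho> \<sigma> by (intro mult_left_mono) (auto simp: powr_mult)
        also have "\<dots> \<le> T * u w - u (dil b k (?R w))" by (rule lower[OF wb])
        also have "dil b k (?R w) = x + (\<sigma> / k) *\<^sub>R \<nu>x"
        proof -
          have "y = dil b (inverse k) (?R x)" by (simp add: y_def dil_inverse_eq)
          then have Ry: "dil b k (?R y) = x" using k0 e by (simp add: hrefl_dil[OF b(2)] dil_inverse)
          have "?R w = ?R y + \<sigma> *\<^sub>R \<nu>x" unfolding w_def hrefl_affine by (simp add: hrefl_0_scaleR e \<nu>eq)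
          then have "dil b k (?R w) - dil b k (?R y) = (\<sigma> / k) *\<^sub>R \<nu>x" by (simp add: dil_diff divide_inverse mult.commute)
          then show ?thesis by (simp add: Ry algebra_simps)
        qed
        finally have fin: "A * \<rho> powr s * \<sigma> powr s \<le> T * u w - u (x + (\<sigma> / k) *\<^sub>R \<nu>x)" by simp
        have "(u (x + (\<sigma> / k) *\<^sub>R \<nu>x) / (\<sigma> / k) powr s) / k powr s = u (x + (\<sigma> / k) *\<^sub>R \<nu>x) / \<sigma> powr s"
          using \<sigma> k0 by (simp add: powr_divide)
        moreover have "A * \<rho> powr s \<le> (T * u w - u (x + (\<sigma> / k) *\<^sub>R \<nu>x)) / \<sigma> powr s"
          using fin \<sigma> by (simp add: pos_le_divide_eq)
        ultimately show ?case unfolding w_def by (simp only: diff_divide_distrib times_divide_eq_right)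
      qed
    qed
    \<comment> \<open>T and 1/k^s both equal 1 up to O(1 - k), so C0 itself cancels.\<close>
    also have "T * C0 - C0 / k powr s = C0 * (T - 1 / k powr s)" by (simp add: algebra_simps)
    also have "\<dots> \<le> \<bar>C0\<bar> * \<bar>T - 1 / k powr s\<bar>" by (metis abs_ge_self abs_mult)
    also have "\<dots> \<le> \<bar>C0\<bar> * ((6 * Ca + 8) * (1 - k))"
    proof (rule mult_left_mono)
      have "1 / k powr s \<le> k powr (- 2 * s)"
      proof -
        have "k powr (- s) \<le> k powr (- 2 * s)" using k0 k s by (intro powr_mono') auto
        then show ?thesis by (simp add: powr_minus_divide)
      qed
      also have "\<dots> \<le> 1 + 8 * (1 - k)" using k0 k s by (intro powr_minus_two_le) auto
      finally have 1: "1 / k powr s \<le> 1 + 8 * (1 - k)" .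
      have "k powr s \<le> 1 powr s" using k0 k s by (intro powr_mono2) auto
      then have 2: "1 \<le> 1 / k powr s" using k0 by simp
      have 3: "(6 * Ca + 8) * (1 - k) = 6 * (Ca * (1 - k)) + 8 * (1 - k)" by (simp add: algebra_simps)
      have 4: "0 \<le> Ca * (1 - k)" using Ca_nonneg k by simp
      show "\<bar>T - 1 / k powr s\<bar> \<le> (6 * Ca + 8) * (1 - k)"
        unfolding 3 T_def using 1 2 4 k(2) by linarith
    qed simp
    also have "\<dots> = (\<bar>C0\<bar> * (6 * Ca + 8)) * (1 - k)" by simp
    also have "\<dots> \<le> X1 * (1 - k)" using k by (intro mult_right_mono) (auto simp: X1_def)
    also have "\<dots> \<le> X1 * (\<eta> * d powr (1 + s))" using \<kappa>d X1 by (intro mult_left_mono) auto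
    also have "\<dots> = (\<eta> * X1) * d powr (1 + s)" by simp
    also have "\<dots> < cs * d powr (1 + s)" using \<eta>(2) d by (intro mult_strict_right_mono) auto
    also have "\<dots> = A * \<rho> powr s"
      using d \<rho>0 by (simp add: cs_def A_def \<rho>_def powr_mult powr_add)
    finally show False by simp
  qed
  then show ?thesis by blast
qed

end

section \<open>Symmetry in every direction\<close>

text \<open>A positive t would carry points near \<open>Sup X\<close> beyond it. Applied to the
  heights of \<Omega>, this forces all symmetry planes through one centre.\<close>

lemma shift_invariant_imp_nonpos:
  fixes X :: "real set"
  assumes "X \<noteq> {}" "bdd_above X" "\<And>x. x \<in> X \<Longrightarrow> x + t \<in> X"
  shows "t \<le> 0"
proof -
  have "Sup X \<le> Sup X - t"
  proof (rule cSup_least[OF assms(1)])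
    fix x assume "x \<in> X"
    then have "x + t \<le> Sup X" using assms by (intro cSup_upper) auto
    then show "x \<le> Sup X - t" by simp
  qed
  then show ?thesis by simp
qed

text \<open>The directions are orthogonal, so each reflection leaves the other coordinates alone and
  the displacements add up. For all of \<open>Basis\<close> the result is a point
  reflection.\<close>

lemma hrefl_Basis_invariant:
  fixes \<Omega> :: "'a::euclidean_space set" and m :: "'a \<Rightarrow> real"
  assumes inv: "\<And>i z. i \<in> Basis \<Longrightarrow> z \<in> \<Omega> \<Longrightarrow> hrefl i (m i) z \<in> \<Omega>" and "finite S" "S \<subseteq> Basis" "x \<in> \<Omega>"
  shows "x - (\<Sum>i\<in>S. (2 * (x \<bullet> i - m i)) *\<^sub>R i) \<in> \<Omega>"
  using assms(2,3)
proof (induction S rule: finite_induct)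
  case empty
  then show ?case using \<open>x \<in> \<Omega>\<close> by simp
next
  case (insert i S)
  define w where "w = x - (\<Sum>i\<in>S. (2 * (x \<bullet> i - m i)) *\<^sub>R i)"
  have w: "w \<in> \<Omega>" using insert by (simp add: w_def)
  have "(\<Sum>j\<in>S. (2 * (x \<bullet> j - m j)) *\<^sub>R j) \<bullet> i = 0"
    using insert by (auto simp: inner_sum_left inner_Basis intro!: sum.neutral)
  then have "w \<bullet> i = x \<bullet> i" by (simp add: w_def inner_diff_left)
  then have "hrefl i (m i) w = x - (\<Sum>j\<in>insert i S. (2 * (x \<bullet> j - m j)) *\<^sub>R j)"
    using insert by (simp add: hrefl_def w_def algebra_simps)
  moreover have "hrefl i (m i) w \<in> \<Omega>" using inv w insert by simp
  ultimately show ?case by simp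
qed

text \<open>Coordinate reflections compose to the point reflection at c. Composing it with the
  reflection for e shifts heights along e, so boundedness puts every symmetry plane through c. Two
  points equally far from c are mirror images in such a plane, so membership depends on the distance
  to c alone.\<close>

lemma ball_if_reflection_symmetric:
  fixes \<Omega> :: "'a::euclidean_space set"
  assumes "open \<Omega>" "convex \<Omega>" "bounded \<Omega>" "\<Omega> \<noteq> {}"
    and sym: "\<And>e::'a. norm e = 1 \<Longrightarrow> \<exists>m. \<forall>z\<in>\<Omega>. hrefl e m z \<in> \<Omega>"
  shows "\<exists>c R. \<Omega> = ball c R"
proof -
  obtain m where m: "\<And>e z. norm (e::'a) = 1 \<Longrightarrow> z \<in> \<Omega> \<Longrightarrow> hrefl e (m e) z \<in> \<Omega>" using sym by metis
  define c where "c = (\<Sum>i\<in>Basis. m i *\<^sub>R i)"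
  have point: "2 *\<^sub>R c - x \<in> \<Omega>" if "x \<in> \<Omega>" for x
  proof -
    have "x - (\<Sum>i\<in>Basis. (2 * (x \<bullet> i - m i)) *\<^sub>R i) \<in> \<Omega>"
      using m that by (intro hrefl_Basis_invariant) auto
    moreover have "(\<Sum>i\<in>Basis. (2 * (x \<bullet> i - m i)) *\<^sub>R i) = 2 *\<^sub>R x - 2 *\<^sub>R c"
    proof -
      have "(\<Sum>i\<in>Basis. (2 * (x \<bullet> i - m i)) *\<^sub>R i) = 2 *\<^sub>R ((\<Sum>i\<in>Basis. (x \<bullet> i) *\<^sub>R i) - c)"
        by (simp add: c_def scaleR_sum_right scaleR_diff_left scaleR_diff_right sum_subtractf right_diff_distrib)
      then show ?thesis by (simp add: euclidean_representation scaleR_diff_right)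
    qed
    ultimately have "x - (2 *\<^sub>R x - 2 *\<^sub>R c) \<in> \<Omega>" by (simp only:)
    moreover have "x - (2 *\<^sub>R x - 2 *\<^sub>R c) = 2 *\<^sub>R c - x" by (simp add: algebra_simps scaleR_2)
    ultimately show ?thesis by (simp only:)
  qed
  have mc: "m e = c \<bullet> e" if e: "norm e = 1" for e
  proof -
    define X where "X = (\<lambda>x. x \<bullet> e) ` \<Omega>"
    have X: "X \<noteq> {}" "bdd_above X"
    proof -
      show "X \<noteq> {}" using assms(4) by (simp add: X_def)
      have "bounded X" unfolding X_def using assms(3) by (intro bounded_linear_image bounded_linear_inner_left)
      then show "bdd_above X" by (rule bounded_imp_bdd_above)
    qed
    have "2 * (m e - c \<bullet> e) \<le> 0"
    proof (rule shift_invariant_imp_nonpos[OF X])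
      fix t assume "t \<in> X"
      then obtain x where x: "x \<in> \<Omega>" "t = x \<bullet> e" by (auto simp: X_def)
      have "hrefl e (m e) (2 *\<^sub>R c - x) \<bullet> e = t + 2 * (m e - c \<bullet> e)"
        unfolding hrefl_inner[OF e] by (simp add: x inner_diff_left algebra_simps)
      moreover have "hrefl e (m e) (2 *\<^sub>R c - x) \<in> \<Omega>" using m[OF e point[OF x(1)]] .
      ultimately show "t + 2 * (m e - c \<bullet> e) \<in> X" unfolding X_def by (metis imageI)
    qed
    moreover have "2 * (c \<bullet> e - m e) \<le> 0"
    proof (rule shift_invariant_imp_nonpos[OF X])
      fix t assume "t \<in> X"
      then obtain x where x: "x \<in> \<Omega>" "t = x \<bullet> e" by (auto simp: X_def)
      have "(2 *\<^sub>R c - hrefl e (m e) x) \<bullet> e = t + 2 * (c \<bullet> e - m e)"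
        by (simp add: x inner_diff_left hrefl_inner[OF e] algebra_simps)
      moreover have "2 *\<^sub>R c - hrefl e (m e) x \<in> \<Omega>" using point[OF m[OF e x(1)]] .
      ultimately show "t + 2 * (c \<bullet> e - m e) \<in> X" unfolding X_def by (metis imageI)
    qed
    ultimately show ?thesis by simp
  qed
  have rad: "z \<in> \<Omega>" if x: "x \<in> \<Omega>" and eq: "norm (z - c) = norm (x - c)" for x z
  proof (cases "x = z")
    case False
    define e where "e = (x - z) /\<^sub>R norm (x - z)"
    have e: "norm e = 1" using False by (simp add: e_def)
    have n0: "norm (x - z) \<noteq> 0" using False by simp
    have "(norm (z - c))\<^sup>2 = (norm (x - c))\<^sup>2" using eq by simp
    moreover have "z - c = (x - c) + (- norm (x - z)) *\<^sub>R e" using n0 by (simp add: e_def)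
    ultimately have "2 * (- norm (x - z)) * ((x - c) \<bullet> e) + (norm (x - z))\<^sup>2 = 0"
      using norm_add_scaleR_sq[OF e, of "x - c" "- norm (x - z)"] by simp
    then have "norm (x - z) * (norm (x - z) - 2 * ((x - c) \<bullet> e)) = 0" by (simp add: power2_eq_square algebra_simps)
    then have "2 * ((x - c) \<bullet> e) = norm (x - z)" using n0 by simp
    then have "hrefl e (m e) x = x - norm (x - z) *\<^sub>R e" by (simp add: hrefl_def mc[OF e] inner_diff_left)
    also have "\<dots> = z" using n0 by (simp add: e_def)
    finally show ?thesis using m[OF e x] by simp
  qed (use x in simp)
  have c\<Omega>: "c \<in> \<Omega>"
  proof -
    obtain x where x: "x \<in> \<Omega>" using assms(4) by blast
    have "(1 - 1/2) *\<^sub>R x + (1/2) *\<^sub>R (2 *\<^sub>R c - x) \<in> \<Omega>" using x point[OF x] assms(2) by (intro convexD_alt) auto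
    then show ?thesis by (simp add: algebra_simps)
  qed
  define N where "N = (\<lambda>x. norm (x - c)) ` \<Omega>"
  have N: "N \<noteq> {}" "bdd_above N"
  proof -
    show "N \<noteq> {}" using assms(4) by (simp add: N_def)
    obtain B where B: "\<And>x. x \<in> \<Omega> \<Longrightarrow> norm x \<le> B" using assms(3) unfolding bounded_iff by blast
    have "norm (x - c) \<le> B + norm c" if "x \<in> \<Omega>" for x using B[OF that] norm_triangle_ineq4[of x c] by linarith
    then show "bdd_above N" by (auto simp: N_def bdd_above_def)
  qed
  define R where "R = Sup N"
  have "\<Omega> = ball c R"
  proof (intro equalityI subsetI)
    fix x assume x: "x \<in> \<Omega>"
    obtain \<delta> where \<delta>: "\<delta> > 0" "ball x \<delta> \<subseteq> \<Omega>" using x assms(1) openE by blast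
    \<comment> \<open>By openness some point of \<Omega> is strictly farther from c than x, so the
      supremum R is not attained.\<close>
    obtain f :: 'a where f: "norm f = 1" "norm (x - c) < norm (x + (\<delta> / 2) *\<^sub>R f - c)"
    proof (cases "x = c")
      case True
      obtain f :: 'a where "norm f = 1" using vector_choose_size[of 1] by auto
      then show ?thesis using that[of f] True \<delta> by simp
    next
      case False
      define f where "f = (x - c) /\<^sub>R norm (x - c)"
      have "x + (\<delta> / 2) *\<^sub>R f - c = (1 + (\<delta> / 2) / norm (x - c)) *\<^sub>R (x - c)"
      proof -
        define \<tau> where "\<tau> = (\<delta> / 2) / norm (x - c)"
        have "(\<delta> / 2) *\<^sub>R f = \<tau> *\<^sub>R (x - c)" unfolding f_def \<tau>_def scaleR_scaleR divide_inverse ..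
        then show ?thesis unfolding \<tau>_def[symmetric] by (simp add: algebra_simps)
      qed
      then have "norm (x + (\<delta> / 2) *\<^sub>R f - c) = (1 + (\<delta> / 2) / norm (x - c)) * norm (x - c)"
        using \<delta> by simp
      then have "norm (x + (\<delta> / 2) *\<^sub>R f - c) = norm (x - c) + \<delta> / 2" using False by (simp add: distrib_right)
      moreover have "norm f = 1" using False by (simp add: f_def)
      ultimately show ?thesis using \<delta>(1) by (intro that[of f]) auto
    qed
    have "x + (\<delta> / 2) *\<^sub>R f \<in> ball x \<delta>" using \<delta> f by (simp add: dist_norm)
    then have "norm (x + (\<delta> / 2) *\<^sub>R f - c) \<in> N" using \<delta> by (auto simp: N_def)
    then have "norm (x + (\<delta> / 2) *\<^sub>R f - c) \<le> R" unfolding R_def using N by (intro cSup_upper)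
    then show "x \<in> ball c R" using f by (simp add: dist_norm norm_minus_commute)
  next
    fix z assume "z \<in> ball c R"
    then have "norm (z - c) < Sup N" by (simp add: R_def dist_norm norm_minus_commute)
    then obtain x where x: "x \<in> \<Omega>" "norm (z - c) < norm (x - c)"
      using less_cSup_iff[OF N] by (auto simp: N_def)
    show "z \<in> \<Omega>"
    proof (cases "z = c")
      case False
      \<comment> \<open>z is a convex combination of c and the point w on its ray that is as far
        from c as x; w belongs to \<Omega> by \<open>rad\<close>.\<close>
      define t where "t = norm (z - c) / norm (x - c)"
      have n: "0 < norm (z - c)" using False by simp
      have n': "0 < norm (x - c)" using n x(2) by linarith
      have t: "0 < t" "t \<le> 1" unfolding t_def using n n' x(2) by (simp_all only: divide_pos_pos pos_divide_le_eq)
      define w where "w = c + (1 / t) *\<^sub>R (z - c)"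
      have "norm (w - c) = norm (x - c)" using n t x by (simp add: w_def t_def)
      then have "w \<in> \<Omega>" using rad[OF x(1)] by simp
      then have "(1 - t) *\<^sub>R c + t *\<^sub>R w \<in> \<Omega>" using c\<Omega> assms(2) t by (intro convexD_alt) auto
      moreover have "(1 - t) *\<^sub>R c + t *\<^sub>R w = z" using t by (simp add: w_def algebra_simps)
      ultimately show ?thesis by simp
    qed (use c\<Omega> in simp)
  qed
  then show ?thesis by blast
qed

theorem theorem1p1:
  fixes \<Omega> :: "'a::euclidean_space set" and u :: "'a \<Rightarrow> real" and s p C0 :: real
  assumes "0 < s" "s < 1" "1 \<le> p" "p \<le> 2"
    and "bounded \<Omega>" "open \<Omega>" "convex \<Omega>" "C11_boundary \<Omega>"
    and "continuous_on UNIV u"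
    and "\<forall>x. 0 \<le> u x" "\<exists>x. u x \<noteq> 0"
    and "\<forall>x\<in>\<Omega>. frac_lap_pv s u x (lambda_sp s p \<Omega> * rpow (u x) (p - 1))"
    and "\<forall>x. x \<notin> \<Omega> \<longrightarrow> u x = 0"
    and "\<forall>x0\<in>frontier \<Omega>. ((\<lambda>x. u x / bdist \<Omega> x powr s) \<longlongrightarrow> C0) (at x0 within \<Omega>)"
  shows "\<exists>c r. \<Omega> = ball c r"
proof -
  obtain D where D: "\<Omega> \<subseteq> ball 0 D" using bounded_subset_ballD[OF assms(5), of 0] by blast
  obtain M where M: "\<And>x. u x \<le> M"
  proof -
    have "compact (u ` closure \<Omega>)"
      using assms(5,9) continuous_on_subset by (intro compact_continuous_image) auto
    then have "bounded (u ` closure \<Omega>)" by (rule compact_imp_bounded)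
    then obtain B where B: "\<And>y. y \<in> u ` closure \<Omega> \<Longrightarrow> \<bar>y\<bar> \<le> B"
      unfolding bounded_iff real_norm_def by blast
    have "u x \<le> max 0 B" for x
    proof (cases "x \<in> \<Omega>")
      case True
      then have "u x \<in> u ` closure \<Omega>" using closure_subset by blast
      then show ?thesis using B by fastforce
    qed (use assms(13) in auto)
    then show ?thesis using that by blast
  qed
  obtain r where r: "0 < r" "\<And>y. y \<in> frontier \<Omega> \<Longrightarrow> \<exists>\<nu>. norm \<nu> = 1 \<and> ball (y + r *\<^sub>R \<nu>) r \<subseteq> \<Omega>"
    using C11_interior_ball[OF assms(6,5,8)] by blast
  interpret overdetermined \<Omega> u s p "lambda_sp s p \<Omega>" D M "frac_const DIM('a) s" "1 / (5 * D) powr (real DIM('a) + 2 * s)" r C0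
    by unfold_locales (use assms D M r in auto)
  have "\<exists>m. \<forall>z\<in>\<Omega>. hrefl e m z \<in> \<Omega>" if e: "norm e = 1" for e :: 'a
  proof -
    obtain m where m: "\<And>z. u (hrefl e m z) = u z" using reflection_symmetric[OF e] by blast
    \<comment> \<open>\<Omega> is the positivity set of u and inherits its symmetry.\<close>
    then have "hrefl e m z \<in> \<Omega>" if "z \<in> \<Omega>" for z using u_pos[OF that] u_outside[of "hrefl e m z"] by fastforce
    then show ?thesis by blast
  qed
  then show ?thesis using assms(5,6,7) \<Omega>_nonempty by (intro ball_if_reflection_symmetric) auto
qed

end
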